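(* Let $\pi^X\propto\exp(-f)$ be a probability distribution on $\mathbb{R}^d$ satisfying the log-Sobolev inequality with constant $\alpha>0$ ($\alpha$-LSI). For any $\eta>0$, any initial distribution $\rho_0^X$ and any integer $k\ge 0$, the law $\rho_k^X$ of the $k$-th iterate of the proximal sampler with target $\pi^X$ and step size $\eta$ satisfies $$H_{\pi^X}(\rho_k^X)\le\frac{H_{\pi^X}(\rho_0^X)}{(1+\alpha\eta)^{2k}}.$$ Furthermore, for all $q\ge1$, $$R_{q,\pi^X}(\rho_k^X)\le\frac{R_{q,\pi^X}(\rho_0^X)}{(1+\alpha\eta)^{2k/q}}.$$
   Context: Probability measures are identified with their Lebesgue densities when these exist. The target $\pi^X\propto \exp(-f)$, $f:\mathbb{R}^d\to\mathbb{R}$, is assumed to have finite second moment. Proximal sampler with step size $\eta>0$: define the joint probability density on $\mathbb{R}^d\times\mathbb{R}^d$ by $\pi(x,y)\propto \exp(-f(x)-\frac{1}{2\eta}\|x-y\|^2)$. Its conditionals are $\pi^{Y\mid X}(\cdot\mid x)=\mathcal N(x,\eta I)$ and $\pi^{X\mid Y}(x\mid y)\propto_x \exp(-f(x)-\frac1{2\eta}\|x-y\|^2)$, and its $X$-marginal is $\pi^X$. Starting from $x_0\sim\rho_0^X$, for $k=0,1,2,\dots$: draw $y_k\mid x_k\sim\pi^{Y\mid X}(\cdot\mid x_k)$, then draw $x_{k+1}\mid y_k\sim \pi^{X\mid Y}(\cdot\mid y_k)$ (exactly). $\rho_k^X$ denotes the law of $x_k$. For $\rho\ll\pi$: KL divergence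 $H_\pi(\rho)=\int\rho\log\frac\rho\pi$; Rényi divergence of order $q>1$: $R_{q,\pi}(\rho)=\frac1{q-1}\log\int\frac{\rho^q}{\pi^{q-1}}$; and $R_{1,\pi}=H_\pi$. (These are $+\infty$ if $\rho\not\ll\pi$.) Log-Sobolev inequality: $\pi$ satisfies $\alpha$-LSI if for any probability distribution $\rho$ (with smooth relative density $\rho/\pi$), $H_\pi(\rho)\le\frac{1}{2\alpha}J_\pi(\rho)$, where $J_\pi(\rho)=\int\rho\,\|\nabla\log\frac\rho\pi\|^2$ is the Fisher information. *)

theory Defs
  imports "HOL-Probability.Probability"
begin

section \<open>Divergences\<close>

text \<open>
  Both divergences take the reference measure first. The library's \<^const>\<open>KL_divergence\<close> is
  a Bochner integral, hence \<open>0\<close> when the integral diverges. The negative part of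
  \<open>ln (d\<rho>/d\<pi>)\<close> is always \<open>\<rho>\<close>-integrable, since \<open>u * ln u \<ge> - exp (- 1)\<close>, so
  non-integrability means exactly that the divergence is \<open>\<infinity>\<close>.
\<close>

definition KL :: "'a measure \<Rightarrow> 'a measure \<Rightarrow> ereal" where
  "KL \<pi> \<rho> =
     (if absolutely_continuous \<pi> \<rho> \<and> integrable \<rho> (entropy_density (exp 1) \<pi> \<rho>)
      then ereal (KL_divergence (exp 1) \<pi> \<rho>) else \<infinity>)"

text \<open>
  In terms of Lebesgue densities, \<open>\<integral> \<rho>\<^sup>q / \<pi>\<^bsup>q - 1\<^esup> = \<integral> (d\<rho>/d\<pi>)\<^sup>q d\<pi>\<close>. Only orders
  \<open>q \<ge> 1\<close> are meaningful.
\<close>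

definition renyi :: "real \<Rightarrow> 'a measure \<Rightarrow> 'a measure \<Rightarrow> ereal" where
  "renyi q \<pi> \<rho> =
     (if q = 1 then KL \<pi> \<rho>
      else if \<not> absolutely_continuous \<pi> \<rho> then \<infinity>
      else let I = (\<integral>\<^sup>+ x. ennreal (enn2real (RN_deriv \<pi> \<rho> x) powr q) \<partial>\<pi>)
           in if I = \<infinity> then \<infinity> else ereal (1 / (q - 1) * ln (enn2real I)))"


section \<open>Log-Sobolev inequality\<close>

primrec C_k :: "nat \<Rightarrow> ('a::euclidean_space \<Rightarrow> real) \<Rightarrow> bool" where
  "C_k 0 g \<longleftrightarrow> continuous_on UNIV g"
| "C_k (Suc k) g \<longleftrightarrow> (\<forall>x. g differentiable (at x)) \<and>
     (\<forall>b\<in>Basis. C_k k (\<lambda>x. frechet_derivative g (at x) b))"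

definition smooth :: "('a::euclidean_space \<Rightarrow> real) \<Rightarrow> bool" where
  "smooth g \<longleftrightarrow> (\<forall>k. C_k k g)"

definition grad :: "('a::euclidean_space \<Rightarrow> real) \<Rightarrow> 'a \<Rightarrow> 'a" where
  "grad g x = (SOME D. GDERIV g x :> D)"

text \<open>
  Fisher information, relative to \<open>\<pi>\<close>, of the measure \<open>\<rho> = density \<pi> g\<close>; the
  factor \<open>g x\<close> removes the points with \<open>g x = 0\<close>, where \<open>ln (g x)\<close> is meaningless.
\<close>

definition fisher_information :: "'a::euclidean_space measure \<Rightarrow> ('a \<Rightarrow> real) \<Rightarrow> ennreal" where
  "fisher_information \<pi> g =
     (\<integral>\<^sup>+ x. ennreal (g x * (norm (grad (\<lambda>z. ln (g z)) x))\<^sup>2) \<partial>\<pi>)"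

definition LSI :: "real \<Rightarrow> 'a::euclidean_space measure \<Rightarrow> bool" where
  "LSI \<alpha> \<pi> \<longleftrightarrow>
     (\<forall>g. smooth g \<and> (\<forall>x. 0 \<le> g x) \<and> prob_space (density \<pi> g) \<longrightarrow>
        KL \<pi> (density \<pi> g) \<le> ereal (1 / (2 * \<alpha>)) * enn2ereal (fisher_information \<pi> g))"


section \<open>The proximal sampler\<close>

text \<open>The probability measure with Lebesgue density proportional to \<open>w\<close>.\<close>

definition propto :: "('a::euclidean_space \<Rightarrow> real) \<Rightarrow> 'a measure" where
  "propto w = density lborel (\<lambda>x. ennreal (w x / (\<integral>z. w z \<partial>lborel)))"

definition target :: "('a::euclidean_space \<Rightarrow> real) \<Rightarrow> 'a measure" where
  "target f = propto (\<lambda>x. exp (- f x))"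

text \<open>
  The unnormalised joint density of \<open>(x, y)\<close>. The two conditionals are obtained by normalising
  its sections; \<open>prox_Y_given_X_eq_normal\<close> below identifies the first one with the Gaussian
  \<open>N(x, \<eta> I)\<close>.
\<close>

definition prox_joint :: "('a::euclidean_space \<Rightarrow> real) \<Rightarrow> real \<Rightarrow> 'a \<Rightarrow> 'a \<Rightarrow> real" where
  "prox_joint f \<eta> x y = exp (- f x - 1 / (2 * \<eta>) * (norm (x - y))\<^sup>2)"

definition prox_Y_given_X :: "('a::euclidean_space \<Rightarrow> real) \<Rightarrow> real \<Rightarrow> 'a \<Rightarrow> 'a measure" where
  "prox_Y_given_X f \<eta> x = propto (\<lambda>y. prox_joint f \<eta> x y)"

definition prox_X_given_Y :: "('a::euclidean_space \<Rightarrow> real) \<Rightarrow> real \<Rightarrow> 'a \<Rightarrow> 'a measure" where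
  "prox_X_given_Y f \<eta> y = propto (\<lambda>x. prox_joint f \<eta> x y)"

primrec prox_law ::
  "('a::euclidean_space \<Rightarrow> real) \<Rightarrow> real \<Rightarrow> 'a measure \<Rightarrow> nat \<Rightarrow> 'a measure" where
  "prox_law f \<eta> \<rho>\<^sub>0 0 = \<rho>\<^sub>0"
| "prox_law f \<eta> \<rho>\<^sub>0 (Suc k) =
     (prox_law f \<eta> \<rho>\<^sub>0 k \<bind> prox_Y_given_X f \<eta>) \<bind> prox_X_given_Y f \<eta>"


subsection \<open>The conditionals are Markov kernels\<close>

lemma sets_propto [simp, measurable_cong]: "sets (propto w) = sets borel"
  by (simp add: propto_def)

lemma space_propto [simp]: "space (propto w) = UNIV"
  by (simp add: propto_def)

lemma propto_mult:
  assumes "c \<noteq> 0" shows "propto (\<lambda>x. c * w x) = propto w"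
  using assms by (simp add: propto_def)

lemma prob_space_propto:
  fixes w :: "'a::euclidean_space \<Rightarrow> real"
  assumes "integrable lborel w" and pos: "\<And>x. 0 < w x"
  shows "prob_space (propto w)"
proof -
  let ?Z = "\<integral>z. w z \<partial>lborel"
  have [measurable]: "w \<in> borel_measurable borel"
    using assms(1) by auto
  have Z: "(\<integral>\<^sup>+ x. ennreal (w x) \<partial>lborel) = ennreal ?Z"
    by (rule nn_integral_eq_integral[OF assms(1)]) (auto intro: less_imp_le pos)
  have "?Z \<noteq> 0"
  proof
    assume "?Z = 0"
    then have "(\<integral>\<^sup>+ x. ennreal (w x) \<partial>lborel) = 0"
      using Z by simp
    then have "AE x in lborel. ennreal (w x) = 0"
      by (subst (asm) nn_integral_0_iff_AE) auto
    then have "AE x in (lborel :: 'a measure). False"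
      by eventually_elim (metis ennreal_eq_0_iff not_le pos)
    then show False
      by (simp add: AE_iff_measurable[OF _ refl] emeasure_lborel_UNIV)
  qed
  moreover have "0 \<le> ?Z"
    by (intro integral_nonneg_AE) (auto intro: less_imp_le pos)
  ultimately have Zpos: "0 < ?Z" by simp
  have "emeasure (propto w) UNIV = (\<integral>\<^sup>+ x. ennreal (w x / ?Z) \<partial>lborel)"
    by (simp add: propto_def emeasure_density)
  also have "\<dots> = (\<integral>\<^sup>+ x. ennreal (w x) / ennreal ?Z \<partial>lborel)"
    using Zpos pos by (simp add: divide_ennreal less_imp_le)
  also have "\<dots> = ennreal ?Z / ennreal ?Z"
    by (simp add: nn_integral_divide Z)
  also have "\<dots> = 1"
    using Zpos by (simp add: divide_ennreal)
  finally show ?thesis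
    by (intro prob_spaceI) simp
qed

lemma prox_Y_given_X_eq_normal:
  fixes f :: "'a::euclidean_space \<Rightarrow> real"
  assumes "0 < \<eta>"
  shows "prox_Y_given_X f \<eta> x =
    density lborel (\<lambda>y. ennreal (\<Prod>b\<in>Basis. normal_density (x \<bullet> b) (sqrt \<eta>) (y \<bullet> b)))"
proof -
  let ?N = "\<lambda>y::'a. \<Prod>b\<in>Basis. normal_density (x \<bullet> b) (sqrt \<eta>) (y \<bullet> b)"
  define c where "c = (1 / sqrt (2 * pi * \<eta>)) ^ DIM('a)"
  have c: "0 < c" using assms by (simp add: c_def)
  have N: "?N y = c * exp (- (1 / (2 * \<eta>) * (norm (x - y))\<^sup>2))" for y
  proof -
    have "(norm (x - y))\<^sup>2 = (\<Sum>b\<in>Basis. (y \<bullet> b - x \<bullet> b)\<^sup>2)"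
      unfolding power2_norm_eq_inner
      by (subst euclidean_inner) (simp add: inner_diff_left power2_eq_square algebra_simps)
    then have "- (1 / (2 * \<eta>) * (norm (x - y))\<^sup>2) = (\<Sum>b\<in>Basis. - (y \<bullet> b - x \<bullet> b)\<^sup>2 / (2 * \<eta>))"
      by (simp add: sum_distrib_left sum_negf sum_divide_distrib)
    then show ?thesis
      using assms by (simp add: normal_density_def prod.distrib c_def exp_sum prod_dividef power_one_over)
  qed
  have "prox_joint f \<eta> x = (\<lambda>y. (exp (- f x) / c) * ?N y)"
    unfolding N using c by (auto simp: prox_joint_def fun_eq_iff exp_add[symmetric])
  then have "prox_Y_given_X f \<eta> x = propto ?N"
    using c propto_mult[of "exp (- f x) / c" ?N] unfolding prox_Y_given_X_def by simp
  moreover have "(\<integral>y. ?N y \<partial>lborel) = 1"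
  proof -
    have "(\<integral>\<^sup>+ y. ennreal (?N y) \<partial>lborel)
        = (\<integral>\<^sup>+ y. (\<Prod>b\<in>Basis. ennreal (normal_density (x \<bullet> b) (sqrt \<eta>) (y \<bullet> b))) \<partial>lborel)"
      by (simp add: prod_ennreal)
    also have "\<dots> = (\<Prod>b\<in>(Basis::'a set). \<integral>\<^sup>+ t. ennreal (normal_density (x \<bullet> b) (sqrt \<eta>) t) \<partial>lborel)"
      by (rule nn_integral_lborel_prod) auto
    also have "\<dots> = 1"
      using assms by (simp add: nn_integral_eq_integral integral_normal_density)
    finally show ?thesis
      by (subst integral_eq_nn_integral) (auto intro!: prod_nonneg)
  qed
  ultimately show ?thesis
    by (simp add: propto_def)
qed

lemma borel_measurable_prox_joint [measurable]:
  assumes [measurable]: "f \<in> borel_measurable borel"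
  shows "(\<lambda>(x, y). prox_joint f \<eta> x y) \<in> borel_measurable (borel \<Otimes>\<^sub>M borel)"
  unfolding prox_joint_def by measurable

lemma integrable_prox_joint_X:
  assumes "0 < \<eta>" "integrable lborel (\<lambda>x. exp (- f x))" "f \<in> borel_measurable borel"
  shows "integrable lborel (\<lambda>x. prox_joint f \<eta> x y)"
proof (rule Bochner_Integration.integrable_bound[OF assms(2)])
  show "(\<lambda>x. prox_joint f \<eta> x y) \<in> borel_measurable lborel"
    using assms(3) unfolding prox_joint_def by measurable
qed (use assms(1) in \<open>simp add: prox_joint_def\<close>)

lemma integrable_prox_joint_Y:
  fixes f :: "'a::euclidean_space \<Rightarrow> real"
  assumes "0 < \<eta>"
  shows "integrable lborel (\<lambda>y. prox_joint f \<eta> x y)"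
proof (rule ccontr)
  assume "\<not> ?thesis"
  then have "(\<integral>y. prox_joint f \<eta> x y \<partial>lborel) = 0"
    by (rule not_integrable_integral_eq)
  then have "prox_Y_given_X f \<eta> x = density lborel (\<lambda>_. 0)"
    by (simp add: prox_Y_given_X_def propto_def)
  then have "emeasure (prox_Y_given_X f \<eta> x) UNIV = 0"
    by (simp add: emeasure_density)
  moreover have "emeasure (prox_Y_given_X f \<eta> x) UNIV
      = (\<integral>\<^sup>+ y. (\<Prod>b\<in>Basis. ennreal (normal_density (x \<bullet> b) (sqrt \<eta>) (y \<bullet> b))) \<partial>lborel)"
    using assms by (simp add: prox_Y_given_X_eq_normal emeasure_density prod_ennreal)
  moreover have "\<dots> = (\<Prod>b\<in>(Basis::'a set). \<integral>\<^sup>+ t. ennreal (normal_density (x \<bullet> b) (sqrt \<eta>) t) \<partial>lborel)"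
    by (rule nn_integral_lborel_prod) auto
  moreover have "\<dots> = 1"
    using assms by (simp add: nn_integral_eq_integral integral_normal_density)
  ultimately show False by simp
qed

lemma measurable_propto_kernel:
  fixes w :: "'a::euclidean_space \<Rightarrow> 'a \<Rightarrow> real"
  assumes w [measurable]: "(\<lambda>(a, x). w a x) \<in> borel_measurable (borel \<Otimes>\<^sub>M borel)"
    and "\<And>a. integrable lborel (w a)" "\<And>a x. 0 < w a x"
  shows "(\<lambda>a. propto (w a)) \<in> borel \<rightarrow>\<^sub>M prob_algebra borel"
proof (intro measurable_prob_algebraI measurable_subprob_algebra)
  show "prob_space (propto (w a))" for a
    by (intro prob_space_propto assms)
  then show "subprob_space (propto (w a))" for a
    by (rule prob_space_imp_subprob_space)
  show "sets (propto (w a)) = sets borel" for a by simp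
  fix A :: "'a set" assume [measurable]: "A \<in> sets borel"
  have [measurable]: "(\<lambda>(a, x). w a x) \<in> borel_measurable (borel \<Otimes>\<^sub>M lborel)"
    using w by simp
  have "emeasure (propto (w a)) A
      = (\<integral>\<^sup>+ x. ennreal (w a x / (\<integral>z. w a z \<partial>lborel)) * indicator A x \<partial>lborel)" for a
    unfolding propto_def using assms(2)[of a] by (subst emeasure_density) auto
  then show "(\<lambda>a. emeasure (propto (w a)) A) \<in> borel_measurable borel"
    by simp
qed

lemma measurable_prox_Y_given_X:
  assumes "0 < \<eta>" and [measurable]: "f \<in> borel_measurable borel"
  shows "prox_Y_given_X f \<eta> \<in> borel \<rightarrow>\<^sub>M prob_algebra borel"
  unfolding prox_Y_given_X_def using assms
  by (intro measurable_propto_kernel integrable_prox_joint_Y borel_measurable_prox_joint)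
     (simp_all add: prox_joint_def)

lemma measurable_prox_X_given_Y:
  assumes "0 < \<eta>" "integrable lborel (\<lambda>x. exp (- f x))" and [measurable]: "f \<in> borel_measurable borel"
  shows "prox_X_given_Y f \<eta> \<in> borel \<rightarrow>\<^sub>M prob_algebra borel"
  unfolding prox_X_given_Y_def using assms
proof (intro measurable_propto_kernel integrable_prox_joint_X)
  show "(\<lambda>(y, x). prox_joint f \<eta> x y) \<in> borel_measurable (borel \<Otimes>\<^sub>M borel)"
    unfolding prox_joint_def by measurable
qed (simp_all add: prox_joint_def)

end

theory Submission
  imports Defs
begin

text \<open>
  Write \<open>\<pi>\<close> for the target, \<open>N(0, t I)\<close> for the centred Gaussian,
  \<open>heat t v x = E v (x + N(0, t I))\<close> for the heat flow and \<open>\<mu>\<close> for the \<open>Y\<close>-marginal of the joint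
  law. The sampler is reversible: if the current law has density \<open>g\<close> with respect to \<open>\<pi>\<close>, then \<open>y\<close>
  has density \<open>K g (y) = E [g(X) | Y = y]\<close> with respect to \<open>\<mu>\<close>, and the next law has density
  \<open>heat \<eta> (K g)\<close> with respect to \<open>\<pi>\<close>. The operators \<open>K\<close> and \<open>heat \<eta>\<close> are adjoint to each other.
  Everything therefore reduces to one property of the heat flow, a hypercontractive estimate
  between \<open>\<mu>\<close> and \<open>\<pi>\<close>: \<open>\<parallel>heat \<eta> v\<parallel>\<close> in \<open>L\<close>-norm of order \<open>1 + b (p - 1)\<close> under \<open>\<pi>\<close> is at most
  \<open>\<parallel>v\<parallel>\<close> in norm of order \<open>p\<close> under \<open>\<mu>\<close>, for all \<open>p > 1\<close> and \<open>1 < b < 1 + \<alpha> \<eta>\<close>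
  (\<open>heat_hypercontractivity\<close>).

  Its proof replaces the usual differentiation along a diffusion by a chain of finite steps. Let
  \<open>L\<^sub>s = (1/p) ln heat s ((heat (\<eta> - s) v)\<^sup>p)\<close>. This is an upper bound of \<open>ln heat \<eta> v\<close> by
  Jensen's inequality, and it equals \<open>(1/p) ln heat \<eta> (v\<^sup>p)\<close> at \<open>s = \<eta>\<close>. Wang's Harnack
  inequality, which is Hoelder's inequality against a Cameron-Martin shift, says exactly that \<open>L\<close>
  dominates its own Hopf-Lax evolution: \<open>L\<^sub>s\<^sub>+\<^sub>\<delta> (x) \<ge> L\<^sub>s (x + \<delta> w) - \<delta> |w|\<^sup>2 / (2 (p - 1))\<close>.
  With \<open>w = (p - 1) \<nabla>L\<^sub>s (x)\<close> and a Taylor bound that is uniform in \<open>s\<close>,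
  \<open>L\<^sub>s\<^sub>+\<^sub>\<delta> \<ge> L\<^sub>s + (\<delta>/2) (p - 1) |\<nabla>L\<^sub>s|\<^sup>2\<close> up to an error of order \<open>\<delta>\<^sup>2\<close>. The log-Sobolev
  inequality for the density proportional to \<open>exp (P L\<^sub>s)\<close> turns this gain into a decrease of the
  exponent: to first order, the norm of \<open>exp L\<^sub>s\<close> does not decrease if its order drops by
  \<open>\<alpha> (p - 1) \<delta>\<close> while \<open>s\<close> grows by \<open>\<delta>\<close> (\<open>lsi_gradient_step\<close>). Summing over \<open>[0, \<eta>]\<close> gives the
  exponent \<open>p + \<alpha> \<eta> (p - 1) = 1 + (1 + \<alpha> \<eta>) (p - 1)\<close>. Only the inequality for \<open>\<pi>\<close> itself enters,
  never one for its convolutions with Gaussians.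

  Duality transports the estimate to \<open>K\<close>. Hence one step of the sampler is a contraction
  from the Lebesgue space of order \<open>1 + (q - 1) / b\<^sup>2\<close> to that of order \<open>q\<close>
  (\<open>hypercontractive_R\<close>). Interpolating between order one, where a density has norm one, and
  order \<open>q\<close> yields a contraction of the Renyi divergence by \<open>1 / (1 + (b\<^sup>2 - 1) / q)\<close>. Letting
  \<open>q\<close> tend to 1 yields a contraction of the KL divergence by \<open>1 / b\<^sup>2\<close>. Finally \<open>b\<close> tends to
  \<open>1 + \<alpha> \<eta>\<close>, and Bernoulli's inequality \<open>(1 + x)\<^bsup>1/q\<^esup> \<le> 1 + x / q\<close> gives the stated rate for the
  Renyi divergence.
\<close>

section \<open>Gaussian measures\<close>

definition gauss_density :: "real \<Rightarrow> 'a::euclidean_space \<Rightarrow> real" where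
  "gauss_density t z = (1 / sqrt (2 * pi * t)) ^ DIM('a) * exp (- (norm z)\<^sup>2 / (2 * t))"

definition gauss :: "real \<Rightarrow> 'a::euclidean_space measure" where
  "gauss t = density lborel (\<lambda>z. ennreal (gauss_density t z))"

definition heat :: "real \<Rightarrow> ('a::euclidean_space \<Rightarrow> real) \<Rightarrow> 'a \<Rightarrow> real" where
  "heat t v x = (\<integral>z. v (x + z) \<partial>gauss t)"

lemma gauss_density_nonneg: "0 < t \<Longrightarrow> 0 \<le> gauss_density t z"
  by (simp add: gauss_density_def)

lemma borel_measurable_gauss_density [measurable]: "gauss_density t \<in> borel_measurable borel"
  unfolding gauss_density_def by measurable

lemma sets_gauss [simp, measurable_cong]: "sets (gauss t) = sets borel"
  by (simp add: gauss_def)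

lemma space_gauss [simp]: "space (gauss t) = UNIV"
  by (simp add: gauss_def)

lemma gauss_density_eq_prod:
  fixes z :: "'a::euclidean_space"
  assumes "0 < t"
  shows "gauss_density t z = (\<Prod>b\<in>Basis. normal_density 0 (sqrt t) (z \<bullet> b))"
proof -
  have "(norm z)\<^sup>2 = (\<Sum>b\<in>Basis. (z \<bullet> b)\<^sup>2)"
    unfolding power2_norm_eq_inner by (subst euclidean_inner) (simp add: power2_eq_square)
  then have "- (norm z)\<^sup>2 / (2 * t) = (\<Sum>b\<in>Basis. - (z \<bullet> b)\<^sup>2 / (2 * t))"
    by (simp add: sum_negf sum_divide_distrib)
  then show ?thesis
    using assms
    by (simp add: gauss_density_def normal_density_def prod.distrib exp_sum prod_dividef power_one_over)
qed

lemma nn_integral_gauss_density: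
  assumes "0 < t"
  shows "(\<integral>\<^sup>+z. ennreal (gauss_density t (z::'a::euclidean_space)) \<partial>lborel) = 1"
proof -
  have "(\<integral>\<^sup>+z. ennreal (gauss_density t (z::'a)) \<partial>lborel)
      = (\<integral>\<^sup>+z. (\<Prod>b\<in>Basis. ennreal (normal_density 0 (sqrt t) ((z::'a) \<bullet> b))) \<partial>lborel)"
    using assms by (simp add: gauss_density_eq_prod prod_ennreal)
  also have "\<dots> = (\<Prod>b\<in>(Basis::'a set). \<integral>\<^sup>+s. ennreal (normal_density 0 (sqrt t) s) \<partial>lborel)"
    by (rule nn_integral_lborel_prod) auto
  also have "\<dots> = 1"
    using assms by (simp add: nn_integral_eq_integral integral_normal_density)
  finally show ?thesis .
qed

lemma prob_space_gauss: "0 < t \<Longrightarrow> prob_space (gauss t)"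
  by (rule prob_spaceI) (simp add: gauss_def emeasure_density nn_integral_gauss_density)

lemma integrable_gauss_density:
  "0 < t \<Longrightarrow> integrable lborel (gauss_density t :: 'a::euclidean_space \<Rightarrow> real)"
  by (rule integrableI_nonneg)
     (auto simp: gauss_density_nonneg nn_integral_gauss_density)

lemma integral_gauss:
  fixes h :: "'a::euclidean_space \<Rightarrow> real"
  assumes "0 < t" "h \<in> borel_measurable borel"
  shows "(\<integral>z. h z \<partial>gauss t) = (\<integral>z. gauss_density t z * h z \<partial>lborel)"
  unfolding gauss_def using assms
  by (subst integral_real_density) (auto simp: gauss_density_nonneg)

lemma integrable_gauss:
  fixes h :: "'a::euclidean_space \<Rightarrow> real"
  assumes "0 < t" "h \<in> borel_measurable borel"
  shows "integrable (gauss t) h \<longleftrightarrow> integrable lborel (\<lambda>z. gauss_density t z * h z)"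
  unfolding gauss_def using assms
  by (subst integrable_real_density) (auto simp: gauss_density_nonneg)

lemma nn_integral_gauss:
  fixes h :: "'a::euclidean_space \<Rightarrow> ennreal"
  assumes "0 < t" "h \<in> borel_measurable borel"
  shows "(\<integral>\<^sup>+z. h z \<partial>gauss t) = (\<integral>\<^sup>+z. ennreal (gauss_density t z) * h z \<partial>lborel)"
  unfolding gauss_def using assms
  by (subst nn_integral_density) auto

lemma lborel_integral_translate:
  fixes h :: "'a::euclidean_space \<Rightarrow> real"
  assumes "h \<in> borel_measurable borel"
  shows "(\<integral>z. h (c + z) \<partial>lborel) = (\<integral>z. h z \<partial>lborel)"
proof -
  have "(\<integral>z. h z \<partial>lborel) = (\<integral>z. h z \<partial>distr lborel borel ((+) c))"
    by (simp add: lborel_distr_plus)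
  also have "\<dots> = (\<integral>z. h (c + z) \<partial>lborel)"
    using assms by (intro integral_distr) auto
  finally show ?thesis by simp
qed

lemma nn_integral_lborel_translate:
  fixes h :: "'a::euclidean_space \<Rightarrow> ennreal"
  assumes "h \<in> borel_measurable borel"
  shows "(\<integral>\<^sup>+z. h (c + z) \<partial>lborel) = (\<integral>\<^sup>+z. h z \<partial>lborel)"
proof -
  have "(\<integral>\<^sup>+z. h z \<partial>lborel) = (\<integral>\<^sup>+z. h z \<partial>distr lborel borel ((+) c))"
    by (simp add: lborel_distr_plus)
  also have "\<dots> = (\<integral>\<^sup>+z. h (c + z) \<partial>lborel)"
    using assms by (intro nn_integral_distr) auto
  finally show ?thesis by simp
qed

text \<open>
  Completing the square: a shift of the Gaussian by \<open>t w\<close> has an exponential density with respect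
  to it. This identity is the source of the smoothness of the heat flow and of Wang's Harnack
  inequality.
\<close>

lemma gauss_density_shift:
  assumes "0 < t"
  shows "gauss_density t (z - t *\<^sub>R w) = gauss_density t z * exp (w \<bullet> z - t * (norm w)\<^sup>2 / 2)"
proof -
  have "(norm (z - t *\<^sub>R w))\<^sup>2 = (norm z)\<^sup>2 - 2 * t * (w \<bullet> z) + t\<^sup>2 * (norm w)\<^sup>2"
    unfolding power2_norm_eq_inner
    by (simp add: inner_diff_left inner_diff_right inner_commute power2_eq_square algebra_simps)
  then have "- (norm (z - t *\<^sub>R w))\<^sup>2 / (2 * t)
      = - (norm z)\<^sup>2 / (2 * t) + (w \<bullet> z - t * (norm w)\<^sup>2 / 2)"
    using assms by (simp add: field_simps power2_eq_square)
  then show ?thesis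
    unfolding gauss_density_def by (simp only: exp_add mult.assoc)
qed

lemma cameron_martin:
  fixes h :: "'a::euclidean_space \<Rightarrow> real"
  assumes t: "0 < t" and [measurable]: "h \<in> borel_measurable borel"
  shows "(\<integral>z. h (z + t *\<^sub>R w) \<partial>gauss t) = (\<integral>z. h z * exp (w \<bullet> z - t * (norm w)\<^sup>2 / 2) \<partial>gauss t)"
proof -
  have "(\<integral>z. h (z + t *\<^sub>R w) \<partial>gauss t) = (\<integral>z. gauss_density t z * h (z + t *\<^sub>R w) \<partial>lborel)"
    by (rule integral_gauss[OF t]) measurable
  also have "\<dots> = (\<integral>z. gauss_density t (t *\<^sub>R w + z - t *\<^sub>R w) * h (t *\<^sub>R w + z) \<partial>lborel)"
    by (simp add: algebra_simps)
  also have "\<dots> = (\<integral>z. gauss_density t (z - t *\<^sub>R w) * h z \<partial>lborel)"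
    by (rule lborel_integral_translate[where h = "\<lambda>z. gauss_density t (z - t *\<^sub>R w) * h z"]) measurable
  also have "\<dots> = (\<integral>z. gauss_density t z * (h z * exp (w \<bullet> z - t * (norm w)\<^sup>2 / 2)) \<partial>lborel)"
    by (simp add: gauss_density_shift[OF t] algebra_simps)
  also have "\<dots> = (\<integral>z. h z * exp (w \<bullet> z - t * (norm w)\<^sup>2 / 2) \<partial>gauss t)"
    by (rule integral_gauss[OF t, symmetric]) measurable
  finally show ?thesis .
qed

text \<open>
  Young's inequality \<open>r |z| \<le> |z|\<^sup>2 / (4 t) + r\<^sup>2 t\<close> costs half of the Gaussian exponent, so the
  integrand is dominated by a multiple of the Gaussian density of variance \<open>2 t\<close>.
\<close>

lemma integrable_exp_norm_gauss:
  assumes t: "0 < t"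
  shows "integrable (gauss t) (\<lambda>z::'a::euclidean_space. exp (r * norm z))"
proof -
  let ?C = "(1 / sqrt (2 * pi * t)) ^ DIM('a) / (1 / sqrt (2 * pi * (2 * t))) ^ DIM('a) * exp (r\<^sup>2 * t)"
  have bd: "gauss_density t z * exp (r * norm z) \<le> ?C * gauss_density (2 * t) z" for z :: 'a
  proof -
    have "0 \<le> (norm z - 2 * r * t)\<^sup>2 / (4 * t)" using t by simp
    also have "\<dots> = (norm z)\<^sup>2 / (4 * t) - r * norm z + r\<^sup>2 * t"
      using t by (simp add: power2_diff field_simps power2_eq_square)
    finally have "- (norm z)\<^sup>2 / (2 * t) + r * norm z \<le> r\<^sup>2 * t + - (norm z)\<^sup>2 / (2 * (2 * t))"
      by (simp add: field_simps)
    then have "exp (- (norm z)\<^sup>2 / (2 * t)) * exp (r * norm z)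
        \<le> exp (r\<^sup>2 * t) * exp (- (norm z)\<^sup>2 / (2 * (2 * t)))"
      unfolding exp_add[symmetric] by simp
    then have "(1 / sqrt (2 * pi * t)) ^ DIM('a) * (exp (- (norm z)\<^sup>2 / (2 * t)) * exp (r * norm z))
        \<le> (1 / sqrt (2 * pi * t)) ^ DIM('a) * (exp (r\<^sup>2 * t) * exp (- (norm z)\<^sup>2 / (2 * (2 * t))))"
      by (intro mult_left_mono) (use t in auto)
    then show ?thesis
      unfolding gauss_density_def using t by (simp add: mult.assoc)
  qed
  have "integrable lborel (\<lambda>z::'a. ?C * gauss_density (2 * t) z)"
    using t by (intro integrable_mult_right integrable_gauss_density) auto
  then have "integrable lborel (\<lambda>z::'a. gauss_density t z * exp (r * norm z))"
    by (rule Bochner_Integration.integrable_bound)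
       (use t bd in \<open>auto simp: abs_mult gauss_density_nonneg intro!: AE_I2 order_trans[OF bd]\<close>)
  then show ?thesis
    using t by (subst integrable_gauss) auto
qed

lemma exp_inner_gauss:
  fixes w :: "'a::euclidean_space"
  assumes t: "0 < t"
  shows "integrable (gauss t) (\<lambda>z. exp (w \<bullet> z))"
    and "(\<integral>z. exp (w \<bullet> z) \<partial>gauss t) = exp (t * (norm w)\<^sup>2 / 2)"
proof -
  interpret prob_space "gauss t :: 'a measure" by (rule prob_space_gauss[OF t])
  show "integrable (gauss t) (\<lambda>z. exp (w \<bullet> z))"
    by (rule Bochner_Integration.integrable_bound[OF integrable_exp_norm_gauss[OF t, of "norm w"]])
       (auto intro!: AE_I2 norm_cauchy_schwarz)
  have "1 = (\<integral>z. exp (w \<bullet> z - t * (norm w)\<^sup>2 / 2) \<partial>gauss t)"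
    using cameron_martin[OF t, of "\<lambda>_. 1" w] prob_space by simp
  also have "\<dots> = (\<integral>z. exp (w \<bullet> z) / exp (t * (norm w)\<^sup>2 / 2) \<partial>gauss t)"
    by (simp add: exp_diff)
  finally show "(\<integral>z. exp (w \<bullet> z) \<partial>gauss t) = exp (t * (norm w)\<^sup>2 / 2)"
    by (simp add: field_simps)
qed

text \<open>
  Both densities are products over the coordinates, so the claim reduces to the convolution of
  normal densities on the line.
\<close>

lemma gauss_convolution:
  assumes a: "0 < a" and b: "0 < b"
  shows "distr (gauss a \<Otimes>\<^sub>M gauss b) borel (\<lambda>(z, z'). z + z') = (gauss (a + b) :: 'a::euclidean_space measure)"
proof (rule measure_eqI)
  interpret A: prob_space "gauss a :: 'a measure" by (rule prob_space_gauss[OF a])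
  interpret B: prob_space "gauss b :: 'a measure" by (rule prob_space_gauss[OF b])
  have conv: "(\<integral>\<^sup>+z. ennreal (gauss_density a z) * ennreal (gauss_density b (y - z)) \<partial>lborel)
      = ennreal (gauss_density (a + b) y)" for y :: 'a
  proof -
    have "(\<integral>\<^sup>+z. ennreal (gauss_density a z) * ennreal (gauss_density b (y - z)) \<partial>lborel)
      = (\<integral>\<^sup>+z. (\<Prod>i\<in>Basis. ennreal (normal_density 0 (sqrt b) (y \<bullet> i - z \<bullet> i) * normal_density 0 (sqrt a) (z \<bullet> i))) \<partial>lborel)"
      using a b by (simp add: gauss_density_eq_prod prod_ennreal[symmetric] inner_diff_left
          ennreal_mult' prod.distrib mult.commute)
    also have "\<dots> = (\<Prod>i\<in>Basis. \<integral>\<^sup>+s. ennreal (normal_density 0 (sqrt b) (y \<bullet> i - s) * normal_density 0 (sqrt a) s) \<partial>lborel)"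
      by (rule nn_integral_lborel_prod[where f = "\<lambda>i s. ennreal (normal_density 0 (sqrt b) (y \<bullet> i - s) * normal_density 0 (sqrt a) s)"]) auto
    also have "\<dots> = (\<Prod>i\<in>Basis. ennreal (normal_density 0 (sqrt (a + b)) (y \<bullet> i)))"
    proof (rule prod.cong[OF refl])
      fix i
      show "(\<integral>\<^sup>+s. ennreal (normal_density 0 (sqrt b) (y \<bullet> i - s) * normal_density 0 (sqrt a) s) \<partial>lborel)
          = ennreal (normal_density 0 (sqrt (a + b)) (y \<bullet> i))"
        using a b fun_cong[OF conv_normal_density_zero_mean[of "sqrt b" "sqrt a"], of "y \<bullet> i"]
        by (simp add: add.commute)
    qed
    also have "\<dots> = ennreal (gauss_density (a + b) y)"
      using a b by (simp add: gauss_density_eq_prod prod_ennreal)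
    finally show ?thesis .
  qed
  fix S :: "'a set" assume "S \<in> sets (distr (gauss a \<Otimes>\<^sub>M gauss b) borel (\<lambda>(z, z'). z + z'))"
  then have S [measurable]: "S \<in> sets borel" by simp
  have "emeasure (distr (gauss a \<Otimes>\<^sub>M gauss b) borel (\<lambda>(z, z'). z + z')) S
      = (\<integral>\<^sup>+p. indicator S (fst p + snd p) \<partial>(gauss a \<Otimes>\<^sub>M gauss b))"
    by (subst nn_integral_indicator[symmetric], simp, subst nn_integral_distr)
       (auto simp: case_prod_beta')
  also have "\<dots> = (\<integral>\<^sup>+z. \<integral>\<^sup>+z'. indicator S (z + z') \<partial>gauss b \<partial>gauss a)"
    by (subst B.nn_integral_fst[symmetric]) auto
  also have "\<dots> = (\<integral>\<^sup>+z. ennreal (gauss_density a z) * (\<integral>\<^sup>+z'. ennreal (gauss_density b z') * indicator S (z + z') \<partial>lborel) \<partial>lborel)"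
    using a b by (simp add: nn_integral_gauss)
  also have "\<dots> = (\<integral>\<^sup>+z. (\<integral>\<^sup>+y. ennreal (gauss_density a z) * (ennreal (gauss_density b (y - z)) * indicator S y) \<partial>lborel) \<partial>lborel)"
  proof (rule nn_integral_cong)
    fix z :: 'a
    have "(\<integral>\<^sup>+z'. ennreal (gauss_density b z') * indicator S (z + z') \<partial>lborel)
       = (\<integral>\<^sup>+z'. ennreal (gauss_density b (z + z' - z)) * indicator S (z + z') \<partial>lborel)"
      by simp
    also have "\<dots> = (\<integral>\<^sup>+y. ennreal (gauss_density b (y - z)) * indicator S y \<partial>lborel)"
      by (rule nn_integral_lborel_translate[where h = "\<lambda>y. ennreal (gauss_density b (y - z)) * indicator S y"]) measurable
    finally show "ennreal (gauss_density a z) * (\<integral>\<^sup>+z'. ennreal (gauss_density b z') * indicator S (z + z') \<partial>lborel)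
      = (\<integral>\<^sup>+y. ennreal (gauss_density a z) * (ennreal (gauss_density b (y - z)) * indicator S y) \<partial>lborel)"
      by (simp add: nn_integral_cmult)
  qed
  also have "\<dots> = (\<integral>\<^sup>+y. (\<integral>\<^sup>+z. ennreal (gauss_density a z) * (ennreal (gauss_density b (y - z)) * indicator S y) \<partial>lborel) \<partial>lborel)"
    by (rule lborel_pair.Fubini') measurable
  also have "\<dots> = (\<integral>\<^sup>+y. ennreal (gauss_density (a + b) y) * indicator S y \<partial>lborel)"
    by (simp add: mult.assoc[symmetric] nn_integral_multc conv)
  also have "\<dots> = emeasure (gauss (a + b)) S"
    by (simp add: gauss_def emeasure_density)
  finally show "emeasure (distr (gauss a \<Otimes>\<^sub>M gauss b) borel (\<lambda>(z, z'). z + z')) S = emeasure (gauss (a + b)) S" .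
qed simp

section \<open>The heat flow on bounded functions\<close>

text \<open>
  Nearly all analysis below is done for functions with values in a fixed interval, usually with
  \<open>c > 0\<close>. For them all integrals exist, averaging operators preserve the class, and logarithms
  and real powers are harmless.
\<close>

definition borel_between :: "real \<Rightarrow> real \<Rightarrow> ('a::euclidean_space \<Rightarrow> real) \<Rightarrow> bool" where
  "borel_between c C v \<longleftrightarrow> v \<in> borel_measurable borel \<and> (\<forall>x. c \<le> v x \<and> v x \<le> C)"

lemma borel_betweenD:
  assumes "borel_between c C v"
  shows "v \<in> borel_measurable borel" "c \<le> v x" "v x \<le> C"
  using assms by (auto simp: borel_between_def)

lemma integrable_borel_between:
  assumes "finite_measure M" "sets M = sets borel" "borel_between c C v"
  shows "integrable M v"
proof -
  have "v \<in> borel_measurable M"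
    using borel_betweenD(1)[OF assms(3)] measurable_cong_sets[OF assms(2) refl] by blast
  moreover have "norm (v x) \<le> max \<bar>c\<bar> \<bar>C\<bar>" for x
    using borel_betweenD(2,3)[OF assms(3), of x] by auto
  ultimately show ?thesis
    using finite_measure.integrable_const_bound[OF assms(1), of v "max \<bar>c\<bar> \<bar>C\<bar>"] by auto
qed

lemma borel_between_translate:
  "borel_between c C v \<Longrightarrow> borel_between c C (\<lambda>z. v (x + z))"
  unfolding borel_between_def by auto

lemma integrable_heat:
  assumes "0 < t" "borel_between c C v"
  shows "integrable (gauss t) (\<lambda>z. v (x + z))"
  using prob_space_gauss[OF assms(1)] borel_between_translate[OF assms(2)]
  by (intro integrable_borel_between[where c = c and C = C]) (auto simp: prob_space_def)

lemma integral_between: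
  assumes "prob_space M" "integrable M v" "\<And>x. c \<le> v x" "\<And>x. v x \<le> (C::real)"
  shows "c \<le> (\<integral>x. v x \<partial>M)" "(\<integral>x. v x \<partial>M) \<le> C"
proof -
  interpret prob_space M by fact
  show "c \<le> (\<integral>x. v x \<partial>M)"
    using integral_mono[of M "\<lambda>_. c" v] assms by (simp add: prob_space)
  show "(\<integral>x. v x \<partial>M) \<le> C"
    using integral_mono[of M v "\<lambda>_. C"] assms by (simp add: prob_space)
qed

lemma integral_borel_between_pos:
  assumes "prob_space M" "sets M = sets borel" "borel_between c C v" "0 < c"
  shows "0 < (\<integral>x. v x \<partial>M)"
  using integral_between(1)[OF assms(1) integrable_borel_between[OF prob_space.finite_measure[OF assms(1)] assms(2,3)]
      borel_betweenD(2,3)[OF assms(3)]] assms(4) by linarith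

lemma borel_measurable_heat:
  assumes "0 < t" and [measurable]: "v \<in> borel_measurable borel"
  shows "heat t v \<in> borel_measurable borel"
proof -
  interpret prob_space "gauss t :: 'a measure" by (rule prob_space_gauss[OF assms(1)])
  show ?thesis unfolding heat_def by measurable
qed

lemma borel_between_heat:
  assumes "0 < t" "borel_between c C v"
  shows "borel_between c C (heat t v)"
  unfolding borel_between_def heat_def[of t v]
proof (intro conjI allI)
  show "c \<le> (\<integral>z. v (x + z) \<partial>gauss t)" "(\<integral>z. v (x + z) \<partial>gauss t) \<le> C" for x
    using integral_between[OF prob_space_gauss[OF assms(1)] integrable_heat[OF assms], of c x C]
    by (simp_all add: borel_betweenD[OF assms(2)])
qed (use borel_measurable_heat[OF assms(1) borel_betweenD(1)[OF assms(2)]] in \<open>simp add: heat_def[abs_def]\<close>)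

lemma heat_mono:
  assumes "0 < t" "borel_between c C u" "borel_between c' C' v" "\<And>x. u x \<le> v x"
  shows "heat t u x \<le> heat t v x"
  unfolding heat_def using assms by (intro integral_mono integrable_heat) auto

lemma heat_translate: "heat t (\<lambda>z. v (h + z)) x = heat t v (h + x)"
  by (simp add: heat_def add.assoc)

lemma heat_cmult: "heat t (\<lambda>z. c * v z) x = c * heat t v x"
  by (simp add: heat_def)

lemma heat_heat:
  fixes v :: "'a::euclidean_space \<Rightarrow> real"
  assumes a: "0 < a" and b: "0 < b" and v: "borel_between c C v"
  shows "heat a (heat b v) = heat (a + b) v"
proof
  fix x :: 'a
  interpret A: prob_space "gauss a :: 'a measure" by (rule prob_space_gauss[OF a])
  interpret B: prob_space "gauss b :: 'a measure" by (rule prob_space_gauss[OF b])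
  interpret AB: pair_prob_space "gauss a :: 'a measure" "gauss b :: 'a measure" ..
  have [measurable]: "v \<in> borel_measurable borel" by (rule borel_betweenD[OF v])
  have bd: "\<bar>v y\<bar> \<le> max \<bar>c\<bar> \<bar>C\<bar>" for y
    using borel_betweenD(2,3)[OF v, of y] by auto
  have int: "integrable (gauss a \<Otimes>\<^sub>M gauss b) (\<lambda>(z, z'). v (x + (z + z')))"
    by (rule AB.integrable_const_bound[of _ "max \<bar>c\<bar> \<bar>C\<bar>"]) (auto simp: bd split: prod.split)
  have "heat (a + b) v x = (\<integral>y. v (x + y) \<partial>distr (gauss a \<Otimes>\<^sub>M gauss b) borel (\<lambda>(z, z'). z + z'))"
    by (simp add: heat_def gauss_convolution[OF a b])
  also have "\<dots> = (\<integral>p. (case p of (z, z') \<Rightarrow> v (x + (z + z'))) \<partial>(gauss a \<Otimes>\<^sub>M gauss b))"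
    by (subst integral_distr) (auto simp: case_prod_beta')
  also have "\<dots> = (\<integral>z. (\<integral>z'. v (x + (z + z')) \<partial>gauss b) \<partial>gauss a)"
    using AB.integral_fst'[OF int] by simp
  finally show "heat a (heat b v) x = heat (a + b) v x"
    by (simp add: heat_def add.assoc)
qed

section \<open>Wang's Harnack inequality\<close>

lemma Holder_inequality:
  fixes f g :: "'b \<Rightarrow> real"
  assumes pq: "1 < p" "1 < q" "1 / p + 1 / q = 1"
    and nn: "\<And>x. 0 \<le> f x" "\<And>x. 0 \<le> g x"
    and [measurable]: "f \<in> borel_measurable M" "g \<in> borel_measurable M"
    and int: "integrable M (\<lambda>x. f x powr p)" "integrable M (\<lambda>x. g x powr q)"
    and pos: "0 < (\<integral>x. f x powr p \<partial>M)" "0 < (\<integral>x. g x powr q \<partial>M)"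
  shows "(\<integral>x. f x * g x \<partial>M) \<le> (\<integral>x. f x powr p \<partial>M) powr (1 / p) * (\<integral>x. g x powr q \<partial>M) powr (1 / q)"
proof -
  define A where "A = (\<integral>x. f x powr p \<partial>M)"
  define B where "B = (\<integral>x. g x powr q \<partial>M)"
  have A: "0 < A" and B: "0 < B" using pos by (simp_all add: A_def B_def)
  let ?h = "\<lambda>x. A powr (1/p) * B powr (1/q) * (f x powr p / (p * A) + g x powr q / (q * B))"
  have le: "f x * g x \<le> ?h x" for x
  proof -
    have "(f x / A powr (1/p)) * (g x / B powr (1/q))
        \<le> (f x / A powr (1/p)) powr p / p + (g x / B powr (1/q)) powr q / q"
      using pq nn by (intro Youngs_inequality) auto
    also have "\<dots> = f x powr p / (p * A) + g x powr q / (q * B)"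
      using pq nn A B by (simp add: powr_divide powr_powr mult.commute)
    finally show ?thesis
      using A B by (simp add: field_simps)
  qed
  have "integrable M ?h"
    using int by (intro integrable_mult_right Bochner_Integration.integrable_add integrable_divide)
  moreover from this have "integrable M (\<lambda>x. f x * g x)"
    by (rule Bochner_Integration.integrable_bound)
       (use order_trans[OF le abs_ge_self] in \<open>auto simp: nn abs_mult[of "f _" "g _"]\<close>)
  ultimately have "(\<integral>x. f x * g x \<partial>M) \<le> (\<integral>x. ?h x \<partial>M)"
    using le by (intro integral_mono)
  also have "\<dots> = A powr (1/p) * B powr (1/q) * (A / (p * A) + B / (q * B))"
    using int by (simp add: A_def B_def)
  also have "A / (p * A) + B / (q * B) = 1"
    using A B pq by simp
  finally show ?thesis by (simp add: A_def B_def)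
qed

lemma borel_between_powr:
  assumes "borel_between c C v" "0 \<le> c" "0 \<le> p"
  shows "borel_between (c powr p) (C powr p) (\<lambda>x. v x powr p)"
  using assms unfolding borel_between_def
  by (auto intro!: powr_mono2 dest: order_trans)

text \<open>
  By the Cameron-Martin formula, \<open>heat t v\<close> at the shifted point is the average at \<open>x\<close> of \<open>v\<close>
  times the exponential density of the shift. Hoelder's inequality separates the two factors, and
  the norm of order \<open>p / (p - 1)\<close> of the exponential is explicit. For \<open>w = 0\<close> this is Jensen's
  inequality.
\<close>

lemma wang_harnack:
  fixes v :: "'a::euclidean_space \<Rightarrow> real"
  assumes t: "0 < t" and p: "1 < p" and v: "borel_between c C v" and c: "0 < c"
  shows "heat t v (x + t *\<^sub>R w) powr p
    \<le> heat t (\<lambda>z. v z powr p) x * exp (p * t * (norm w)\<^sup>2 / (2 * (p - 1)))"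
proof -
  interpret prob_space "gauss t :: 'a measure" by (rule prob_space_gauss[OF t])
  have [measurable]: "v \<in> borel_measurable borel" by (rule borel_betweenD[OF v])
  have vpos: "0 < v y" for y using borel_betweenD(2)[OF v, of y] c by simp
  define q where "q = p / (p - 1)"
  have q: "1 < q" "1 / p + 1 / q = 1" using p by (auto simp: q_def field_simps)
  let ?g = "\<lambda>z. exp (w \<bullet> z - t * (norm w)\<^sup>2 / 2)"
  have g: "?g z powr q = exp ((q *\<^sub>R w) \<bullet> z) / exp (q * t * (norm w)\<^sup>2 / 2)" for z
    by (simp add: powr_def exp_diff[symmetric] algebra_simps)
  have gint: "(\<integral>z. ?g z powr q \<partial>gauss t) = exp (q * (q - 1) * t * (norm w)\<^sup>2 / 2)"
  proof -
    have "(\<integral>z. ?g z powr q \<partial>gauss t) = exp (t * (norm (q *\<^sub>R w))\<^sup>2 / 2) / exp (q * t * (norm w)\<^sup>2 / 2)"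
      unfolding g by (simp only: integral_divide_zero exp_inner_gauss(2)[OF t, of "q *\<^sub>R w"])
    then show ?thesis
      by (simp add: exp_diff[symmetric] power_mult_distrib power2_eq_square algebra_simps diff_divide_distrib)
  qed
  have vp: "borel_between (c powr p) (C powr p) (\<lambda>x. v x powr p)"
    using borel_between_powr[OF v] c p by simp
  have "heat t v (x + t *\<^sub>R w) = (\<integral>z. v (x + (z + t *\<^sub>R w)) \<partial>gauss t)"
    by (simp add: heat_def add_ac)
  also have "\<dots> = (\<integral>z. v (x + z) * ?g z \<partial>gauss t)"
    by (rule cameron_martin[OF t, where h = "\<lambda>z. v (x + z)"]) measurable
  also have "\<dots> \<le> (\<integral>z. v (x + z) powr p \<partial>gauss t) powr (1/p) * (\<integral>z. ?g z powr q \<partial>gauss t) powr (1/q)"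
  proof (rule Holder_inequality[OF p q])
    show "integrable (gauss t) (\<lambda>z. v (x + z) powr p)"
      by (rule integrable_heat[OF t vp])
    show "integrable (gauss t) (\<lambda>z. ?g z powr q)"
      unfolding g using exp_inner_gauss(1)[OF t, of "q *\<^sub>R w"] by simp
    show "0 < (\<integral>z. v (x + z) powr p \<partial>gauss t)"
      using borel_betweenD(2)[OF borel_between_heat[OF t vp], of x] c
        powr_gt_zero[of c p]
      unfolding heat_def by (metis c less_le_trans less_irrefl)
    show "0 < (\<integral>z. ?g z powr q \<partial>gauss t)"
      by (simp add: gint)
  qed (auto simp: less_imp_le[OF vpos])
  finally have "heat t v (x + t *\<^sub>R w) \<le> heat t (\<lambda>z. v z powr p) x powr (1/p)
      * exp ((q - 1) * t * (norm w)\<^sup>2 / 2)"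
    using q unfolding gint by (simp add: heat_def exp_powr_real mult.assoc)
  then have "heat t v (x + t *\<^sub>R w) powr p \<le> (heat t (\<lambda>z. v z powr p) x powr (1/p)
      * exp ((q - 1) * t * (norm w)\<^sup>2 / 2)) powr p"
    using p borel_betweenD(2)[OF borel_between_heat[OF t v], of "x + t *\<^sub>R w"] c
    by (intro powr_mono2) auto
  also have "\<dots> = heat t (\<lambda>z. v z powr p) x * exp (p * ((q - 1) * t * (norm w)\<^sup>2 / 2))"
  proof -
    have "0 < c powr p" using c by simp
    then have "0 < heat t (\<lambda>z. v z powr p) x"
      using borel_betweenD(2)[OF borel_between_heat[OF t vp], of x] by linarith
    then show ?thesis using p by (simp add: powr_mult powr_powr exp_powr_real mult_ac)
  qed
  also have "q - 1 = 1 / (p - 1)" using p by (simp add: q_def field_simps)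
  finally show ?thesis by (simp add: field_simps)
qed

corollary heat_jensen:
  fixes v :: "'a::euclidean_space \<Rightarrow> real"
  assumes "0 < t" "1 < p" "borel_between c C v" "0 < c"
  shows "heat t v x powr p \<le> heat t (\<lambda>z. v z powr p) x"
  using wang_harnack[OF assms, of x 0] by simp

section \<open>Smoothness of the heat flow\<close>

text \<open>
  The closure properties of \<^const>\<open>C_k\<close> are proved by induction on the order with the usual product and
  chain rules; \<open>C_k_Suc_imp\<close> supplies the lower order that the product rule needs.
\<close>

lemma C_k_SucI:
  assumes "\<And>x. (g has_derivative g' x) (at x)" "\<And>b. b \<in> Basis \<Longrightarrow> C_k k (\<lambda>x. g' x b)"
  shows "C_k (Suc k) g"
proof -
  have "frechet_derivative g (at x) = g' x" for x
    by (rule frechet_derivative_at[symmetric, OF assms(1)])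
  then show ?thesis
    using assms by (auto simp: differentiable_def)
qed

lemma C_k_SucD:
  assumes "C_k (Suc k) g"
  shows "(g has_derivative frechet_derivative g (at x)) (at x)"
    "b \<in> Basis \<Longrightarrow> C_k k (\<lambda>x. frechet_derivative g (at x) b)"
  using assms by (auto simp: frechet_derivative_works)

lemma C_k_Suc_imp: "C_k (Suc k) g \<Longrightarrow> C_k k g"
proof (induction k arbitrary: g)
  case 0
  then show ?case
    by (auto intro!: continuous_at_imp_continuous_on differentiable_imp_continuous_within)
next
  case (Suc k)
  then show ?case by (metis C_k.simps(2))
qed

lemma C_k_const: "C_k k (\<lambda>x. c)"
proof (induction k arbitrary: c)
  case (Suc k)
  show ?case by (rule C_k_SucI[where g' = "\<lambda>x h. 0"]) (auto intro!: derivative_eq_intros Suc.IH)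
qed auto

lemma C_k_inner: "C_k k (\<lambda>x. x \<bullet> b)"
proof (cases k)
  case (Suc n)
  show ?thesis unfolding Suc
    by (rule C_k_SucI[where g' = "\<lambda>x h. h \<bullet> b"]) (auto intro!: derivative_eq_intros C_k_const)
qed (auto intro!: continuous_intros)

lemma C_k_add: "C_k k f \<Longrightarrow> C_k k g \<Longrightarrow> C_k k (\<lambda>x. f x + g x)"
proof (induction k arbitrary: f g)
  case (Suc k)
  show ?case
    by (rule C_k_SucI[where g' = "\<lambda>x h. frechet_derivative f (at x) h + frechet_derivative g (at x) h"])
       (intro has_derivative_add C_k_SucD(1)[OF Suc.prems(1)] C_k_SucD(1)[OF Suc.prems(2)],
        intro Suc.IH C_k_SucD(2)[OF Suc.prems(1)] C_k_SucD(2)[OF Suc.prems(2)])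
qed (auto intro!: continuous_intros)

lemma C_k_mult: "C_k k f \<Longrightarrow> C_k k g \<Longrightarrow> C_k k (\<lambda>x. f x * g x)"
proof (induction k arbitrary: f g)
  case (Suc k)
  show ?case
    by (rule C_k_SucI[where g' = "\<lambda>x h. f x * frechet_derivative g (at x) h + frechet_derivative f (at x) h * g x"])
       (intro has_derivative_mult C_k_SucD(1)[OF Suc.prems(1)] C_k_SucD(1)[OF Suc.prems(2)],
        intro C_k_add Suc.IH C_k_SucD(2)[OF Suc.prems(1)] C_k_SucD(2)[OF Suc.prems(2)]
          C_k_Suc_imp[OF Suc.prems(1)] C_k_Suc_imp[OF Suc.prems(2)])
qed (auto intro!: continuous_intros)

lemma C_k_exp: "C_k k f \<Longrightarrow> C_k k (\<lambda>x. exp (f x))"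
proof (induction k arbitrary: f)
  case (Suc k)
  note d = C_k_SucD(1)[OF Suc.prems]
  show ?case
    by (rule C_k_SucI[where g' = "\<lambda>x h. exp (f x) * frechet_derivative f (at x) h"])
       (auto intro!: derivative_eq_intros d C_k_mult Suc.IH C_k_SucD(2)[OF Suc.prems] C_k_Suc_imp[OF Suc.prems])
qed (auto intro!: continuous_intros)

lemma C_k_ln:
  assumes "C_k k f" "\<And>x. 0 < f x"
  shows "C_k k (\<lambda>x. ln (f x))"
  using assms
proof (induction k arbitrary: f)
  case 0
  then show ?case by (auto intro!: continuous_intros simp: less_imp_neq[symmetric])
next
  case (Suc k)
  note d = C_k_SucD(1)[OF Suc.prems(1)]
  have "C_k k (\<lambda>x. exp ((- 1) * ln (f x)))"
    by (intro C_k_exp C_k_mult[OF C_k_const] Suc.IH[OF C_k_Suc_imp[OF Suc.prems(1)] Suc.prems(2)])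
  also have "(\<lambda>x. exp ((- 1) * ln (f x))) = (\<lambda>x. inverse (f x))"
    using Suc.prems(2) by (simp add: exp_minus)
  finally have "C_k k (\<lambda>x. inverse (f x))" .
  show ?case
  proof (rule C_k_SucI)
    show "((\<lambda>x. ln (f x)) has_derivative (\<lambda>h. frechet_derivative f (at x) h * inverse (f x))) (at x)" for x
      by (auto intro!: derivative_eq_intros d Suc.prems(2) simp: divide_inverse)
    show "C_k k (\<lambda>x. frechet_derivative f (at x) b * inverse (f x))" if "b \<in> Basis" for b
      by (intro C_k_mult C_k_SucD(2)[OF Suc.prems(1)] that) fact
  qed
qed

text \<open>
  Differentiation under the integral sign will always come from a pointwise Taylor bound with
  quadratic remainder, which integrates to a bound of the same kind. No limit has to be exchanged
  with an integral.
\<close>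

lemma has_derivative_of_quadratic_remainder:
  fixes F :: "'a::euclidean_space \<Rightarrow> real"
  assumes D: "bounded_linear D"
    and R: "\<And>w. norm w \<le> 1 \<Longrightarrow> \<bar>F (x + w) - F x - D w\<bar> \<le> B * (norm w)\<^sup>2"
  shows "(F has_derivative D) (at x)"
  unfolding has_derivative_at_alt
proof (intro conjI allI impI D)
  fix e :: real assume e: "0 < e"
  let ?d = "min 1 (e / (\<bar>B\<bar> + 1))"
  show "\<exists>d>0. \<forall>y. norm (y - x) < d \<longrightarrow> norm (F y - F x - D (y - x)) \<le> e * norm (y - x)"
  proof (intro exI[of _ ?d] conjI allI impI)
    fix y assume y: "norm (y - x) < ?d"
    let ?n = "norm (y - x)"
    have "norm (F y - F x - D (y - x)) \<le> B * ?n\<^sup>2"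
      using R[of "y - x"] y by simp
    also have "\<dots> \<le> (\<bar>B\<bar> + 1) * ?n * ?n"
      by (simp add: power2_eq_square flip: mult.assoc) (intro mult_right_mono, auto)
    also have "\<dots> \<le> e * ?n"
      using y by (intro mult_right_mono) (auto simp: field_simps)
    finally show "norm (F y - F x - D (y - x)) \<le> e * norm (y - x)" .
  qed (use e in auto)
qed

lemma exp_remainder: "\<bar>exp u - 1 - u\<bar> \<le> u\<^sup>2 * exp \<bar>u\<bar>" for u :: real
proof -
  obtain s where s: "\<bar>s\<bar> \<le> \<bar>u\<bar>" "exp u = (\<Sum>m<2. u ^ m / fact m) + exp s / fact 2 * u ^ 2"
    using Maclaurin_exp_le[of u 2] by blast
  then have "\<bar>exp u - 1 - u\<bar> = exp s * u\<^sup>2 / 2"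
    by (simp add: numeral_2_eq_2 abs_mult)
  also have "\<dots> \<le> u\<^sup>2 * exp s" by simp
  also have "\<dots> \<le> u\<^sup>2 * exp \<bar>u\<bar>" using s(1) by (intro mult_left_mono) auto
  finally show ?thesis .
qed

lemma square_le_exp: "0 \<le> u \<Longrightarrow> u\<^sup>2 \<le> exp (2 * u)" for u :: real
proof -
  assume "0 \<le> u"
  then have "u\<^sup>2 \<le> (exp u)\<^sup>2"
    using exp_ge_add_one_self[of u] by (intro power_mono) linarith+
  then show ?thesis by (simp add: exp_double)
qed

lemma exp_inner_remainder:
  fixes w z :: "'a::real_inner"
  assumes "norm w \<le> r"
  shows "\<bar>exp (w \<bullet> z) - 1 - w \<bullet> z\<bar> \<le> (norm w)\<^sup>2 * exp ((2 + r) * norm z)"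
proof -
  have wz: "\<bar>w \<bullet> z\<bar> \<le> norm w * norm z" by (rule Cauchy_Schwarz_ineq2)
  also have "\<dots> \<le> r * norm z" using assms by (intro mult_right_mono) auto
  finally have wz': "\<bar>w \<bullet> z\<bar> \<le> r * norm z" .
  have "\<bar>exp (w \<bullet> z) - 1 - w \<bullet> z\<bar> \<le> (w \<bullet> z)\<^sup>2 * exp \<bar>w \<bullet> z\<bar>" by (rule exp_remainder)
  also have "\<dots> \<le> ((norm w)\<^sup>2 * exp (2 * norm z)) * exp (r * norm z)"
  proof (intro mult_mono)
    have "(w \<bullet> z)\<^sup>2 \<le> (norm w * norm z)\<^sup>2" using wz by (simp add: abs_le_square_iff[symmetric])
    also have "\<dots> \<le> (norm w)\<^sup>2 * exp (2 * norm z)"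
      by (simp add: power_mult_distrib mult_left_mono square_le_exp)
    finally show "(w \<bullet> z)\<^sup>2 \<le> (norm w)\<^sup>2 * exp (2 * norm z)" .
  qed (use wz' in auto)
  finally show ?thesis by (simp only: distrib_right exp_add mult.assoc)
qed

text \<open>
  Weights of at most exponential growth are integrable against every Gaussian and are stable under
  multiplication by coordinates. Hence each partial derivative of a Laplace transform of such a
  weight is again such a Laplace transform, and smoothness follows by induction.
\<close>

definition exp_growth :: "('a::euclidean_space \<Rightarrow> real) \<Rightarrow> bool" where
  "exp_growth k \<longleftrightarrow> k \<in> borel_measurable borel \<and> (\<exists>A r. \<forall>z. \<bar>k z\<bar> \<le> A * exp (r * norm z))"

lemma exp_growthE:
  assumes "exp_growth k"
  obtains A r where "\<forall>z. \<bar>k z\<bar> \<le> A * exp (r * norm z)" "0 \<le> A"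
proof -
  obtain A r where *: "\<forall>z. \<bar>k z\<bar> \<le> A * exp (r * norm z)" using assms by (auto simp: exp_growth_def)
  have "0 \<le> A" using *[rule_format, of 0] by simp
  then show ?thesis using that * by blast
qed

lemma exp_growth_mult:
  assumes "exp_growth k" "exp_growth l"
  shows "exp_growth (\<lambda>z. k z * l z)"
proof -
  obtain A r where k: "\<forall>z. \<bar>k z\<bar> \<le> A * exp (r * norm z)" "0 \<le> A" by (rule exp_growthE[OF assms(1)])
  obtain B s where l: "\<forall>z. \<bar>l z\<bar> \<le> B * exp (s * norm z)" "0 \<le> B" by (rule exp_growthE[OF assms(2)])
  have "\<bar>k z * l z\<bar> \<le> (A * B) * exp ((r + s) * norm z)" for z
  proof -
    have "\<bar>k z * l z\<bar> \<le> (A * exp (r * norm z)) * (B * exp (s * norm z))"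
      unfolding abs_mult by (intro mult_mono k(1)[rule_format] l(1)[rule_format]) (auto simp: k)
    then show ?thesis by (simp only: distrib_right distrib_left exp_add mult_ac)
  qed
  moreover have "(\<lambda>z. k z * l z) \<in> borel_measurable borel"
    using assms unfolding exp_growth_def by auto
  ultimately show ?thesis unfolding exp_growth_def by blast
qed

lemma exp_growth_bounded: "k \<in> borel_measurable borel \<Longrightarrow> (\<And>z. \<bar>k z\<bar> \<le> A) \<Longrightarrow> exp_growth k"
  unfolding exp_growth_def by (intro conjI exI[of _ A] exI[of _ 0]) auto

lemma exp_growth_inner: "exp_growth (\<lambda>z. w \<bullet> z)"
proof -
  have "\<bar>w \<bullet> z\<bar> \<le> norm w * exp (1 * norm z)" for z
  proof -
    have "\<bar>w \<bullet> z\<bar> \<le> norm w * norm z" by (rule Cauchy_Schwarz_ineq2)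
    also have "\<dots> \<le> norm w * exp (1 * norm z)"
      using exp_ge_add_one_self[of "norm z"] by (intro mult_left_mono) (auto intro: order_trans[OF _ exp_ge_add_one_self])
    finally show ?thesis .
  qed
  then show ?thesis unfolding exp_growth_def by (intro conjI exI allI) (measurable, blast)
qed

lemma exp_growth_exp_inner: "exp_growth (\<lambda>z. exp (w \<bullet> z))"
  unfolding exp_growth_def
  by (intro conjI exI[of _ 1] exI[of _ "norm w"]) (auto intro: norm_cauchy_schwarz)

lemma exp_growth_exp_norm: "exp_growth (\<lambda>z. exp (r * norm z))"
  unfolding exp_growth_def by (intro conjI exI[of _ 1] exI[of _ r]) auto

lemma integrable_exp_growth:
  assumes "0 < t" "exp_growth k"
  shows "integrable (gauss t) k"
proof -
  obtain A r where k: "\<forall>z. \<bar>k z\<bar> \<le> A * exp (r * norm z)" "0 \<le> A" by (rule exp_growthE[OF assms(2)])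
  have "integrable (gauss t) (\<lambda>z. A * exp (r * norm z) :: real)"
    by (intro integrable_mult_right integrable_exp_norm_gauss assms)
  then show ?thesis
    by (rule Bochner_Integration.integrable_bound)
       (use assms(2) k in \<open>auto simp: exp_growth_def abs_mult\<close>)
qed

definition laplace :: "real \<Rightarrow> ('a::euclidean_space \<Rightarrow> real) \<Rightarrow> 'a \<Rightarrow> real" where
  "laplace t k x = (\<integral>z. k z * exp (((1 / t) *\<^sub>R x) \<bullet> z) \<partial>gauss t)"

lemma laplace_has_derivative:
  fixes k :: "'a::euclidean_space \<Rightarrow> real"
  assumes t: "0 < t" and k: "exp_growth k"
  shows "(laplace t k has_derivative (\<lambda>w. laplace t (\<lambda>z. k z * (((1 / t) *\<^sub>R w) \<bullet> z)) x)) (at x)"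
proof (rule has_derivative_of_quadratic_remainder)
  have [measurable]: "k \<in> borel_measurable borel" using k by (simp add: exp_growth_def)
  let ?y = "(1 / t) *\<^sub>R x"
  have int: "integrable (gauss t) (\<lambda>z. k z * (w \<bullet> z) * exp (y \<bullet> z))" for w y
    by (intro integrable_exp_growth[OF t] exp_growth_mult k exp_growth_inner exp_growth_exp_inner)
  have int0: "integrable (gauss t) (\<lambda>z. k z * exp (y \<bullet> z))" for y
    by (intro integrable_exp_growth[OF t] exp_growth_mult k exp_growth_exp_inner)
  show "bounded_linear (\<lambda>w. laplace t (\<lambda>z. k z * (((1 / t) *\<^sub>R w) \<bullet> z)) x)"
    unfolding linear_conv_bounded_linear[symmetric] laplace_def
  proof (rule linearI)
    fix a b :: 'a and r :: real
    let ?I = "\<lambda>w. \<integral>z. k z * (((1 / t) *\<^sub>R w) \<bullet> z) * exp (?y \<bullet> z) \<partial>gauss t"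
    show "?I (a + b) = ?I a + ?I b"
      by (subst Bochner_Integration.integral_add[symmetric, OF int int])
         (simp add: inner_add_left algebra_simps add_divide_distrib)
    show "?I (r *\<^sub>R b) = r *\<^sub>R ?I b"
      unfolding real_scaleR_def integral_mult_right_zero[symmetric]
      by (rule Bochner_Integration.integral_cong) (simp_all add: mult_ac)
  qed
  let ?B = "\<lambda>z. \<bar>k z\<bar> * (exp (norm ?y * norm z) * exp ((2 + 1 / t) * norm z))"
  have kabs: "exp_growth (\<lambda>z. \<bar>k z\<bar>)" using k by (simp add: exp_growth_def)
  have intB: "integrable (gauss t) ?B"
    by (intro integrable_exp_growth[OF t] exp_growth_mult kabs exp_growth_exp_norm)
  fix w :: 'a assume w: "norm w \<le> 1"
  let ?u = "(1 / t) *\<^sub>R w"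
  let ?rem = "\<lambda>z. k z * exp (((1 / t) *\<^sub>R (x + w)) \<bullet> z) - k z * exp (?y \<bullet> z) - k z * (?u \<bullet> z) * exp (?y \<bullet> z)"
  let ?R = "laplace t k (x + w) - laplace t k x - laplace t (\<lambda>z. k z * (?u \<bullet> z)) x"
  have pt: "\<bar>?rem z\<bar> \<le> (norm ?u)\<^sup>2 * ?B z" for z
  proof -
    have "?rem z = k z * (exp (?y \<bullet> z) * (exp (?u \<bullet> z) - 1 - ?u \<bullet> z))"
      by (simp only: scaleR_add_right inner_add_left exp_add) (simp add: algebra_simps)
    then have "\<bar>?rem z\<bar> = \<bar>k z\<bar> * (exp (?y \<bullet> z) * \<bar>exp (?u \<bullet> z) - 1 - ?u \<bullet> z\<bar>)"
      by (simp only: abs_mult abs_exp_cancel)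
    also have "\<dots> \<le> \<bar>k z\<bar> * (exp (norm ?y * norm z) * ((norm ?u)\<^sup>2 * exp ((2 + 1 / t) * norm z)))"
    proof (intro mult_left_mono mult_mono exp_inner_remainder)
      show "norm ?u \<le> 1 / t" using w t by (simp add: divide_right_mono)
      show "exp (?y \<bullet> z) \<le> exp (norm ?y * norm z)" by (simp only: exp_le_cancel_iff norm_cauchy_schwarz)
    qed auto
    finally show ?thesis by (simp only: mult_ac)
  qed
  have eq: "?R = (\<integral>z. ?rem z \<partial>gauss t)"
    unfolding laplace_def
    by (simp only: Bochner_Integration.integral_diff[OF int0 int0]
        Bochner_Integration.integral_diff[OF Bochner_Integration.integrable_diff[OF int0 int0] int])
  have "\<bar>?R\<bar> \<le> (\<integral>z. \<bar>?rem z\<bar> \<partial>gauss t)" unfolding eq by (rule integral_abs_bound)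
  also have "\<dots> \<le> (\<integral>z. (norm ?u)\<^sup>2 * ?B z \<partial>gauss t)"
    by (intro integral_mono integrable_abs Bochner_Integration.integrable_diff integrable_mult_right int int0 intB pt)
  also have "\<dots> = ((1 / t)\<^sup>2 * (\<integral>z. ?B z \<partial>gauss t)) * (norm w)\<^sup>2"
    by (simp add: power_divide)
  finally show "\<bar>?R\<bar> \<le> ((1 / t)\<^sup>2 * (\<integral>z. ?B z \<partial>gauss t)) * (norm w)\<^sup>2" .
qed

lemma C_k_laplace:
  assumes "0 < t" "exp_growth k"
  shows "C_k n (laplace t k)"
  using assms(2)
proof (induction n arbitrary: k)
  case 0
  then have "isCont (laplace t k) x" for x
    using laplace_has_derivative[OF assms(1), of k x] by (intro has_derivative_continuous) auto
  then show ?case by (simp add: continuous_at_imp_continuous_on)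
next
  case (Suc n)
  show ?case
    by (rule C_k_SucI[OF laplace_has_derivative[OF assms(1) Suc.prems]])
       (intro Suc.IH exp_growth_mult Suc.prems exp_growth_inner)
qed

text \<open>
  Moving the argument out of \<open>v\<close> by the Cameron-Martin formula shows the heat flow as a smooth
  Gaussian factor times a Laplace transform, even when \<open>v\<close> is only measurable.
\<close>

lemma heat_eq_laplace:
  fixes v :: "'a::euclidean_space \<Rightarrow> real"
  assumes t: "0 < t" and [measurable]: "v \<in> borel_measurable borel"
  shows "heat t v x = exp (- (norm x)\<^sup>2 / (2 * t)) * laplace t v x"
proof -
  let ?y = "(1 / t) *\<^sub>R x"
  have "heat t v x = (\<integral>z. v (z + t *\<^sub>R ?y) \<partial>gauss t)"
    using t by (simp add: heat_def add.commute)
  also have "\<dots> = (\<integral>z. v z * exp (?y \<bullet> z - t * (norm ?y)\<^sup>2 / 2) \<partial>gauss t)"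
    by (rule cameron_martin[OF t]) measurable
  also have "\<dots> = (\<integral>z. exp (- (norm x)\<^sup>2 / (2 * t)) * (v z * exp (?y \<bullet> z)) \<partial>gauss t)"
  proof (rule Bochner_Integration.integral_cong[OF refl])
    fix z
    have "?y \<bullet> z - t * (norm ?y)\<^sup>2 / 2 = - (norm x)\<^sup>2 / (2 * t) + ?y \<bullet> z"
      using t by (simp add: power_divide power2_eq_square)
    then show "v z * exp (?y \<bullet> z - t * (norm ?y)\<^sup>2 / 2) = exp (- (norm x)\<^sup>2 / (2 * t)) * (v z * exp (?y \<bullet> z))"
      by (simp only: exp_add mult_ac)
  qed
  finally show ?thesis by (simp add: laplace_def)
qed

lemma smooth_heat:
  fixes v :: "'a::euclidean_space \<Rightarrow> real"
  assumes t: "0 < t" and v: "borel_between c C v"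
  shows "smooth (heat t v)"
  unfolding smooth_def
proof
  fix n
  have vm: "v \<in> borel_measurable borel" by (rule borel_betweenD[OF v])
  have "exp_growth v"
  proof (rule exp_growth_bounded[OF vm])
    show "\<bar>v z\<bar> \<le> max \<bar>c\<bar> \<bar>C\<bar>" for z
      using borel_betweenD(2,3)[OF v, of z] by auto
  qed
  have sq: "C_k m (\<lambda>x::'a. - (norm x)\<^sup>2 / (2 * t))" for m
  proof (cases m)
    case (Suc j)
    have d: "((\<lambda>x::'a. - (norm x)\<^sup>2 / (2 * t)) has_derivative (\<lambda>h. (- 1 / t) * (x \<bullet> h))) (at x)" for x
      unfolding power2_norm_eq_inner
      using t by (auto intro!: derivative_eq_intros simp: inner_commute field_simps)
    show ?thesis unfolding Suc
      by (rule C_k_SucI[OF d]) (intro C_k_mult C_k_const C_k_inner)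
  qed (use t in \<open>auto intro!: continuous_intros\<close>)
  have "C_k n (\<lambda>x. exp (- (norm x)\<^sup>2 / (2 * t)) * laplace t v x)"
    by (intro C_k_mult C_k_exp sq C_k_laplace t \<open>exp_growth v\<close>)
  then show "C_k n (heat t v)"
    by (simp add: heat_eq_laplace[OF t vm, abs_def])
qed

section \<open>Uniform Taylor bounds\<close>

text \<open>
  The constant depends on the time and on the bound of \<open>v\<close> only. By translation it suffices to
  expand at the origin, where \<open>v\<close> enters the remainder only through its bound. For \<open>|w| \<ge> 1\<close> the
  crude bound \<open>C\<close> on the increments is already quadratic.
\<close>

lemma heat_taylor:
  fixes C :: real
  assumes t: "0 < t" and C: "0 \<le> C"
  shows "\<exists>A\<ge>0. \<forall>v::'a::euclidean_space \<Rightarrow> real. borel_between 0 C v \<longrightarrow>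
    (\<exists>D. \<forall>x w. norm (D x) \<le> A \<and> \<bar>heat t v (x + w) - heat t v x\<bar> \<le> A * norm w
        \<and> \<bar>heat t v (x + w) - heat t v x - D x \<bullet> w\<bar> \<le> A * (norm w)\<^sup>2)"
proof -
  let ?B = "\<lambda>z::'a. C * ((1 / t)\<^sup>2 * exp ((2 + 1 / t) * norm z) + 1 / t * exp (1 / t * norm z))"
  define K where "K = (\<integral>z. ?B z \<partial>gauss t)"
  define N where "N = (\<integral>z. C * (1 / t * exp (1 * norm (z::'a))) \<partial>gauss t)"
  define A where "A = K + 2 * N + C"
  have intB: "integrable (gauss t) ?B"
    by (intro integrable_exp_growth[OF t] integrable_mult_right Bochner_Integration.integrable_add
        exp_growth_exp_norm)
  have K: "0 \<le> K" unfolding K_def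
    using C t by (intro Bochner_Integration.integral_nonneg) auto
  have N: "0 \<le> N" unfolding N_def
    using C t by (intro Bochner_Integration.integral_nonneg) auto
  have A: "0 \<le> A" using K N C by (simp add: A_def)
  have "\<exists>D. \<forall>x w. norm (D x) \<le> A \<and> \<bar>heat t v (x + w) - heat t v x\<bar> \<le> A * norm w
        \<and> \<bar>heat t v (x + w) - heat t v x - D x \<bullet> w\<bar> \<le> A * (norm w)\<^sup>2"
    if v: "borel_between 0 C v" for v :: "'a \<Rightarrow> real"
  proof -
    have [measurable]: "v \<in> borel_measurable borel" by (rule borel_betweenD[OF v])
    have vb: "\<bar>v y\<bar> \<le> C" for y using borel_betweenD(2,3)[OF v, of y] by auto
    have vg: "exp_growth (\<lambda>z. v (x + z))" for x
      by (rule exp_growth_bounded[of _ C]) (auto simp: vb)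
    define d where "d x w = (\<integral>z. v (x + z) * (((1 / t) *\<^sub>R w) \<bullet> z) \<partial>gauss t)" for x w
    have dint: "integrable (gauss t) (\<lambda>z. v (x + z) * (w \<bullet> z))" for x w
      by (intro integrable_exp_growth[OF t] exp_growth_mult vg exp_growth_inner)
    have lin: "linear (d x)" for x
    proof (rule linearI)
      fix a b
      show "d x (a + b) = d x a + d x b"
        unfolding d_def
        by (subst Bochner_Integration.integral_add[symmetric, OF dint dint])
           (simp add: inner_add_left algebra_simps add_divide_distrib)
      fix r show "d x (r *\<^sub>R b) = r *\<^sub>R d x b"
        unfolding d_def real_scaleR_def integral_mult_right_zero[symmetric]
        by (rule Bochner_Integration.integral_cong) (simp_all add: mult_ac)
    qed
    \<comment> \<open>The vector that represents the linear functional \<open>d x\<close>.\<close>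
    define D where "D x = adjoint (d x) 1" for x
    have D: "D x \<bullet> w = d x w" for x w
      unfolding D_def inner_commute[of _ w] by (simp only: adjoint_works[OF lin] inner_real_def mult_1_right)
    have dbound: "\<bar>d x w\<bar> \<le> N * norm w" for x w
    proof -
      have "\<bar>d x w\<bar> \<le> (\<integral>z. \<bar>v (x + z) * (((1 / t) *\<^sub>R w) \<bullet> z)\<bar> \<partial>gauss t)"
        unfolding d_def by (rule integral_abs_bound)
      also have "\<dots> \<le> (\<integral>z. norm w * (C * (1 / t * exp (1 * norm (z::'a)))) \<partial>gauss t)"
      proof (rule integral_mono)
        show "integrable (gauss t) (\<lambda>z. norm w * (C * (1 / t * exp (1 * norm (z::'a)))))"
          by (intro integrable_exp_growth[OF t] integrable_mult_right exp_growth_exp_norm)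
        fix z :: 'a
        have "\<bar>w \<bullet> z\<bar> \<le> norm w * norm z" by (rule Cauchy_Schwarz_ineq2)
        also have "\<dots> \<le> norm w * exp (norm z)"
          using exp_ge_add_one_self[of "norm z"] by (intro mult_left_mono; linarith?) auto
        finally have "\<bar>v (x + z)\<bar> * (1 / t * \<bar>w \<bullet> z\<bar>) \<le> C * (1 / t * (norm w * exp (norm z)))"
          using t vb C by (intro mult_mono) (auto simp: divide_right_mono)
        then show "\<bar>v (x + z) * (((1 / t) *\<^sub>R w) \<bullet> z)\<bar> \<le> norm w * (C * (1 / t * exp (1 * norm z)))"
          using t by (simp add: abs_mult mult_ac)
      qed (intro integrable_abs dint)
      also have "\<dots> = N * norm w" by (simp add: N_def)
      finally show ?thesis .
    qed
    have nD: "norm (D x) \<le> N" for x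
    proof (cases "D x = 0")
      case False
      have "norm (D x) * norm (D x) = d x (D x)"
        by (simp add: D[symmetric] power2_norm_eq_inner[symmetric] power2_eq_square)
      also have "\<dots> \<le> N * norm (D x)" using dbound[of x "D x"] by simp
      finally show ?thesis using False by simp
    qed (use N in simp)
    let ?h = "\<lambda>x w. heat t v (x + w) - heat t v x" and ?r = "\<lambda>x w. heat t v (x + w) - heat t v x - D x \<bullet> w"
    have small: "\<bar>?r x w\<bar> \<le> K * (norm w)\<^sup>2" if w: "norm w \<le> 1" for x w
    proof -
      let ?u = "(1 / t) *\<^sub>R w"
      let ?b = "(norm w)\<^sup>2 / (2 * t)"
      let ?rem = "\<lambda>z. v (x + z) * (exp (?u \<bullet> z) * exp (- ?b)) - v (x + z) - v (x + z) * (?u \<bullet> z)"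
      have b: "t * (norm ?u)\<^sup>2 / 2 = ?b" using t by (simp add: power_divide power2_eq_square)
      have h: "heat t v (x + w) = (\<integral>z. v (x + z) * (exp (?u \<bullet> z) * exp (- ?b)) \<partial>gauss t)"
      proof -
        have "heat t v (x + w) = (\<integral>z. v (x + (z + t *\<^sub>R ?u)) \<partial>gauss t)"
          using t by (simp add: heat_def add_ac)
        also have "\<dots> = (\<integral>z. v (x + z) * exp (?u \<bullet> z - t * (norm ?u)\<^sup>2 / 2) \<partial>gauss t)"
          by (rule cameron_martin[OF t, where h = "\<lambda>z. v (x + z)"]) measurable
        finally show ?thesis unfolding b by (simp only: exp_add[symmetric] diff_conv_add_uminus)
      qed
      have int1: "integrable (gauss t) (\<lambda>z. v (x + z) * (exp (?u \<bullet> z) * exp (- ?b)))"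
        unfolding mult.assoc[symmetric]
        by (intro integrable_mult_left integrable_exp_growth[OF t] exp_growth_mult vg exp_growth_exp_inner)
      have int2: "integrable (gauss t) (\<lambda>z. v (x + z))"
        by (intro integrable_exp_growth[OF t] vg)
      have pt: "\<bar>?rem z\<bar> \<le> (norm w)\<^sup>2 * ?B z" for z
      proof -
        have u: "norm ?u \<le> 1 / t" using w t by (simp add: divide_right_mono)
        have 1: "\<bar>exp (?u \<bullet> z) - 1 - ?u \<bullet> z\<bar> \<le> (norm w)\<^sup>2 * ((1 / t)\<^sup>2 * exp ((2 + 1 / t) * norm z))"
          using exp_inner_remainder[OF u, of z] t by (simp add: power_divide)
        have 2: "\<bar>exp (?u \<bullet> z) * (exp (- ?b) - 1)\<bar> \<le> (norm w)\<^sup>2 * (1 / t * exp (1 / t * norm z))"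
        proof -
          have "\<bar>exp (- ?b) - 1\<bar> \<le> ?b"
          proof -
            have "0 \<le> ?b" using t by simp
            then have "exp (- ?b) \<le> 1" by (subst exp_le_one_iff) linarith
            then show ?thesis using exp_ge_add_one_self[of "- ?b"] by linarith
          qed
          also have "\<dots> \<le> (norm w)\<^sup>2 * (1 / t)" using t by (simp add: field_simps)
          finally have "exp (?u \<bullet> z) * \<bar>exp (- ?b) - 1\<bar> \<le> exp (1 / t * norm z) * ((norm w)\<^sup>2 * (1 / t))"
          proof (intro mult_mono)
            have "?u \<bullet> z \<le> norm ?u * norm z" by (rule norm_cauchy_schwarz)
            also have "\<dots> \<le> 1 / t * norm z" using u by (intro mult_right_mono) auto
            finally show "exp (?u \<bullet> z) \<le> exp (1 / t * norm z)" by (simp only: exp_le_cancel_iff)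
          qed auto
          then show ?thesis by (simp only: abs_mult abs_exp_cancel mult_ac)
        qed
        have eq: "?rem z
            = v (x + z) * ((exp (?u \<bullet> z) - 1 - ?u \<bullet> z) + exp (?u \<bullet> z) * (exp (- ?b) - 1))"
          by (simp add: algebra_simps)
        have "\<bar>?rem z\<bar> \<le> C * \<bar>(exp (?u \<bullet> z) - 1 - ?u \<bullet> z) + exp (?u \<bullet> z) * (exp (- ?b) - 1)\<bar>"
          unfolding eq by (subst abs_mult, intro mult_right_mono vb) auto
        also have "\<dots> \<le> C * ((norm w)\<^sup>2 * ((1 / t)\<^sup>2 * exp ((2 + 1 / t) * norm z))
            + (norm w)\<^sup>2 * (1 / t * exp (1 / t * norm z)))"
          using 1 2 by (intro mult_left_mono C) (rule order_trans[OF abs_triangle_ineq], rule add_mono)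
        finally show ?thesis by (simp only: distrib_left mult_ac)
      qed
      have eq: "?r x w = (\<integral>z. ?rem z \<partial>gauss t)"
        unfolding h D d_def heat_def[of t v x]
        by (simp only: Bochner_Integration.integral_diff[OF int1 int2]
            Bochner_Integration.integral_diff[OF Bochner_Integration.integrable_diff[OF int1 int2] dint])
      have "\<bar>?r x w\<bar> \<le> (\<integral>z. \<bar>?rem z\<bar> \<partial>gauss t)"
        unfolding eq by (rule integral_abs_bound)
      also have "\<dots> \<le> (\<integral>z. (norm w)\<^sup>2 * ?B z \<partial>gauss t)"
        by (intro integral_mono integrable_abs Bochner_Integration.integrable_diff integrable_mult_right
            int1 int2 dint intB pt)
      also have "\<dots> = K * (norm w)\<^sup>2" by (simp only: integral_mult_right_zero K_def mult.commute)
      finally show ?thesis .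
    qed
    have hb: "0 \<le> heat t v y" "heat t v y \<le> C" for y
      using borel_betweenD(2,3)[OF borel_between_heat[OF t v]] by auto
    have diff: "\<bar>?h x w\<bar> \<le> C" for x w
      using hb[of x] hb[of "x + w"] by (auto simp: abs_if)
    have "norm (D x) \<le> A \<and> \<bar>?h x w\<bar> \<le> A * norm w
        \<and> \<bar>?r x w\<bar> \<le> A * (norm w)\<^sup>2" for x w
    proof (intro conjI)
      show "norm (D x) \<le> A" using nD[of x] K N C by (simp add: A_def)
      have Dw: "\<bar>D x \<bullet> w\<bar> \<le> N * norm w" using dbound D by simp
      show "\<bar>?h x w\<bar> \<le> A * norm w"
      proof (cases "norm w \<le> 1")
        case True
        have "\<bar>?h x w\<bar> \<le> K * (norm w)\<^sup>2 + N * norm w"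
          using small[OF True, of x] Dw by linarith
        also have "\<dots> \<le> K * norm w + N * norm w"
          using True K by (simp add: power2_eq_square mult_left_mono mult_left_le_one_le)
        also have "\<dots> \<le> A * norm w"
          unfolding A_def distrib_right[symmetric] using N C by (intro mult_right_mono) auto
        finally show ?thesis .
      next
        case False
        then have "C \<le> A * norm w"
          using mult_mono[of C A 1 "norm w"] C A K N by (simp add: A_def)
        then show ?thesis using diff[of x w] by linarith
      qed
      show "\<bar>?r x w\<bar> \<le> A * (norm w)\<^sup>2"
      proof (cases "norm w \<le> 1")
        case True
        have "K * (norm w)\<^sup>2 \<le> A * (norm w)\<^sup>2"
          unfolding A_def using N C by (intro mult_right_mono) auto
        then show ?thesis using small[OF True, of x] by linarith
      next
        case False
        then have w: "1 \<le> norm w" by simp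
        have "\<bar>?r x w\<bar> \<le> C + N * norm w"
          using diff[of x w] Dw by linarith
        also have "\<dots> \<le> (C + N) * (norm w)\<^sup>2"
        proof -
          have "norm w \<le> (norm w)\<^sup>2" using w self_le_power[of "norm w" 2] by simp
          then have "N * norm w \<le> N * (norm w)\<^sup>2" using N by (rule mult_left_mono)
          moreover have "C * 1 \<le> C * (norm w)\<^sup>2" using one_le_power[OF w] C by (rule mult_left_mono)
          ultimately show ?thesis by (simp add: distrib_right)
        qed
        also have "\<dots> \<le> A * (norm w)\<^sup>2"
          unfolding A_def using K N by (intro mult_right_mono) auto
        finally show ?thesis .
      qed
    qed
    then show ?thesis by blast
  qed
  then show ?thesis using A by blast
qed

text \<open>
  The upper bound is \<open>ln u \<le> u - 1\<close> at \<open>u = b / a\<close>; the lower bound is the same inequality at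
  \<open>u = a / b\<close>.
\<close>

lemma ln_taylor:
  fixes a b c :: real
  assumes "0 < c" "c \<le> a" "c \<le> b"
  shows "\<bar>ln b - ln a - (b - a) / a\<bar> \<le> (b - a)\<^sup>2 / c\<^sup>2"
proof -
  have pos: "0 < a" "0 < b" using assms by auto
  have up: "ln b - ln a \<le> (b - a) / a"
    using ln_le_minus_one[of "b / a"] pos by (simp add: ln_div diff_divide_distrib)
  have "ln a - ln b \<le> (a - b) / b"
    using ln_le_minus_one[of "a / b"] pos by (simp add: ln_div diff_divide_distrib)
  then have "(b - a) / a - (ln b - ln a) \<le> (b - a) / a - (b - a) / b"
    by (simp add: diff_divide_distrib)
  also have "\<dots> = (b - a)\<^sup>2 / (a * b)"
    using pos by (simp add: field_simps power2_eq_square)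
  also have "\<dots> \<le> (b - a)\<^sup>2 / c\<^sup>2"
    using assms pos by (intro divide_left_mono) (auto simp: power2_eq_square intro: mult_mono)
  finally show ?thesis using up zero_le_power2[of "b - a"] by (simp add: abs_if)
qed

text \<open>
  This uniform bound is what makes the finite-step argument converge: in the chain for
  hypercontractivity the functions \<open>v\<close> change with the number of steps, but they keep values in
  the same interval.
\<close>

lemma ln_heat_taylor:
  fixes C :: real
  assumes t: "0 < t" and c: "0 < c" "c \<le> C"
  shows "\<exists>A\<ge>0. \<forall>v::'a::euclidean_space \<Rightarrow> real. borel_between c C v \<longrightarrow>
    (\<exists>D. \<forall>x w. \<bar>ln (heat t v (x + w)) - ln (heat t v x) - D x \<bullet> w\<bar> \<le> A * (norm w)\<^sup>2)"
proof -
  obtain A where A: "0 \<le> A" and *: "\<And>v::'a \<Rightarrow> real. borel_between 0 C v \<Longrightarrow>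
    \<exists>D. \<forall>x w. norm (D x) \<le> A \<and> \<bar>heat t v (x + w) - heat t v x\<bar> \<le> A * norm w
        \<and> \<bar>heat t v (x + w) - heat t v x - D x \<bullet> w\<bar> \<le> A * (norm w)\<^sup>2"
    using heat_taylor[OF t, of C, where 'a = 'a] c by force
  define B where "B = A / c + A\<^sup>2 / c\<^sup>2"
  have B: "0 \<le> B" using A c by (simp add: B_def)
  have "\<exists>D. \<forall>x w. \<bar>ln (heat t v (x + w)) - ln (heat t v x) - D x \<bullet> w\<bar> \<le> B * (norm w)\<^sup>2"
    if v: "borel_between c C v" for v :: "'a \<Rightarrow> real"
  proof -
    have "borel_between 0 C v" using v c unfolding borel_between_def by (auto intro: order_trans[of 0 c])
    from *[OF this] obtain D where D: "\<bar>heat t v (x + w) - heat t v x\<bar> \<le> A * norm w"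
        "\<bar>heat t v (x + w) - heat t v x - D x \<bullet> w\<bar> \<le> A * (norm w)\<^sup>2" for x w
      by blast
    have hb: "c \<le> heat t v y" for y
      using borel_betweenD(2)[OF borel_between_heat[OF t v]] .
    have "\<bar>ln (heat t v (x + w)) - ln (heat t v x) - (D x /\<^sub>R heat t v x) \<bullet> w\<bar> \<le> B * (norm w)\<^sup>2" for x w
    proof -
      let ?a = "heat t v x" and ?b = "heat t v (x + w)"
      have a: "0 < ?a" using hb[of x] c by simp
      have "\<bar>ln ?b - ln ?a - (?b - ?a) / ?a\<bar> \<le> (?b - ?a)\<^sup>2 / c\<^sup>2"
        by (rule ln_taylor[OF c(1) hb hb])
      also have "(?b - ?a)\<^sup>2 \<le> (A * norm w)\<^sup>2"
        using D(1)[of x w] A by (simp add: abs_le_square_iff[symmetric])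
      then have "(?b - ?a)\<^sup>2 / c\<^sup>2 \<le> A\<^sup>2 / c\<^sup>2 * (norm w)\<^sup>2"
        by (simp add: divide_right_mono power_mult_distrib)
      finally have 1: "\<bar>ln ?b - ln ?a - (?b - ?a) / ?a\<bar> \<le> A\<^sup>2 / c\<^sup>2 * (norm w)\<^sup>2" .
      have "\<bar>(?b - ?a) / ?a - (D x /\<^sub>R ?a) \<bullet> w\<bar> = \<bar>?b - ?a - D x \<bullet> w\<bar> / ?a"
        using a by (simp add: divide_inverse_commute abs_mult right_diff_distrib[symmetric])
      also have "\<dots> \<le> (A * (norm w)\<^sup>2) / c"
        using D(2)[of x w] hb[of x] c A by (intro frac_le) auto
      finally show ?thesis using 1 by (simp add: B_def distrib_right)
    qed
    then show ?thesis by (intro exI[of _ "\<lambda>x. D x /\<^sub>R heat t v x"]) auto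
  qed
  then show ?thesis using B by blast
qed

section \<open>Iterates of the heat flow\<close>

lemma borel_between_heat_funpow:
  "0 < t \<Longrightarrow> borel_between c C v \<Longrightarrow> borel_between c C ((heat t ^^ i) v)"
  by (induction i) (auto intro: borel_between_heat)

lemma heat_funpow_mono:
  assumes "0 < t" "borel_between c C u" "borel_between c' C' v" "\<And>x. u x \<le> v x"
  shows "(heat t ^^ i) u x \<le> (heat t ^^ i) v x"
  using assms(4)
proof (induction i arbitrary: x)
  case (Suc i)
  then show ?case
    using heat_mono[OF assms(1) borel_between_heat_funpow[OF assms(1,2)] borel_between_heat_funpow[OF assms(1,3)]]
    by simp
qed simp

lemma heat_funpow_translate: "(heat t ^^ i) (\<lambda>z. v (h + z)) = (\<lambda>x. (heat t ^^ i) v (h + x))"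
  by (induction i) (auto simp: heat_translate)

lemma heat_funpow_cmult: "(heat t ^^ i) (\<lambda>z. c * v z) = (\<lambda>x. c * (heat t ^^ i) v x)"
  by (induction i) (auto simp: heat_cmult)

lemma heat_funpow_semigroup:
  assumes "0 < s" "0 < t" "borel_between c C v"
  shows "heat s ((heat t ^^ i) v) = heat (s + real i * t) v"
  using assms(3)
proof (induction i arbitrary: v)
  case (Suc i)
  have "heat s ((heat t ^^ Suc i) v) = heat s ((heat t ^^ i) (heat t v))"
    by (simp add: funpow_swap1)
  also have "\<dots> = heat (s + real i * t) (heat t v)"
    by (rule Suc.IH[OF borel_between_heat[OF assms(2) Suc.prems]])
  also have "\<dots> = heat (s + real i * t + t) v"
    using assms by (intro heat_heat[OF _ _ Suc.prems] add_pos_nonneg) auto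
  finally show ?case by (simp add: algebra_simps)
qed simp

section \<open>Consequences of the log-Sobolev inequality\<close>

lemma prob_space_density_iff:
  fixes g :: "'b \<Rightarrow> real"
  assumes g [measurable]: "g \<in> borel_measurable M" and nn: "\<And>x. 0 \<le> g x"
  shows "prob_space (density M g) \<longleftrightarrow> integrable M g \<and> (\<integral>x. g x \<partial>M) = 1"
proof -
  have e: "emeasure (density M g) (space (density M g)) = (\<integral>\<^sup>+x. g x \<partial>M)"
    by (simp add: emeasure_density cong: nn_integral_cong)
  show ?thesis
  proof
    assume "prob_space (density M g)"
    then have eq: "(\<integral>\<^sup>+x. g x \<partial>M) = 1" using prob_space.emeasure_space_1 e by metis
    then have i: "integrable M g" using nn by (intro integrableI_nonneg) auto
    then have "ennreal (\<integral>x. g x \<partial>M) = ennreal 1" using eq nn by (simp add: nn_integral_eq_integral)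
    then show "integrable M g \<and> (\<integral>x. g x \<partial>M) = 1"
      using i nn by (subst (asm) ennreal_inj) (auto intro!: Bochner_Integration.integral_nonneg)
  next
    assume "integrable M g \<and> (\<integral>x. g x \<partial>M) = 1"
    then show "prob_space (density M g)"
      using nn e by (intro prob_spaceI) (simp add: nn_integral_eq_integral)
  qed
qed

text \<open>
  Jensen's inequality for the exponential function under the law with density \<open>g\<close>. Applied to a
  function minus \<open>ln g\<close> it is the Gibbs variational principle.
\<close>

lemma exp_jensen_density:
  fixes g X :: "'b \<Rightarrow> real"
  assumes g: "\<And>x. 0 \<le> g x" "integrable M g" "(\<integral>x. g x \<partial>M) = 1"
    and int: "integrable M (\<lambda>x. X x * g x)" "integrable M (\<lambda>x. exp (X x) * g x)"
  shows "exp (\<integral>x. X x * g x \<partial>M) \<le> (\<integral>x. exp (X x) * g x \<partial>M)"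
proof -
  define m where "m = (\<integral>x. X x * g x \<partial>M)"
  have "exp m * (g x + X x * g x - m * g x) \<le> exp (X x) * g x" for x
  proof -
    have "exp m * (1 + (X x - m)) \<le> exp m * exp (X x - m)"
      by (intro mult_left_mono exp_ge_add_one_self) auto
    also have "\<dots> = exp (X x)" by (simp add: exp_diff)
    finally have "exp m * (1 + (X x - m)) * g x \<le> exp (X x) * g x" using g(1) by (rule mult_right_mono)
    then show ?thesis by (simp add: algebra_simps)
  qed
  then have "(\<integral>x. exp m * (g x + X x * g x - m * g x) \<partial>M) \<le> (\<integral>x. exp (X x) * g x \<partial>M)"
    using int g(2) by (intro integral_mono) auto
  then show ?thesis using int(1) g(2,3) by (simp add: m_def)
qed

lemma KL_density_real:
  fixes g :: "'b \<Rightarrow> real"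
  assumes "prob_space M" and g [measurable]: "g \<in> borel_measurable M" and nn: "\<And>x. 0 \<le> g x"
  shows "KL M (density M g) = (if integrable M (\<lambda>x. g x * ln (g x)) then ereal (\<integral>x. g x * ln (g x) \<partial>M) else \<infinity>)"
proof -
  interpret prob_space M by fact
  have ac: "absolutely_continuous M (density M g)"
    by (rule absolutely_continuousI_density) simp
  have log: "log (exp 1) y = ln y" for y by (simp add: log_def)
  have "AE x in M. ennreal (g x) = RN_deriv M (density M g) x"
    by (rule RN_deriv_unique) auto
  then have eq: "AE x in M. g x * entropy_density (exp 1) M (density M g) x = g x * ln (g x)"
  proof eventually_elim
    case (elim x)
    have "enn2real (RN_deriv M (density M g) x) = g x"
      unfolding elim[symmetric] by (simp add: nn)
    then show ?case by (simp add: entropy_density_def log)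
  qed
  have "integrable (density M g) (entropy_density (exp 1) M (density M g))
      \<longleftrightarrow> integrable M (\<lambda>x. g x * entropy_density (exp 1) M (density M g) x)"
    by (rule integrable_real_density) (auto simp: nn)
  also have "\<dots> \<longleftrightarrow> integrable M (\<lambda>x. g x * ln (g x))"
    by (rule integrable_cong_AE[OF _ _ eq]) measurable
  finally have "integrable (density M g) (entropy_density (exp 1) M (density M g)) \<longleftrightarrow> integrable M (\<lambda>x. g x * ln (g x))" .
  moreover have "KL_divergence (exp 1) M (density M g) = (\<integral>x. g x * ln (g x) \<partial>M)"
    using nn by (subst KL_density) (auto simp: log)
  ultimately show ?thesis using ac by (simp add: KL_def)
qed

text \<open>
  Let \<open>\<nu>\<close> have density \<open>g\<close> proportional to \<open>exp ((P + \<tau>) L)\<close>. The Gibbs variational principle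
  bounds \<open>ln \<integral> exp (P Lp) d\<pi>\<close> from below by \<open>P \<integral> Lp d\<nu> - KL(\<nu>)\<close>. Replacing \<open>Lp\<close> by \<open>L\<close> and \<open>P\<close> by
  \<open>P + \<tau>\<close> loses a multiple of \<open>KL(\<nu>)\<close>, which by the log-Sobolev inequality is controlled by the
  Fisher information \<open>(P + \<tau>)\<^sup>2 \<integral> |D|\<^sup>2 d\<nu>\<close>, and the gain \<open>\<kappa> |D|\<^sup>2\<close> in \<open>Lp\<close> pays for it. The
  condition on \<open>\<tau>\<close> is the resulting balance.
\<close>

lemma lsi_gradient_step:
  fixes L Lp :: "'a::euclidean_space \<Rightarrow> real"
  assumes prob: "prob_space \<pi>" and sets: "sets \<pi> = sets borel"
    and lsi: "LSI \<alpha> \<pi>" and \<alpha>: "0 < \<alpha>"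
    and L: "borel_between c C L" "smooth L" "\<And>x. GDERIV L x :> D x"
    and Lp: "borel_between c' C' Lp" "\<And>x. L x + \<kappa> * (norm (D x))\<^sup>2 \<le> Lp x" and \<kappa>: "0 < \<kappa>"
    and P: "1 \<le> P" and \<tau>: "0 \<le> \<tau>" "\<tau> * (1 + \<tau>) \<le> 2 * \<alpha> * \<kappa>"
  shows "ln (\<integral>x. exp ((P + \<tau>) * L x) \<partial>\<pi>) / (P + \<tau>) \<le> ln (\<integral>x. exp (P * Lp x) \<partial>\<pi>) / P"
proof -
  interpret prob_space \<pi> by fact
  have [measurable]: "L \<in> borel_measurable \<pi>" "Lp \<in> borel_measurable \<pi>"
    using borel_betweenD(1)[OF L(1)] borel_betweenD(1)[OF Lp(1)] measurable_cong_sets[OF sets refl] by blast+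
  define P' where "P' = P + \<tau>"
  have P': "0 < P'" "1 \<le> P'" using P \<tau> by (auto simp: P'_def)
  have fin: "finite_measure \<pi>" by unfold_locales
  have Lb: "\<bar>L x\<bar> \<le> max \<bar>c\<bar> \<bar>C\<bar>" for x using borel_betweenD(2,3)[OF L(1), of x] by auto
  have Lpb: "\<bar>Lp x\<bar> \<le> max \<bar>c'\<bar> \<bar>C'\<bar>" for x using borel_betweenD(2,3)[OF Lp(1), of x] by auto
  have eb: "borel_between (exp (s * a)) (exp (s * b)) (\<lambda>x. exp (s * h x))"
    if "borel_between a b h" "0 < s" for s a b and h :: "'a \<Rightarrow> real"
    using that unfolding borel_between_def by (auto intro!: mult_left_mono)
  note eL = eb[OF L(1) P'(1)]
  define Z where "Z = (\<integral>x. exp (P' * L x) \<partial>\<pi>)"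
  have intZ: "integrable \<pi> (\<lambda>x. exp (P' * L x))" by (rule integrable_borel_between[OF fin sets eL])
  have Z: "0 < Z" unfolding Z_def by (rule integral_borel_between_pos[OF prob sets eL]) simp
  define g where "g x = exp (P' * L x) / Z" for x
  have g: "0 < g x" for x using Z by (simp add: g_def)
  have gm [measurable]: "g \<in> borel_measurable \<pi>" unfolding g_def by measurable
  have gb: "g x \<le> exp (P' * C) / Z" for x
    using borel_betweenD(3)[OF eL, of x] Z by (simp add: g_def divide_right_mono)
  have intg: "integrable \<pi> (\<lambda>x. h x * g x)" if "h \<in> borel_measurable \<pi>" "\<And>x. \<bar>h x\<bar> \<le> B" for h :: "'a \<Rightarrow> real" and B
  proof (rule integrable_const_bound[OF AE_I2])
    show "norm (h x * g x) \<le> B * (exp (P' * C) / Z)" for x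
      unfolding real_norm_def abs_mult using that(2)[of x] gb[of x] g[of x]
      by (intro mult_mono) (auto intro: order_trans[OF abs_ge_zero])
  qed (use that in measurable)
  have int1: "integrable \<pi> g" using intZ by (simp add: g_def[abs_def])
  have g1: "(\<integral>x. g x \<partial>\<pi>) = 1" using Z by (simp add: g_def Z_def)
  have lng: "ln (g x) = P' * L x - ln Z" for x using Z by (simp add: g_def ln_div)
  have intL: "integrable \<pi> (\<lambda>x. L x * g x)" by (rule intg[OF _ Lb]) simp
  have intLp: "integrable \<pi> (\<lambda>x. Lp x * g x)" by (rule intg[OF _ Lpb]) simp
  have gln: "g x * ln (g x) = P' * (L x * g x) - ln Z * g x" for x by (simp add: lng algebra_simps)
  have intgln: "integrable \<pi> (\<lambda>x. g x * ln (g x))" unfolding gln using intL int1 by simp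
  define E where "E = (\<integral>x. g x * ln (g x) \<partial>\<pi>)"
  have E: "E = P' * (\<integral>x. L x * g x \<partial>\<pi>) - ln Z"
    unfolding E_def gln using intL int1 g1 by simp
  have E0: "0 \<le> E"
  proof -
    have inv: "exp (- ln (g x)) * g x = 1" for x using g[of x] by (simp add: exp_minus)
    have "exp (\<integral>x. - ln (g x) * g x \<partial>\<pi>) \<le> (\<integral>x. exp (- ln (g x)) * g x \<partial>\<pi>)"
      by (rule exp_jensen_density[OF g[THEN less_imp_le] int1 g1]) (use intgln in \<open>simp_all only: inv mult_minus_left mult.commute[of "ln _"]\<close>, auto)
    then show ?thesis unfolding inv using prob_space by (simp add: E_def mult.commute)
  qed
  \<comment> \<open>The gain, measured by the integrable majorant \<open>Lp - L\<close> of \<open>\<kappa> |D|\<^sup>2\<close>.\<close>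
  define I where "I = (\<integral>x. Lp x * g x - L x * g x \<partial>\<pi>)"
  have intI: "integrable \<pi> (\<lambda>x. Lp x * g x - L x * g x)" using intL intLp by simp
  have D0: "0 \<le> Lp x - L x" for x using Lp(2)[of x] \<kappa> zero_le_power2[of "norm (D x)"]
    by (smt (verit) mult_nonneg_nonneg)
  have fisher: "fisher_information \<pi> g \<le> ennreal (P'\<^sup>2 / \<kappa> * I)"
  proof -
    have gr: "grad (\<lambda>z. ln (g z)) x = P' *\<^sub>R D x" for x
    proof -
      have d: "GDERIV (\<lambda>z. ln (g z)) x :> P' *\<^sub>R D x"
        unfolding lng gderiv_def
        using L(3)[of x] unfolding gderiv_def by (auto intro!: derivative_eq_intros)
      have "grad (\<lambda>z. ln (g z)) x = D'" if "GDERIV (\<lambda>z. ln (g z)) x :> D'" for D'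
      proof -
        have "GDERIV (\<lambda>z. ln (g z)) x :> grad (\<lambda>z. ln (g z)) x"
          unfolding grad_def using that by (rule someI)
        then have "(\<lambda>h. h \<bullet> grad (\<lambda>z. ln (g z)) x) = (\<lambda>h. h \<bullet> D')"
          using that unfolding gderiv_def by (rule has_derivative_unique)
        then show ?thesis by (metis inner_commute vector_eq_rdot)
      qed
      from this[OF d] show ?thesis .
    qed
    have "fisher_information \<pi> g \<le> (\<integral>\<^sup>+x. ennreal (P'\<^sup>2 / \<kappa> * (Lp x * g x - L x * g x)) \<partial>\<pi>)"
      unfolding fisher_information_def gr
    proof (intro nn_integral_mono ennreal_leI)
      fix x
      have "(norm (D x))\<^sup>2 \<le> (Lp x - L x) / \<kappa>" using Lp(2)[of x] \<kappa> by (simp add: field_simps)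
      then have "(g x * P'\<^sup>2) * (norm (D x))\<^sup>2 \<le> (g x * P'\<^sup>2) * ((Lp x - L x) / \<kappa>)"
        using g[of x] by (intro mult_left_mono) auto
      then show "g x * (norm (P' *\<^sub>R D x))\<^sup>2 \<le> P'\<^sup>2 / \<kappa> * (Lp x * g x - L x * g x)"
        by (simp add: power_mult_distrib field_simps)
    qed
    also have "\<dots> = ennreal (\<integral>x. P'\<^sup>2 / \<kappa> * (Lp x * g x - L x * g x) \<partial>\<pi>)"
    proof (rule nn_integral_eq_integral)
      show "AE x in \<pi>. 0 \<le> P'\<^sup>2 / \<kappa> * (Lp x * g x - L x * g x)"
        unfolding left_diff_distrib[symmetric] using \<kappa> D0 g[THEN less_imp_le]
        by (intro AE_I2 mult_nonneg_nonneg divide_nonneg_pos zero_le_power2)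
    qed (intro integrable_mult_right intI)
    finally show ?thesis by (simp add: I_def)
  qed
  have I0: "0 \<le> I" unfolding I_def
    using D0 g[THEN less_imp_le] by (intro Bochner_Integration.integral_nonneg) (auto intro!: mult_right_mono)
  have sg: "smooth g"
  proof -
    have "g = (\<lambda>x. exp (P' * L x + (- ln Z)))"
      using Z by (auto simp: g_def[abs_def] exp_diff)
    then show ?thesis
      using L(2) unfolding smooth_def
      by (simp del: add_uminus_conv_diff) (intro allI C_k_exp C_k_add C_k_mult C_k_const, simp)
  qed
  have "prob_space (density \<pi> g)"
    using prob_space_density_iff[OF gm g[THEN less_imp_le]] int1 g1 by simp
  with lsi sg g[THEN less_imp_le]
  have "KL \<pi> (density \<pi> g) \<le> ereal (1 / (2 * \<alpha>)) * enn2ereal (fisher_information \<pi> g)"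
    unfolding LSI_def by blast
  also have "\<dots> \<le> ereal (1 / (2 * \<alpha>)) * enn2ereal (ennreal (P'\<^sup>2 / \<kappa> * I))"
    using \<alpha> fisher by (intro ereal_mult_left_mono) (auto simp: less_eq_ennreal.rep_eq)
  also have "\<dots> = ereal (1 / (2 * \<alpha>) * (P'\<^sup>2 / \<kappa> * I))"
    using I0 \<kappa> by (simp add: enn2ereal_ennreal)
  finally have EI: "E \<le> 1 / (2 * \<alpha>) * (P'\<^sup>2 / \<kappa> * I)"
    using KL_density_real[OF prob gm g[THEN less_imp_le]] intgln by (simp add: E_def)
  \<comment> \<open>Chosen so that \<open>exp X\<close> times the density of \<open>\<nu>\<close> is \<open>exp (P Lp)\<close>; Jensen for \<open>exp\<close> is the variational principle.\<close>
  define X where "X x = P * Lp x - P' * L x + ln Z" for x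
  define m where "m = (\<integral>x. X x * g x \<partial>\<pi>)"
  have Xg: "X x * g x = P * (Lp x * g x) - P' * (L x * g x) + ln Z * g x" for x
    by (simp add: X_def algebra_simps)
  have intX: "integrable \<pi> (\<lambda>x. X x * g x)" unfolding Xg using intL intLp int1 by simp
  have m: "m = P * I + P * ((E + ln Z) / P') - E"
  proof -
    have "(\<integral>x. L x * g x \<partial>\<pi>) = (E + ln Z) / P'" using E P' by simp
    moreover have "(\<integral>x. Lp x * g x \<partial>\<pi>) = I + (\<integral>x. L x * g x \<partial>\<pi>)"
      unfolding I_def using intL intLp by simp
    moreover have "m = P * (\<integral>x. Lp x * g x \<partial>\<pi>) - P' * (\<integral>x. L x * g x \<partial>\<pi>) + ln Z"
      unfolding m_def Xg using intL intLp int1 g1 by simp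
    ultimately show ?thesis using E by (simp add: algebra_simps)
  qed
  have jensen: "exp m \<le> (\<integral>x. exp (P * Lp x) \<partial>\<pi>)"
  proof -
    have eX: "exp (X x) * g x = exp (P * Lp x)" for x
      using Z by (simp add: X_def g_def exp_add exp_diff)
    have "integrable \<pi> (\<lambda>x. exp (P * Lp x))"
      using P by (intro integrable_borel_between[OF fin sets eb[OF Lp(1)]]) simp
    then show ?thesis
      using exp_jensen_density[OF g[THEN less_imp_le] int1 g1 intX] by (simp add: eX m_def)
  qed
  then have "m \<le> ln (\<integral>x. exp (P * Lp x) \<partial>\<pi>)"
    by (metis exp_gt_zero less_le_trans ln_exp ln_mono)
  moreover have "P * (ln Z / P') \<le> m"
  proof -
    have EI': "2 * \<alpha> * \<kappa> * E \<le> P'\<^sup>2 * I" using EI \<alpha> \<kappa> by (simp add: field_simps)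
    have "\<tau> * P' \<le> 2 * \<alpha> * \<kappa> * P"
    proof -
      have "\<tau> * P' \<le> \<tau> * (1 + \<tau>) * P"
        using \<tau>(1) P mult_left_mono[of 1 P "\<tau> * \<tau>"] by (simp add: P'_def algebra_simps)
      also have "\<dots> \<le> 2 * \<alpha> * \<kappa> * P" using \<tau>(2) P by (intro mult_right_mono) auto
      finally show ?thesis .
    qed
    then have "\<tau> * P' * E \<le> 2 * \<alpha> * \<kappa> * P * E" using E0 by (intro mult_right_mono)
    also have "\<dots> = P * (2 * \<alpha> * \<kappa> * E)" by simp
    also have "\<dots> \<le> P * (P'\<^sup>2 * I)" using P EI' by (intro mult_left_mono) auto
    finally have "\<tau> * P' * E \<le> P * (P'\<^sup>2 * I)" .
    then have "P' * (\<tau> * E) \<le> P' * (P * P' * I)" by (simp add: mult_ac power2_eq_square)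
    then have "\<tau> * E \<le> P * P' * I" using P'(1) by (simp only: mult_le_cancel_left_pos)
    then have "\<tau> * E / P' \<le> P * I" using P'(1) by (simp add: field_simps)
    moreover have "P * ((E + ln Z) / P') - E = P * (ln Z / P') - \<tau> * E / P'"
    proof -
      have Peq: "P = P' - \<tau>" by (simp add: P'_def)
      show ?thesis unfolding Peq using P'(1) by (simp add: field_simps)
    qed
    ultimately show ?thesis unfolding m by linarith
  qed
  ultimately have "P * (ln Z / P') \<le> ln (\<integral>x. exp (P * Lp x) \<partial>\<pi>)" by linarith
  then show ?thesis
    using P unfolding Z_def P'_def by (simp add: field_simps)
qed

text \<open>
  The steps of the previous lemma, chained along the interpolation. The time is divided into an
  initial piece \<open>\<epsilon>\<close> and \<open>n\<close> pieces of length \<open>\<delta>\<close>, and \<open>L i\<close> is the interpolation at time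
  \<open>\<epsilon> + i \<delta>\<close>. Every \<open>L i\<close> is, up to the factor \<open>1/p\<close>, the logarithm of \<open>heat \<epsilon>\<close> applied to a
  function with values in one fixed interval, so all \<open>L i\<close> are smooth with one Taylor constant
  \<open>M\<close>, whatever \<open>n\<close> is. That is the purpose of the initial piece.
\<close>

lemma heat_hypercontractivity:
  fixes v :: "'a::euclidean_space \<Rightarrow> real"
  assumes prob: "prob_space \<pi>" and sets: "sets \<pi> = sets borel"
    and lsi: "LSI \<alpha> \<pi>" and \<alpha>: "0 < \<alpha>"
    and \<eta>: "0 < \<eta>" and p: "1 < p" and b: "1 < b" "b < 1 + \<alpha> * \<eta>"
    and v: "borel_between c C v" and c: "0 < c"
  shows "(\<integral>x. heat \<eta> v x powr (1 + b * (p - 1)) \<partial>\<pi>) powr (1 / (1 + b * (p - 1)))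
    \<le> (\<integral>x. heat \<eta> (\<lambda>z. v z powr p) x \<partial>\<pi>) powr (1 / p)"
proof -
  interpret prob_space \<pi> by fact
  define a where "a = p - 1"
  have a: "0 < a" using p by (simp add: a_def)
  have cC: "c \<le> C" using borel_betweenD(2,3)[OF v, of 0] by simp
  \<comment> \<open>The remaining time \<open>\<eta> - \<epsilon>\<close> must still allow the growth of the exponent from \<open>p\<close> to \<open>1 + b (p - 1)\<close>.\<close>
  define \<epsilon> where "\<epsilon> = (\<eta> - (b - 1) / \<alpha>) / 2"
  have \<epsilon>: "0 < \<epsilon>" "\<epsilon> < \<eta>" "b - 1 < \<alpha> * (\<eta> - \<epsilon>)"
  proof -
    have lims: "0 < (b - 1) / \<alpha>" "(b - 1) / \<alpha> < \<eta>" using b \<alpha> by (auto simp: field_simps)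
    have mid: "\<alpha> * (\<eta> - \<epsilon>) = (\<alpha> * \<eta> + (b - 1)) / 2" using \<alpha> by (simp add: \<epsilon>_def field_simps)
    show "b - 1 < \<alpha> * (\<eta> - \<epsilon>)" unfolding mid using b(2) by simp
    show "0 < \<epsilon>" unfolding \<epsilon>_def using lims by simp
    show "\<epsilon> < \<eta>" unfolding \<epsilon>_def using lims \<eta> by simp
  qed
  obtain A where A: "0 \<le> A" and taylor: "\<And>W::'a \<Rightarrow> real. borel_between (c powr p) (C powr p) W \<Longrightarrow>
    \<exists>D. \<forall>x w. \<bar>ln (heat \<epsilon> W (x + w)) - ln (heat \<epsilon> W x) - D x \<bullet> w\<bar> \<le> A * (norm w)\<^sup>2"
    using ln_heat_taylor[OF \<epsilon>(1), of "c powr p" "C powr p"] c cC p by (force intro!: powr_mono2)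
  define M where "M = A / p"
  let ?l = "\<lambda>n. (b - 1) * (1 + a * (b - 1) / real n)"
    and ?r = "\<lambda>n. \<alpha> * (\<eta> - \<epsilon>) * (1 - 2 * M * (a * (\<eta> - \<epsilon>)) / real n)"
  \<comment> \<open>For large \<open>n\<close> the second-order errors fit into the room that \<open>b < 1 + \<alpha> \<eta>\<close> leaves.\<close>
  have "\<forall>\<^sub>F n in sequentially. ?l n < ?r n"
  proof -
    have "(\<lambda>n. ?r n - ?l n) \<longlonglongrightarrow> \<alpha> * (\<eta> - \<epsilon>) * (1 - 0) - (b - 1) * (1 + 0)"
      by (intro tendsto_intros lim_const_over_n)
    then have "\<forall>\<^sub>F n in sequentially. 0 < ?r n - ?l n"
      by (rule order_tendstoD) (use \<epsilon> in simp)
    then show ?thesis by simp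
  qed
  then have "\<exists>n>0. ?l n < ?r n"
    using eventually_happens'[OF sequentially_bot eventually_conj[OF _ eventually_gt_at_top[of 0]]] by blast
  then obtain n where n: "0 < n" and small: "?l n < ?r n" by blast
  define \<delta> where "\<delta> = (\<eta> - \<epsilon>) / real n"
  have \<delta>: "0 < \<delta>" "\<epsilon> + real n * \<delta> = \<eta>" using n \<epsilon> by (auto simp: \<delta>_def)
  define \<tau> where "\<tau> = a * (b - 1) / real n"
  define \<kappa> where "\<kappa> = \<delta> * a / 2 * (1 - 2 * M * \<delta> * a)"
  have \<tau>0: "0 \<le> \<tau>" using a b by (simp add: \<tau>_def)
  have \<tau>\<kappa>: "\<tau> * (1 + \<tau>) < 2 * \<alpha> * \<kappa>"
  proof -
    have "a / real n * ?l n
        < a / real n * ?r n"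
      using small a n by (intro mult_strict_left_mono) auto
    moreover have "a / real n * ?l n = \<tau> * (1 + \<tau>)"
      by (simp add: \<tau>_def)
    moreover have "a / real n * ?r n = 2 * \<alpha> * \<kappa>"
      by (simp add: \<kappa>_def \<delta>_def)
    ultimately show ?thesis by simp
  qed
  have \<kappa>: "0 < \<kappa>"
  proof -
    have "0 \<le> \<tau> * (1 + \<tau>)" using \<tau>0 by simp
    then have "0 < 2 * \<alpha> * \<kappa>" using \<tau>\<kappa> by linarith
    then show ?thesis using \<alpha> by (simp add: zero_less_mult_iff)
  qed
  define u where "u i = (heat \<delta> ^^ (n - i)) v" for i
  define W where "W i = (heat \<delta> ^^ i) (\<lambda>z. u i z powr p)" for i
  define L where "L i x = ln (heat \<epsilon> (W i) x) / p" for i x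
  have u: "borel_between c C (u i)" for i
    unfolding u_def by (rule borel_between_heat_funpow[OF \<delta>(1) v])
  have up: "borel_between (c powr p) (C powr p) (\<lambda>z. u i z powr p)" for i
    using borel_between_powr[OF u] c p by simp
  have W: "borel_between (c powr p) (C powr p) (W i)" for i
    unfolding W_def by (rule borel_between_heat_funpow[OF \<delta>(1) up])
  have hW: "borel_between (c powr p) (C powr p) (heat \<epsilon> (W i))" for i
    by (rule borel_between_heat[OF \<epsilon>(1) W])
  have cp: "0 < c powr p" using c by simp
  have hW0: "0 < heat \<epsilon> (W i) x" for i x
    using borel_betweenD(2)[OF hW, of i x] cp by linarith
  have L: "borel_between (ln (c powr p) / p) (ln (C powr p) / p) (L i)" for i
  proof -
    have [measurable]: "heat \<epsilon> (W i) \<in> borel_measurable borel" by (rule borel_betweenD[OF hW])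
    have "L i \<in> borel_measurable borel" unfolding L_def[abs_def] by measurable
    moreover have "ln (c powr p) / p \<le> L i x" "L i x \<le> ln (C powr p) / p" for x
    proof -
      note hb = borel_betweenD(2,3)[OF hW, of i x]
      show "ln (c powr p) / p \<le> L i x" unfolding L_def
        by (rule divide_right_mono[OF ln_mono]) (use hb cp hW0[of i x] p in linarith)+
      show "L i x \<le> ln (C powr p) / p" unfolding L_def
        by (rule divide_right_mono[OF ln_mono]) (use hb cp hW0[of i x] p in linarith)+
    qed
    ultimately show ?thesis by (simp add: borel_between_def)
  qed
  have smooth: "smooth (L i)" for i
  proof -
    have "C_k k (\<lambda>x. (1 / p) * ln (heat \<epsilon> (W i) x))" for k
      using smooth_heat[OF \<epsilon>(1) W, of i] hW0 unfolding smooth_def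
      by (intro C_k_mult C_k_const C_k_ln) auto
    then show ?thesis by (simp add: smooth_def L_def[abs_def])
  qed
  have "\<exists>D. \<forall>x w. \<bar>L i (x + w) - L i x - D x \<bullet> w\<bar> \<le> M * (norm w)\<^sup>2" for i
  proof -
    obtain D where D: "\<And>x w. \<bar>ln (heat \<epsilon> (W i) (x + w)) - ln (heat \<epsilon> (W i) x) - D x \<bullet> w\<bar> \<le> A * (norm w)\<^sup>2"
      using taylor[OF W, of i] by blast
    have "\<bar>L i (x + w) - L i x - ((1 / p) *\<^sub>R D x) \<bullet> w\<bar> \<le> M * (norm w)\<^sup>2" for x w
    proof -
      have "L i (x + w) - L i x - ((1 / p) *\<^sub>R D x) \<bullet> w = (ln (heat \<epsilon> (W i) (x + w)) - ln (heat \<epsilon> (W i) x) - D x \<bullet> w) / p"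
        by (simp add: L_def diff_divide_distrib)
      then show ?thesis using D[of x w] p by (simp add: M_def divide_right_mono)
    qed
    then show ?thesis by (intro exI[of _ "\<lambda>x. (1 / p) *\<^sub>R D x"]) auto
  qed
  then obtain G where G: "\<And>i x w. \<bar>L i (x + w) - L i x - G i x \<bullet> w\<bar> \<le> M * (norm w)\<^sup>2" by metis
  have gderiv: "GDERIV (L i) x :> G i x" for i x
    unfolding gderiv_def
    by (rule has_derivative_of_quadratic_remainder[where B = M])
       (use G in \<open>auto simp: inner_commute intro: bounded_linear_inner_left\<close>)
  \<comment> \<open>Wang's Harnack inequality in the innermost step, with the same shift \<open>w\<close> at all points; the
    outer heat flows commute with translations and are monotone, so they preserve the inequality.\<close>
  have hopf_lax: "L i (x + \<delta> *\<^sub>R w) - \<delta> * (norm w)\<^sup>2 / (2 * a) \<le> L (Suc i) x" if i: "i < n" for i x w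
  proof -
    define K where "K = \<delta> * (norm w)\<^sup>2 / (2 * a)"
    have K: "p * \<delta> * (norm w)\<^sup>2 / (2 * (p - 1)) = p * K" by (simp add: K_def a_def)
    define e where "e = exp (- (p * K))"
    have ui: "u i = heat \<delta> (u (Suc i))"
      using i by (simp add: u_def Suc_diff_Suc[symmetric])
    have 1: "e * u i (\<delta> *\<^sub>R w + y) powr p \<le> heat \<delta> (\<lambda>z. u (Suc i) z powr p) y" for y
      using wang_harnack[OF \<delta>(1) p u c, of "Suc i" y w] unfolding ui e_def exp_minus K
      by (simp add: field_simps add.commute)
    have WS: "W (Suc i) = (heat \<delta> ^^ i) (heat \<delta> (\<lambda>z. u (Suc i) z powr p))"
      by (simp add: W_def funpow_swap1)
    have eb: "borel_between (e * c powr p) (e * C powr p) (\<lambda>y. e * u i (\<delta> *\<^sub>R w + y) powr p)"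
      using borel_between_translate[OF up, of i "\<delta> *\<^sub>R w"]
      unfolding borel_between_def by (auto simp: e_def)
    have 2: "e * W i (\<delta> *\<^sub>R w + y) \<le> W (Suc i) y" for y
    proof -
      have "e * W i (\<delta> *\<^sub>R w + y) = (heat \<delta> ^^ i) (\<lambda>y. e * u i (\<delta> *\<^sub>R w + y) powr p) y"
        by (simp add: W_def heat_funpow_cmult heat_funpow_translate[of i \<delta> "\<lambda>y. u i y powr p"])
      also have "\<dots> \<le> W (Suc i) y"
        unfolding WS by (rule heat_funpow_mono[OF \<delta>(1) eb borel_between_heat[OF \<delta>(1) up] 1])
      finally show ?thesis .
    qed
    have eW: "borel_between (e * c powr p) (e * C powr p) (\<lambda>y. e * W i (\<delta> *\<^sub>R w + y))"
      using borel_between_translate[OF W, of i "\<delta> *\<^sub>R w"]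
      unfolding borel_between_def by (auto simp: e_def)
    have "e * heat \<epsilon> (W i) (\<delta> *\<^sub>R w + x) \<le> heat \<epsilon> (W (Suc i)) x"
      using heat_mono[OF \<epsilon>(1) eW W 2] by (simp add: heat_cmult heat_translate)
    then have "ln (e * heat \<epsilon> (W i) (\<delta> *\<^sub>R w + x)) \<le> ln (heat \<epsilon> (W (Suc i)) x)"
      using hW0 by (intro ln_mono) (auto simp: e_def)
    then have "- (p * K) + ln (heat \<epsilon> (W i) (\<delta> *\<^sub>R w + x)) \<le> ln (heat \<epsilon> (W (Suc i)) x)"
      using hW0[of i "\<delta> *\<^sub>R w + x"] by (simp add: ln_mult e_def)
    then have "(- (p * K) + ln (heat \<epsilon> (W i) (\<delta> *\<^sub>R w + x))) / p \<le> L (Suc i) x"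
      unfolding L_def using p by (intro divide_right_mono) auto
    moreover have "(- (p * K) + l) / p = l / p - K" for l using p by (simp add: field_simps)
    ultimately show ?thesis by (simp add: L_def add.commute K_def)
  qed
  \<comment> \<open>The choice \<open>w = a \<nabla>L\<close> maximises the first-order part of the Hopf-Lax bound.\<close>
  have grow: "L i x + \<kappa> * (norm (G i x))\<^sup>2 \<le> L (Suc i) x" if i: "i < n" for i x
  proof -
    let ?N = "(norm (G i x))\<^sup>2"
    have n: "(norm (a *\<^sub>R G i x))\<^sup>2 = a\<^sup>2 * ?N" "(norm (\<delta> *\<^sub>R a *\<^sub>R G i x))\<^sup>2 = \<delta>\<^sup>2 * a\<^sup>2 * ?N"
      by (simp_all add: power_mult_distrib)
    have "L i x + \<delta> * a * ?N - M * (\<delta>\<^sup>2 * a\<^sup>2 * ?N) \<le> L i (x + \<delta> *\<^sub>R a *\<^sub>R G i x)"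
      using G[of i x "\<delta> *\<^sub>R a *\<^sub>R G i x"] unfolding n
      by (simp add: power2_norm_eq_inner abs_le_iff mult.assoc)
    moreover have "L i (x + \<delta> *\<^sub>R a *\<^sub>R G i x) - \<delta> * (a\<^sup>2 * ?N) / (2 * a) \<le> L (Suc i) x"
      using hopf_lax[OF i, of x "a *\<^sub>R G i x"] unfolding n by simp
    moreover have "\<delta> * a * ?N - M * (\<delta>\<^sup>2 * a\<^sup>2 * ?N) - \<delta> * (a\<^sup>2 * ?N) / (2 * a) = \<kappa> * ?N"
      using a by (simp add: \<kappa>_def field_simps power2_eq_square)
    ultimately show ?thesis by linarith
  qed
  \<comment> \<open>The exponent falls from \<open>p + n \<tau> = 1 + b (p - 1)\<close> at \<open>i = 0\<close> to \<open>p\<close> at \<open>i = n\<close>.\<close>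
  define N where "N i = ln (\<integral>x. exp ((p + real (n - i) * \<tau>) * L i x) \<partial>\<pi>) / (p + real (n - i) * \<tau>)" for i
  have step: "N i \<le> N (Suc i)" if i: "i < n" for i
  proof -
    have "real (n - i) = real (n - Suc i) + 1" using i by simp
    then have eq: "p + real (n - i) * \<tau> = (p + real (n - Suc i) * \<tau>) + \<tau>" by (simp add: algebra_simps)
    have "1 \<le> p + real (n - Suc i) * \<tau>" using p \<tau>0 by (simp add: add_increasing2)
    then show ?thesis
      unfolding N_def eq
      by (intro lsi_gradient_step[OF prob sets lsi \<alpha> L smooth gderiv L grow[OF i] \<kappa> _ \<tau>0 less_imp_le[OF \<tau>\<kappa>]])
  qed
  have "i \<le> n \<Longrightarrow> N 0 \<le> N i" for i
    by (induction i) (auto intro: order_trans[OF _ step])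
  then have chain: "N 0 \<le> N n" by simp
  define Q where "Q = 1 + b * (p - 1)"
  have Q: "p + real n * \<tau> = Q" "1 < Q"
    using n a b p by (auto simp: \<tau>_def Q_def a_def field_simps intro!: add_pos_pos)
  have v': "borel_between (c powr p) (C powr p) (\<lambda>z. v z powr p)"
    using borel_between_powr[OF v] c p by simp
  have top: "N n = ln (\<integral>x. heat \<eta> (\<lambda>z. v z powr p) x \<partial>\<pi>) / p"
  proof -
    have "heat \<epsilon> (W n) = heat \<eta> (\<lambda>z. v z powr p)"
      unfolding W_def using heat_funpow_semigroup[OF \<epsilon>(1) \<delta>(1) v', of n] \<delta>(2) by (simp add: u_def)
    then show ?thesis using p hW0[of n] by (simp add: N_def L_def)
  qed
  have hm: "borel_between (c powr Q) (C powr Q) (\<lambda>x. heat \<eta> v x powr Q)"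
    using borel_between_powr[OF borel_between_heat[OF \<eta> v]] c Q by simp
  let ?I = "\<integral>x. heat \<eta> v x powr Q \<partial>\<pi>"
  have bot: "ln ?I / Q \<le> N 0"
  proof -
    have eq: "heat \<eta> v = heat \<epsilon> (u 0)"
      unfolding u_def using heat_funpow_semigroup[OF \<epsilon>(1) \<delta>(1) v, of n] \<delta>(2) by simp
    have pos: "c \<le> heat \<eta> v x" for x by (rule borel_betweenD(2)[OF borel_between_heat[OF \<eta> v]])
    have le: "heat \<eta> v x powr Q \<le> exp (Q * L 0 x)" for x
    proof -
      have "heat \<eta> v x powr p \<le> heat \<epsilon> (W 0) x"
        unfolding eq W_def using heat_jensen[OF \<epsilon>(1) p u c, of 0 x] by simp
      then have "ln (heat \<eta> v x powr p) \<le> ln (heat \<epsilon> (W 0) x)"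
        using pos[of x] c by (intro ln_mono) auto
      then have "ln (heat \<eta> v x) \<le> L 0 x"
        using p pos[of x] c by (simp add: L_def ln_powr field_simps)
      then show ?thesis
        using pos[of x] c Q by (simp add: powr_def mult_left_mono)
    qed
    have eL: "borel_between (exp (Q * (ln (c powr p) / p))) (exp (Q * (ln (C powr p) / p))) (\<lambda>x. exp (Q * L 0 x))"
      using L[of 0] Q(2) unfolding borel_between_def by (auto intro!: mult_left_mono)
    have int: "integrable \<pi> (\<lambda>x. heat \<eta> v x powr Q)" "integrable \<pi> (\<lambda>x. exp (Q * L 0 x))"
      using integrable_borel_between[OF finite_measure_axioms sets hm]
        integrable_borel_between[OF finite_measure_axioms sets eL] by auto
    have "0 < ?I" using c by (intro integral_borel_between_pos[OF prob sets hm]) simp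
    then have "ln ?I \<le> ln (\<integral>x. exp (Q * L 0 x) \<partial>\<pi>)"
      using integral_mono[OF int le] by (intro ln_mono; linarith)
    then show ?thesis using Q by (simp add: N_def divide_right_mono)
  qed
  have pos: "0 < (\<integral>x. heat \<eta> (\<lambda>z. v z powr p) x \<partial>\<pi>)" "0 < ?I"
    using c integral_borel_between_pos[OF prob sets borel_between_heat[OF \<eta> v']]
      integral_borel_between_pos[OF prob sets hm] by auto
  have "ln ?I / Q \<le> ln (\<integral>x. heat \<eta> (\<lambda>z. v z powr p) x \<partial>\<pi>) / p"
    using bot chain unfolding top by linarith
  then show ?thesis
    unfolding Q_def[symmetric] using pos by (simp add: powr_def)
qed

section \<open>Real inequalities for densities\<close>

lemma integral_pos_of_powr:
  fixes g :: "'b \<Rightarrow> real"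
  assumes "\<And>x. 0 \<le> g x" "integrable M g" "(\<integral>x. g x \<partial>M) = 1" "integrable M (\<lambda>x. g x powr q)"
  shows "0 < (\<integral>x. g x powr q \<partial>M)"
proof (rule ccontr)
  assume "\<not> ?thesis"
  moreover have "0 \<le> (\<integral>x. g x powr q \<partial>M)" by (rule Bochner_Integration.integral_nonneg) simp
  ultimately have "(\<integral>x. g x powr q \<partial>M) = 0" by simp
  then have "AE x in M. g x powr q = 0"
    using integral_nonneg_eq_0_iff_AE[OF assms(4)] by simp
  then have "AE x in M. g x = 0" by eventually_elim simp
  then have "(\<integral>x. g x \<partial>M) = 0" by (subst integral_eq_zero_AE) auto
  then show False using assms(3) by simp
qed

text \<open>
  Hoelder's inequality for the splitting of \<open>g\<^bsup>r\<^esup>\<close> into \<open>g\<^bsup>\<theta> q\<^esup>\<close> and \<open>g\<^bsup>1 - \<theta>\<^esup>\<close>, whose second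
  factor integrates to one in its conjugate order.
\<close>

lemma lyapunov_inequality:
  fixes g :: "'b \<Rightarrow> real"
  assumes g: "\<And>x. 0 \<le> g x" "integrable M g" "(\<integral>x. g x \<partial>M) = 1" "integrable M (\<lambda>x. g x powr q)"
    and r: "1 < r" "r < q"
  shows "(\<integral>x. g x powr r \<partial>M) \<le> (\<integral>x. g x powr q \<partial>M) powr ((r - 1) / (q - 1))"
proof -
  define \<theta> where "\<theta> = (r - 1) / (q - 1)"
  have \<theta>: "0 < \<theta>" "\<theta> < 1" "\<theta> * (q - 1) = r - 1" using r by (auto simp: \<theta>_def field_simps)
  have [measurable]: "g \<in> borel_measurable M" using g(2) by auto
  have e: "g x powr (\<theta> * q) * g x powr (1 - \<theta>) = g x powr r" for x
    using \<theta>(3) by (simp add: powr_add[symmetric] algebra_simps)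
  have p: "(g x powr (\<theta> * q)) powr (1 / \<theta>) = g x powr q" "(g x powr (1 - \<theta>)) powr (1 / (1 - \<theta>)) = g x" for x
    using \<theta> g(1)[of x] by (auto simp: powr_powr)
  have "(\<integral>x. g x powr (\<theta> * q) * g x powr (1 - \<theta>) \<partial>M)
      \<le> (\<integral>x. (g x powr (\<theta> * q)) powr (1 / \<theta>) \<partial>M) powr (1 / (1 / \<theta>))
        * (\<integral>x. (g x powr (1 - \<theta>)) powr (1 / (1 - \<theta>)) \<partial>M) powr (1 / (1 / (1 - \<theta>)))"
  proof (rule Holder_inequality)
    show "1 < 1 / \<theta>" "1 < 1 / (1 - \<theta>)" "1 / (1 / \<theta>) + 1 / (1 / (1 - \<theta>)) = 1"
      using \<theta> by (auto simp: field_simps)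
  qed (use g integral_pos_of_powr[OF g] in \<open>simp_all add: p\<close>)
  then show ?thesis
    unfolding e p g(3) by (simp add: \<theta>_def)
qed

lemma integral_powr_ge_1:
  fixes g :: "'b \<Rightarrow> real"
  assumes M: "prob_space M"
    and g: "\<And>x. 0 \<le> g x" "integrable M g" "(\<integral>x. g x \<partial>M) = 1" "integrable M (\<lambda>x. g x powr q)"
    and q: "1 < q"
  shows "1 \<le> (\<integral>x. g x powr q \<partial>M)"
proof -
  interpret prob_space M by fact
  have "(\<integral>x. g x * 1 \<partial>M) \<le> (\<integral>x. g x powr q \<partial>M) powr (1 / q) * (\<integral>x. 1 powr (q / (q - 1)) \<partial>M) powr (1 / (q / (q - 1)))"
    by (rule Holder_inequality)
       (use q g integral_pos_of_powr[OF g] in \<open>auto simp: field_simps prob_space\<close>)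
  then have "1 \<le> (\<integral>x. g x powr q \<partial>M) powr (1 / q)" using g(3) by (simp add: prob_space)
  then have "1 powr q \<le> ((\<integral>x. g x powr q \<partial>M) powr (1 / q)) powr q"
    using q by (intro powr_mono2) auto
  then show ?thesis using q integral_pos_of_powr[OF g] by (simp add: powr_powr)
qed

text \<open>
  Young's inequality for the product of \<open>(1 + x)\<^bsup>1/q\<^esup>\<close> and \<open>1\<close>.
\<close>

lemma bernoulli_powr:
  fixes x q :: real
  assumes "0 \<le> x" "1 \<le> q"
  shows "(1 + x) powr (1 / q) \<le> 1 + x / q"
proof (cases "q = 1")
  case False
  have "(1 + x) powr (1 / q) * 1 \<le> ((1 + x) powr (1 / q)) powr q / q + 1 powr (q / (q - 1)) / (q / (q - 1))"
    using False assms by (intro Youngs_inequality) (auto simp: field_simps)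
  also have "\<dots> = (1 + x) / q + (q - 1) / q"
    using assms by (simp add: powr_powr)
  also have "\<dots> = 1 + x / q" using assms by (simp add: field_simps)
  finally show ?thesis by simp
qed (use assms in simp)

lemma xlnx_bounds:
  fixes x :: real
  shows "0 \<le> x \<Longrightarrow> -1 \<le> x * ln x" "0 \<le> x \<Longrightarrow> x \<le> 1 \<Longrightarrow> x * ln x \<le> 0"
proof -
  show "-1 \<le> x * ln x" if "0 \<le> x"
  proof (cases "x = 0")
    case False
    then have x: "0 < x" using that by simp
    have "- ln x \<le> 1 / x - 1" using ln_le_minus_one[of "1 / x"] x by (simp add: ln_div)
    then have "x * (- ln x) \<le> x * (1 / x - 1)" using x by (intro mult_left_mono) auto
    then show ?thesis using x by (simp add: right_diff_distrib)
  qed simp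
  show "0 \<le> x \<Longrightarrow> x \<le> 1 \<Longrightarrow> x * ln x \<le> 0" by (cases "x = 0") (auto simp: mult_nonneg_nonpos)
qed

lemma abs_xlnx_le:
  fixes x :: real
  assumes "0 \<le> x"
  shows "\<bar>x * ln x\<bar> \<le> x\<^sup>2 + 1"
proof (cases "x = 0")
  case False
  then have "x * ln x \<le> x * x"
    using assms ln_le_minus_one[of x] by (intro mult_left_mono) auto
  then show ?thesis
    using xlnx_bounds(1)[OF assms] zero_le_square[of x] unfolding power2_eq_square by linarith
qed simp

text \<open>
  Continuity of \<open>x ln x\<close> on \<open>[0, \<infinity>)\<close>; at \<open>0\<close> it comes from \<open>- x ln x \<le> 2 sqrt x\<close>.
\<close>

lemma tendsto_xlnx:
  fixes u :: "nat \<Rightarrow> real"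
  assumes u: "u \<longlonglongrightarrow> a" and pos: "\<And>n. 0 \<le> u n"
  shows "(\<lambda>n. u n * ln (u n)) \<longlonglongrightarrow> a * ln a"
proof (cases "a = 0")
  case False
  then show ?thesis by (intro tendsto_intros u)
next
  case True
  have bd: "\<bar>u n * ln (u n)\<bar> \<le> 2 * sqrt (u n) + (u n)\<^sup>2" for n
  proof (cases "u n = 0")
    case False
    then have x: "0 < u n" using pos[of n] by simp
    then have s: "0 < sqrt (u n)" by simp
    have "- ln (sqrt (u n)) \<le> 1 / sqrt (u n) - 1" using ln_le_minus_one[of "1 / sqrt (u n)"] s by (simp add: ln_div)
    then have "- ln (u n) \<le> 2 * (1 / sqrt (u n))" using x by (simp add: ln_sqrt)
    then have "u n * (- ln (u n)) \<le> u n * (2 * (1 / sqrt (u n)))" using x by (intro mult_left_mono) auto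
    also have "\<dots> = 2 * (u n / sqrt (u n))" by simp
    also have "\<dots> = 2 * sqrt (u n)" using x by (subst real_div_sqrt) auto
    finally have 1: "- (u n * ln (u n)) \<le> 2 * sqrt (u n)" by simp
    have "u n * ln (u n) \<le> u n * u n"
      using x ln_le_minus_one[OF x] by (intro mult_left_mono) auto
    then have 2: "u n * ln (u n) \<le> (u n)\<^sup>2" by (simp add: power2_eq_square)
    show ?thesis using 1 2 s by (simp add: abs_le_iff add_increasing2 add_increasing less_imp_le)
  qed simp
  have "(\<lambda>n. 2 * sqrt (u n) + (u n)\<^sup>2) \<longlonglongrightarrow> 2 * sqrt a + a\<^sup>2" by (intro tendsto_intros u)
  then have "(\<lambda>n. 2 * sqrt (u n) + (u n)\<^sup>2) \<longlonglongrightarrow> 0" using True by simp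
  then have "(\<lambda>n. u n * ln (u n)) \<longlonglongrightarrow> 0"
    by (rule Lim_null_comparison[rotated]) (use bd in auto)
  then show ?thesis using True by simp
qed

text \<open>
  Truncation is from above and also from below, so that \<open>truncate n g\<close> takes values in a compact
  interval of positive numbers, to which hypercontractivity applies.
\<close>

definition truncate :: "nat \<Rightarrow> ('b \<Rightarrow> real) \<Rightarrow> 'b \<Rightarrow> real" where
  "truncate n g x = max (min (g x) (real n)) (1 / (real n + 1))"

lemma truncate_bounds:
  "1 / (real n + 1) \<le> truncate n g x" "truncate n g x \<le> real n + 1"
  "0 < truncate n g x" "0 \<le> g x \<Longrightarrow> truncate n g x \<le> g x + 1"
proof -
  have 1: "1 / (real n + 1) \<le> 1" "0 < 1 / (real n + 1)" by auto
  show "1 / (real n + 1) \<le> truncate n g x" by (simp add: truncate_def)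
  show "truncate n g x \<le> real n + 1" using 1 unfolding truncate_def by linarith
  show "0 < truncate n g x" using 1 unfolding truncate_def by linarith
  show "0 \<le> g x \<Longrightarrow> truncate n g x \<le> g x + 1" using 1 unfolding truncate_def by linarith
qed

lemma borel_between_truncate:
  "g \<in> borel_measurable borel \<Longrightarrow> borel_between (1 / (real n + 1)) (real n + 1) (truncate n g)"
  unfolding borel_between_def using truncate_bounds(1,2)[of n g] by (auto simp: truncate_def[abs_def])

lemma tendsto_truncate:
  assumes "0 \<le> g x"
  shows "(\<lambda>n. truncate n g x) \<longlonglongrightarrow> g x"
proof -
  have "(\<lambda>n. max (g x) (1 / (real n + 1))) \<longlonglongrightarrow> max (g x) 0"
    by (intro tendsto_max tendsto_const) real_asymp
  moreover have "\<forall>\<^sub>F n in sequentially. max (g x) (1 / (real n + 1)) = truncate n g x"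
    using eventually_ge_at_top[of "nat \<lceil>g x\<rceil>"]
    by eventually_elim (simp add: truncate_def min_def nat_le_iff ceiling_le_iff)
  ultimately have "(\<lambda>n. truncate n g x) \<longlonglongrightarrow> max (g x) 0"
    by (rule Lim_transform_eventually)
  then show ?thesis using assms by (simp add: max_absorb1)
qed

lemma truncate_xlnx:
  assumes "0 \<le> g x"
  shows "\<bar>truncate n g x * ln (truncate n g x)\<bar> \<le> \<bar>g x * ln (g x)\<bar> + 1"
proof -
  let ?t = "truncate n g x"
  consider "?t \<le> 1" | "1 < ?t" by linarith
  then show ?thesis
  proof cases
    case 1
    then show ?thesis using xlnx_bounds(1,2)[of ?t] truncate_bounds(3)[of n g x] by linarith
  next
    case 2
    moreover have "1 / (real n + 1) \<le> 1" by simp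
    ultimately have le: "?t \<le> g x" unfolding truncate_def by (simp add: max_def min_def split: if_splits)
    have "?t * ln ?t \<le> g x * ln (g x)" using 2 le by (intro mult_mono) auto
    moreover have "0 \<le> ?t * ln ?t" using 2 by simp
    ultimately show ?thesis by linarith
  qed
qed

section \<open>Hypercontractive kernels contract divergences\<close>

lemma kernel_space:
  assumes "N \<in> borel \<rightarrow>\<^sub>M prob_algebra borel"
  shows "prob_space (N x)" "sets (N x) = sets borel" "space (N x) = UNIV"
proof -
  show "prob_space (N x)" "sets (N x) = sets borel"
    using measurable_space[OF assms, of x] by (auto simp: space_prob_algebra)
  from sets_eq_imp_space_eq[OF this(2)] show "space (N x) = UNIV" by simp
qed

lemma kernel_between:
  assumes N: "N \<in> borel \<rightarrow>\<^sub>M prob_algebra borel" and g: "borel_between c C g"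
  shows "borel_between c C (\<lambda>x. \<integral>y. g y \<partial>N x)"
  unfolding borel_between_def
proof (intro conjI allI)
  have [measurable]: "N \<in> borel \<rightarrow>\<^sub>M subprob_algebra borel" by (rule measurable_prob_algebraD[OF N])
  have [measurable]: "g \<in> borel_measurable borel" by (rule borel_betweenD[OF g])
  show "(\<lambda>x. \<integral>y. g y \<partial>N x) \<in> borel_measurable borel" by measurable
  have int: "integrable (N x) g" for x
    by (rule integrable_borel_between[OF prob_space.finite_measure[OF kernel_space(1)[OF N]] kernel_space(2)[OF N] g])
  show "c \<le> (\<integral>y. g y \<partial>N x)" "(\<integral>y. g y \<partial>N x) \<le> C" for x
    using integral_between[OF kernel_space(1)[OF N] int borel_betweenD(2,3)[OF g]] by auto
qed

section \<open>Divergences in terms of real densities\<close>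

lemma renyi_density:
  fixes g :: "'b \<Rightarrow> real"
  assumes "prob_space M" and g [measurable]: "g \<in> borel_measurable M" and nn: "\<And>x. 0 \<le> g x" and q: "q \<noteq> 1"
  shows "renyi q M (density M g) =
    (if (\<integral>\<^sup>+x. ennreal (g x powr q) \<partial>M) = \<infinity> then \<infinity>
     else ereal (1 / (q - 1) * ln (enn2real (\<integral>\<^sup>+x. ennreal (g x powr q) \<partial>M))))"
proof -
  interpret prob_space M by fact
  have ac: "absolutely_continuous M (density M g)"
    by (rule absolutely_continuousI_density) simp
  have "AE x in M. ennreal (g x) = RN_deriv M (density M g) x"
    by (rule RN_deriv_unique) auto
  then have "AE x in M. ennreal (enn2real (RN_deriv M (density M g) x) powr q) = ennreal (g x powr q)"
  proof eventually_elim
    case (elim x)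
    show ?case unfolding elim[symmetric] by (simp add: nn)
  qed
  then have "(\<integral>\<^sup>+x. ennreal (enn2real (RN_deriv M (density M g) x) powr q) \<partial>M) = (\<integral>\<^sup>+x. ennreal (g x powr q) \<partial>M)"
    by (rule nn_integral_cong_AE)
  then show ?thesis using q ac by (simp add: renyi_def Let_def)
qed

lemma real_density_exists:
  assumes M: "prob_space M" and \<rho>: "prob_space \<rho>" and s: "sets \<rho> = sets M" and ac: "absolutely_continuous M \<rho>"
  shows "\<exists>g. g \<in> borel_measurable M \<and> (\<forall>x. 0 \<le> g x) \<and> \<rho> = density M (\<lambda>x. ennreal (g x))"
proof -
  interpret prob_space M by fact
  interpret \<rho>: prob_space \<rho> by fact
  let ?g = "\<lambda>x. enn2real (RN_deriv M \<rho> x)"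
  have "AE x in M. RN_deriv M \<rho> x \<noteq> \<infinity>" by (rule RN_deriv_finite[OF _ ac s]) unfold_locales
  then have "AE x in M. RN_deriv M \<rho> x = ennreal (?g x)" by eventually_elim (simp add: less_top)
  then have "density M (RN_deriv M \<rho>) = density M (\<lambda>x. ennreal (?g x))" by (intro density_cong) auto
  then have "\<rho> = density M (\<lambda>x. ennreal (?g x))" using density_RN_deriv[OF ac s] by simp
  then show ?thesis by (intro exI[of _ ?g]) auto
qed

text \<open>
  A Markov kernel with invariant law \<open>\<pi>\<close> that improves integrability near order one: the distance
  of the order from one is multiplied by \<open>\<beta>\<close>. The estimate is assumed for functions with values in
  a compact interval of positive numbers only; truncation extends its consequences to all
  densities.
\<close>

locale hypercontractive_kernel =
  fixes \<pi> :: "'a::euclidean_space measure" and R :: "'a \<Rightarrow> 'a measure" and \<beta> :: real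
  assumes prob: "prob_space \<pi>" and sets_\<pi> [simp, measurable_cong]: "sets \<pi> = sets borel"
    and R: "R \<in> borel \<rightarrow>\<^sub>M prob_algebra borel"
    and invariant: "\<And>h. h \<in> borel_measurable borel \<Longrightarrow> (\<integral>\<^sup>+x. \<integral>\<^sup>+y. h y \<partial>R x \<partial>\<pi>) = (\<integral>\<^sup>+x. h x \<partial>\<pi>)"
    and \<beta>: "1 < \<beta>"
    and hyper: "\<And>q c C g. 1 < q \<Longrightarrow> 0 < c \<Longrightarrow> borel_between c C g \<Longrightarrow>
      (\<integral>x. (\<integral>y. g y \<partial>R x) powr q \<partial>\<pi>) powr (1 / q)
        \<le> (\<integral>x. g x powr (1 + (q - 1) / \<beta>) \<partial>\<pi>) powr (1 / (1 + (q - 1) / \<beta>))"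
begin

sublocale prob_space \<pi> by (rule prob)

definition T :: "('a \<Rightarrow> real) \<Rightarrow> 'a \<Rightarrow> real" where "T g x = (\<integral>y. g y \<partial>R x)"

lemma R_subprob [measurable]: "R \<in> borel \<rightarrow>\<^sub>M subprob_algebra borel"
  by (rule measurable_prob_algebraD[OF R])

lemma prob_R: "prob_space (R x)" and sets_R [simp, measurable_cong]: "sets (R x) = sets borel"
  by (rule kernel_space[OF R])+

lemma space_\<pi> [simp]: "space \<pi> = UNIV" and space_R [simp]: "space (R x) = UNIV"
  using sets_eq_imp_space_eq[OF sets_\<pi>] sets_eq_imp_space_eq[OF sets_R] by auto

lemma T_measurable [measurable]:
  assumes [measurable]: "g \<in> borel_measurable borel" shows "T g \<in> borel_measurable borel"
  unfolding T_def[abs_def] by measurable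

lemma T_between: "borel_between c C g \<Longrightarrow> borel_between c C (T g)"
  unfolding T_def[abs_def] by (rule kernel_between[OF R])

lemma T_divide: "T (\<lambda>x. g x / c) = (\<lambda>x. T g x / c)"
  by (simp add: T_def[abs_def])

lemma AE_nn_integral_R:
  assumes [measurable]: "g \<in> borel_measurable borel" and nn: "\<And>x. 0 \<le> g x" and int: "integrable \<pi> g"
  shows "AE x in \<pi>. integrable (R x) g \<and> ennreal (T g x) = (\<integral>\<^sup>+y. g y \<partial>R x)"
proof -
  have "(\<integral>\<^sup>+x. \<integral>\<^sup>+y. g y \<partial>R x \<partial>\<pi>) = (\<integral>\<^sup>+x. g x \<partial>\<pi>)"
    by (rule invariant) simp
  also have "\<dots> < \<infinity>"
    using int nn by (simp add: nn_integral_eq_integral)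
  finally have "AE x in \<pi>. (\<integral>\<^sup>+y. g y \<partial>R x) \<noteq> \<infinity>"
    by (intro nn_integral_PInf_AE) auto
  then show ?thesis
  proof eventually_elim
    case (elim x)
    have "integrable (R x) g"
      using elim nn by (intro integrableI_nonneg) (auto simp: less_top)
    then show ?case using nn by (simp add: T_def nn_integral_eq_integral)
  qed
qed

lemma T_nonneg: "(\<And>x. 0 \<le> g x) \<Longrightarrow> 0 \<le> T g x"
  unfolding T_def by (rule Bochner_Integration.integral_nonneg)

lemma T_integral:
  assumes [measurable]: "g \<in> borel_measurable borel" and nn: "\<And>x. 0 \<le> g x" and int: "integrable \<pi> g"
  shows "integrable \<pi> (T g)" "(\<integral>x. T g x \<partial>\<pi>) = (\<integral>x. g x \<partial>\<pi>)"
proof -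
  have "(\<integral>\<^sup>+x. ennreal (T g x) \<partial>\<pi>) = (\<integral>\<^sup>+x. \<integral>\<^sup>+y. g y \<partial>R x \<partial>\<pi>)"
    using AE_nn_integral_R[OF assms] by (intro nn_integral_cong_AE) auto
  also have "\<dots> = (\<integral>\<^sup>+x. g x \<partial>\<pi>)" by (rule invariant) simp
  also have "\<dots> = ennreal (\<integral>x. g x \<partial>\<pi>)" using int nn by (simp add: nn_integral_eq_integral)
  finally have eq: "(\<integral>\<^sup>+x. ennreal (T g x) \<partial>\<pi>) = ennreal (\<integral>x. g x \<partial>\<pi>)" .
  show i: "integrable \<pi> (T g)"
    by (rule integrableI_nonneg) (auto simp: T_nonneg nn eq)
  have "ennreal (\<integral>x. T g x \<partial>\<pi>) = ennreal (\<integral>x. g x \<partial>\<pi>)"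
    using eq i by (simp add: nn_integral_eq_integral T_nonneg nn)
  then show "(\<integral>x. T g x \<partial>\<pi>) = (\<integral>x. g x \<partial>\<pi>)"
    by (subst (asm) ennreal_inj) (auto intro!: Bochner_Integration.integral_nonneg simp: T_nonneg nn)
qed

lemma T_truncate:
  assumes [measurable]: "g \<in> borel_measurable borel" and nn: "\<And>x. 0 \<le> g x" and int: "integrable \<pi> g"
  shows "AE x in \<pi>. (\<lambda>n. T (truncate n g) x) \<longlonglongrightarrow> T g x"
  using AE_nn_integral_R[OF assms]
proof eventually_elim
  case (elim x)
  interpret Rx: prob_space "R x" by (rule prob_R)
  show ?case unfolding T_def
  proof (rule integral_dominated_convergence)
    show "integrable (R x) (\<lambda>y. g y + 1)" using elim by simp
    show "AE y in R x. (\<lambda>n. truncate n g y) \<longlonglongrightarrow> g y"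
      using nn by (intro AE_I2 tendsto_truncate)
    show "AE y in R x. norm (truncate n g y) \<le> g y + 1" for n
      using truncate_bounds(3)[of n g] truncate_bounds(4)[of g _ n] nn by (auto simp: abs_of_pos)
  qed (auto simp: truncate_def[abs_def])
qed

text \<open>
  Fatou's lemma along the truncations gives the hypercontractive estimate for \<open>g\<close>; Lyapunov's
  inequality then bounds the moment of order \<open>r\<close> by the one of order \<open>q\<close>, since \<open>g\<close> has mean one.
\<close>

lemma moment_contraction:
  assumes [measurable]: "g \<in> borel_measurable borel" and nn: "\<And>x. 0 \<le> g x"
    and int: "integrable \<pi> g" "(\<integral>x. g x \<partial>\<pi>) = 1"
    and q: "1 < q" and intq: "integrable \<pi> (\<lambda>x. g x powr q)"
  shows "(\<integral>\<^sup>+x. ennreal (T g x powr q) \<partial>\<pi>) \<le> ennreal ((\<integral>x. g x powr q \<partial>\<pi>) powr (q / (\<beta> + q - 1)))"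
proof -
  define r where "r = 1 + (q - 1) / \<beta>"
  have r: "1 < r" "r < q" "(r - 1) / (q - 1) = 1 / \<beta>" "\<beta> * r = \<beta> + q - 1"
  proof -
    have "(q - 1) / \<beta> < q - 1" using q \<beta> by (simp add: divide_less_eq)
    then show "r < q" by (simp add: r_def)
  qed (use q \<beta> in \<open>auto simp: r_def field_simps\<close>)
  have powr_add1: "(a + 1) powr r \<le> 2 powr r * (1 + a powr q)" if a: "0 \<le> a" for a :: real
  proof (cases "a \<le> 1")
    case True
    have "(a + 1) powr r \<le> 2 powr r" using True a r by (intro powr_mono2) auto
    also have "\<dots> \<le> 2 powr r * (1 + a powr q)" by simp
    finally show ?thesis .
  next
    case False
    have "(a + 1) powr r \<le> (2 * a) powr r" using False r by (intro powr_mono2) auto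
    also have "\<dots> = 2 powr r * a powr r" using False by (simp add: powr_mult)
    also have "a powr r \<le> a powr q" using False r by (intro powr_mono) auto
    then have "2 powr r * a powr r \<le> 2 powr r * (1 + a powr q)" by (intro mult_left_mono) auto
    finally show ?thesis .
  qed
  let ?m = "\<lambda>n. \<integral>x. truncate n g x powr r \<partial>\<pi>"
  have tr: "(\<lambda>n. ?m n) \<longlonglongrightarrow> (\<integral>x. g x powr r \<partial>\<pi>)"
  proof (rule integral_dominated_convergence)
    show "integrable \<pi> (\<lambda>x. 2 powr r * (1 + g x powr q))" using intq by simp
    show "AE x in \<pi>. (\<lambda>n. truncate n g x powr r) \<longlonglongrightarrow> g x powr r"
    proof (intro AE_I2)
      fix x
      show "(\<lambda>n. truncate n g x powr r) \<longlonglongrightarrow> g x powr r"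
        using tendsto_truncate[of g x, OF nn] truncate_bounds(3)[of _ g x] r
        by (intro tendsto_powr2) (auto intro: tendsto_const always_eventually less_imp_le)
    qed
    show "AE x in \<pi>. norm (truncate n g x powr r) \<le> 2 powr r * (1 + g x powr q)" for n
    proof (intro AE_I2)
      fix x
      have "truncate n g x powr r \<le> (g x + 1) powr r"
        using truncate_bounds(3)[of n g x] truncate_bounds(4)[of g x n] nn[of x] r by (intro powr_mono2) auto
      also have "\<dots> \<le> 2 powr r * (1 + g x powr q)" by (rule powr_add1[OF nn])
      finally show "norm (truncate n g x powr r) \<le> 2 powr r * (1 + g x powr q)" by simp
    qed
  qed (auto simp: truncate_def[abs_def])
  let ?f = "\<lambda>n x. T (truncate n g) x powr q"
  have step: "(\<integral>\<^sup>+x. ennreal (?f n x) \<partial>\<pi>) \<le> ennreal (?m n powr (q / r))" for n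
  proof -
    have b: "borel_between (1 / (real n + 1)) (real n + 1) (truncate n g)" by (rule borel_between_truncate) simp
    have bq: "borel_between ((1 / (real n + 1)) powr q) ((real n + 1) powr q) (\<lambda>x. ?f n x)"
      using q by (intro borel_between_powr T_between b) auto
    have i: "integrable \<pi> (\<lambda>x. ?f n x)"
      by (rule integrable_borel_between[OF finite_measure_axioms sets_\<pi> bq])
    have "(\<integral>x. ?f n x \<partial>\<pi>) powr (1 / q) \<le> ?m n powr (1 / r)"
      unfolding T_def r_def by (rule hyper[OF q _ b]) simp
    then have "((\<integral>x. ?f n x \<partial>\<pi>) powr (1 / q)) powr q \<le> (?m n powr (1 / r)) powr q"
      using q by (intro powr_mono2) auto
    then have "(\<integral>x. ?f n x \<partial>\<pi>) \<le> ?m n powr (q / r)"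
      using q by (simp add: powr_powr Bochner_Integration.integral_nonneg)
    then show ?thesis using i by (simp add: nn_integral_eq_integral ennreal_leI)
  qed
  have "(\<integral>\<^sup>+x. ennreal (T g x powr q) \<partial>\<pi>) = (\<integral>\<^sup>+x. liminf (\<lambda>n. ennreal (?f n x)) \<partial>\<pi>)"
  proof (rule nn_integral_cong_AE)
    show "AE x in \<pi>. ennreal (T g x powr q) = liminf (\<lambda>n. ennreal (?f n x))"
      using T_truncate[OF assms(1) nn int(1)]
    proof eventually_elim
      case (elim x)
      have "0 \<le> T (truncate n g) x" for n
        by (intro T_nonneg less_imp_le truncate_bounds(3))
      then have "(\<lambda>n. ?f n x) \<longlonglongrightarrow> T g x powr q"
        using elim q by (intro tendsto_powr2) (auto intro: always_eventually)
      then have "(\<lambda>n. ennreal (?f n x)) \<longlonglongrightarrow> ennreal (T g x powr q)" by (rule tendsto_ennrealI)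
      then show ?case by (rule lim_imp_Liminf[OF sequentially_bot, symmetric])
    qed
  qed
  also have "\<dots> \<le> liminf (\<lambda>n. \<integral>\<^sup>+x. ennreal (?f n x) \<partial>\<pi>)"
    by (rule nn_integral_liminf) (auto simp: truncate_def[abs_def])
  also have "\<dots> \<le> liminf (\<lambda>n. ennreal (?m n powr (q / r)))"
    by (intro Liminf_mono always_eventually allI step)
  also have "\<dots> = ennreal ((\<integral>x. g x powr r \<partial>\<pi>) powr (q / r))"
  proof (rule lim_imp_Liminf[OF sequentially_bot], rule tendsto_ennrealI)
    show "(\<lambda>n. ?m n powr (q / r)) \<longlonglongrightarrow> (\<integral>x. g x powr r \<partial>\<pi>) powr (q / r)"
      using tr q r by (intro tendsto_powr2) (auto intro!: always_eventually Bochner_Integration.integral_nonneg)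
  qed
  also have "\<dots> \<le> ennreal ((\<integral>x. g x powr q \<partial>\<pi>) powr (q / (\<beta> + q - 1)))"
  proof (rule ennreal_leI)
    have "(\<integral>x. g x powr r \<partial>\<pi>) powr (q / r) \<le> ((\<integral>x. g x powr q \<partial>\<pi>) powr ((r - 1) / (q - 1))) powr (q / r)"
      using lyapunov_inequality[OF nn int intq r(1,2)] q r
      by (intro powr_mono2) (auto intro!: Bochner_Integration.integral_nonneg)
    also have "\<dots> = (\<integral>x. g x powr q \<partial>\<pi>) powr (q / (\<beta> + q - 1))"
      using r(3,4) by (simp add: powr_powr)
    finally show "(\<integral>x. g x powr r \<partial>\<pi>) powr (q / r) \<le> (\<integral>x. g x powr q \<partial>\<pi>) powr (q / (\<beta> + q - 1))" .
  qed
  finally show ?thesis .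
qed

text \<open>
  Take logarithms in the hypercontractive estimate for \<open>q = 1 + s\<close>. Both sides vanish at \<open>s = 0\<close>,
  and their derivatives there are the two entropies, the right one divided by \<open>\<beta>\<close>. Jensen bounds
  the left-hand side from below by its derivative, and a second-order expansion bounds the
  right-hand side from above with an error of order \<open>s\<^sup>2\<close>.
\<close>

lemma entropy_contraction_bounded:
  assumes c: "0 < c" and g: "borel_between c C g" and g1: "(\<integral>x. g x \<partial>\<pi>) = 1"
  shows "(\<integral>x. T g x * ln (T g x) \<partial>\<pi>) \<le> (\<integral>x. g x * ln (g x) \<partial>\<pi>) / \<beta>"
proof -
  define \<Lambda> where "\<Lambda> = max \<bar>ln c\<bar> \<bar>ln C\<bar>"
  define K where "K = C * \<Lambda>\<^sup>2 * exp \<Lambda>"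
  have bnd: "0 < v x \<and> \<bar>ln (v x)\<bar> \<le> \<Lambda> \<and> v x \<le> C \<and> v x * (ln (v x))\<^sup>2 * exp \<bar>ln (v x)\<bar> \<le> K"
    if v: "borel_between c C v" for v :: "'a \<Rightarrow> real" and x
  proof -
    note vb = borel_betweenD(2,3)[OF v, of x]
    have pos: "0 < v x" using vb c by linarith
    have "ln c \<le> ln (v x)" "ln (v x) \<le> ln C" using vb c pos by auto
    then have l: "\<bar>ln (v x)\<bar> \<le> \<Lambda>" unfolding \<Lambda>_def by linarith
    then have "(ln (v x))\<^sup>2 \<le> \<Lambda>\<^sup>2" by (intro power2_le_iff_abs_le[THEN iffD2]) auto
    then have "v x * (ln (v x))\<^sup>2 * exp \<bar>ln (v x)\<bar> \<le> K"
      unfolding K_def using vb pos l by (intro mult_mono) auto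
    then show ?thesis using pos l vb by simp
  qed
  have int: "integrable \<pi> h" if "h \<in> borel_measurable borel" "\<And>x. \<bar>h x\<bar> \<le> B" for h :: "'a \<Rightarrow> real" and B
    using that by (intro integrable_const_bound[of _ B]) auto
  have intv: "integrable \<pi> v" if "borel_between c C v" for v
    by (rule integrable_borel_between[OF finite_measure_axioms sets_\<pi> that])
  have intvln: "integrable \<pi> (\<lambda>x. v x * ln (v x))" if v: "borel_between c C v" for v
  proof (rule int)
    have [measurable]: "v \<in> borel_measurable borel" by (rule borel_betweenD[OF v])
    show "(\<lambda>x. v x * ln (v x)) \<in> borel_measurable borel" by measurable
    show "\<bar>v x * ln (v x)\<bar> \<le> C * \<Lambda>" for x
      unfolding abs_mult using bnd[OF v, of x] by (intro mult_mono) auto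
  qed
  have intvq: "integrable \<pi> (\<lambda>x. v x powr q)" if v: "borel_between c C v" and q: "0 \<le> q" for v q
    by (rule integrable_borel_between[OF finite_measure_axioms sets_\<pi> borel_between_powr[OF v less_imp_le[OF c] q]])
  have Tg: "borel_between c C (T g)" by (rule T_between[OF g])
  have gm: "g \<in> borel_measurable borel" by (rule borel_betweenD[OF g])
  have Tg1: "(\<integral>x. T g x \<partial>\<pi>) = 1"
    using T_integral(2)[OF gm _ intv[OF g]] bnd[OF g] g1 by (simp add: less_imp_le)
  define H where "H = (\<integral>x. T g x * ln (T g x) \<partial>\<pi>)"
  define E where "E = (\<integral>x. g x * ln (g x) \<partial>\<pi>)"
  have main: "H / (1 + s) \<le> (E / \<beta> + s * K / \<beta>\<^sup>2) / (1 + s / \<beta>)" if s: "0 < s" "s \<le> 1" for s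
  proof -
    define r where "r = 1 + s / \<beta>"
    have r: "1 < r" "r - 1 \<le> 1" "r - 1 = s / \<beta>" using s \<beta> by (auto simp: r_def)
    have low: "s * H \<le> ln (\<integral>x. T g x powr (1 + s) \<partial>\<pi>)"
    proof -
      have e: "exp (s * ln (T g x)) * T g x = T g x powr (1 + s)" for x
        using bnd[OF Tg, of x] by (simp add: powr_def distrib_right exp_add)
      have "exp (\<integral>x. (s * ln (T g x)) * T g x \<partial>\<pi>) \<le> (\<integral>x. exp (s * ln (T g x)) * T g x \<partial>\<pi>)"
      proof (rule exp_jensen_density[OF _ intv[OF Tg] Tg1])
        show "integrable \<pi> (\<lambda>x. (s * ln (T g x)) * T g x)"
          using integrable_mult_right[OF intvln[OF Tg], of s] by (simp add: mult_ac)
      qed (use intvq[OF Tg, of "1 + s"] s bnd[OF Tg] in \<open>auto simp: e less_imp_le\<close>)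
      then have "exp (s * H) \<le> (\<integral>x. T g x powr (1 + s) \<partial>\<pi>)" unfolding e by (simp add: H_def mult_ac)
      then have "ln (exp (s * H)) \<le> ln (\<integral>x. T g x powr (1 + s) \<partial>\<pi>)" by (intro ln_mono) (auto intro: less_le_trans[OF exp_gt_zero])
      then show ?thesis by simp
    qed
    have up: "(\<integral>x. g x powr r \<partial>\<pi>) \<le> 1 + (r - 1) * E + (r - 1)\<^sup>2 * K"
    proof -
      have "g x powr r \<le> g x + (r - 1) * (g x * ln (g x)) + (r - 1)\<^sup>2 * K" for x
      proof -
        have pos: "0 < g x" using bnd[OF g, of x] by simp
        let ?y = "(r - 1) * ln (g x)"
        have y: "\<bar>?y\<bar> \<le> \<bar>ln (g x)\<bar>" using r(1,2) by (simp only: abs_mult) (intro mult_left_le_one_le; simp)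
        have "exp ?y \<le> 1 + ?y + ?y\<^sup>2 * exp \<bar>?y\<bar>" using exp_remainder[of ?y] by linarith
        also have "\<dots> \<le> 1 + ?y + ?y\<^sup>2 * exp \<bar>ln (g x)\<bar>" using y by (intro add_left_mono mult_left_mono) auto
        finally have "g x * exp ?y \<le> g x * (1 + ?y + ?y\<^sup>2 * exp \<bar>ln (g x)\<bar>)" using pos by (intro mult_left_mono) auto
        also have "\<dots> = g x + (r - 1) * (g x * ln (g x)) + (r - 1)\<^sup>2 * (g x * (ln (g x))\<^sup>2 * exp \<bar>ln (g x)\<bar>)"
          by (subst power_mult_distrib) (simp add: algebra_simps)
        also have "\<dots> \<le> g x + (r - 1) * (g x * ln (g x)) + (r - 1)\<^sup>2 * K"
          using bnd[OF g, of x] by (intro add_left_mono mult_left_mono) auto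
        also have "g x * exp ?y = g x powr r"
        proof -
          have "g x powr r = g x powr (1 + (r - 1))" by simp
          also have "\<dots> = g x * exp ?y" using pos by (subst powr_add) (simp add: powr_def)
          finally show ?thesis by simp
        qed
        finally show ?thesis .
      qed
      then have "(\<integral>x. g x powr r \<partial>\<pi>) \<le> (\<integral>x. g x + (r - 1) * (g x * ln (g x)) + (r - 1)\<^sup>2 * K \<partial>\<pi>)"
        using intv[OF g] intvln[OF g] intvq[OF g, of r] r by (intro integral_mono) auto
      also have "\<dots> = 1 + (r - 1) * E + (r - 1)\<^sup>2 * K"
        using intv[OF g] intvln[OF g] g1 prob_space by (simp add: E_def)
      finally show ?thesis .
    qed
    have pos: "0 < (\<integral>x. v x powr q \<partial>\<pi>)" if v: "borel_between c C v" and q: "0 \<le> q" for v q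
      using c by (intro integral_borel_between_pos[OF prob sets_\<pi> borel_between_powr[OF v less_imp_le[OF c] q]]) simp
    have "(\<integral>x. T g x powr (1 + s) \<partial>\<pi>) powr (1 / (1 + s)) \<le> (\<integral>x. g x powr r \<partial>\<pi>) powr (1 / r)"
      using hyper[of "1 + s", OF _ c g] s by (simp add: r_def T_def)
    moreover have "0 < (\<integral>x. T g x powr (1 + s) \<partial>\<pi>)" "0 < (\<integral>x. g x powr r \<partial>\<pi>)"
      using pos[OF Tg, of "1 + s"] pos[OF g, of r] s r by auto
    ultimately have "ln (\<integral>x. T g x powr (1 + s) \<partial>\<pi>) / (1 + s) \<le> ln (\<integral>x. g x powr r \<partial>\<pi>) / r"
      by (simp add: powr_def)
    also have "\<dots> \<le> ((\<integral>x. g x powr r \<partial>\<pi>) - 1) / r"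
      using r pos[OF g, of r] by (intro divide_right_mono ln_le_minus_one) auto
    also have "\<dots> \<le> ((r - 1) * E + (r - 1)\<^sup>2 * K) / r"
      using up r by (intro divide_right_mono) auto
    finally have "s * H / (1 + s) \<le> ((r - 1) * E + (r - 1)\<^sup>2 * K) / r"
      using divide_right_mono[OF low, of "1 + s"] s by simp
    also have "(r - 1) * E + (r - 1)\<^sup>2 * K = s * (E / \<beta> + s * K / \<beta>\<^sup>2)"
      unfolding r(3) by (simp add: power2_eq_square algebra_simps)
    finally have "s * (H / (1 + s)) \<le> s * ((E / \<beta> + s * K / \<beta>\<^sup>2) / r)" by simp
    then show ?thesis using s unfolding r_def by (simp only: mult_le_cancel_left_pos)
  qed
  have s0: "(\<lambda>n. 1 / (real n + 1)) \<longlonglongrightarrow> 0" by real_asymp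
  have "H / (1 + 0) \<le> (E / \<beta> + 0 * K / \<beta>\<^sup>2) / (1 + 0 / \<beta>)"
  proof (rule LIMSEQ_le)
    show "(\<lambda>n. H / (1 + 1 / (real n + 1))) \<longlonglongrightarrow> H / (1 + 0)" by (intro tendsto_intros s0) auto
    show "(\<lambda>n. (E / \<beta> + (1 / (real n + 1)) * K / \<beta>\<^sup>2) / (1 + (1 / (real n + 1)) / \<beta>)) \<longlonglongrightarrow> (E / \<beta> + 0 * K / \<beta>\<^sup>2) / (1 + 0 / \<beta>)"
      using \<beta> by (intro tendsto_intros s0) auto
    show "\<exists>N. \<forall>n\<ge>N. H / (1 + 1 / (real n + 1)) \<le> (E / \<beta> + (1 / (real n + 1)) * K / \<beta>\<^sup>2) / (1 + (1 / (real n + 1)) / \<beta>)"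
      by (intro exI[of _ 0] allI impI main) auto
  qed
  then show ?thesis by (simp add: H_def E_def)
qed

text \<open>
  The truncations are renormalised to mean one. Their entropies converge by dominated convergence
  and those of their images are lower semicontinuous, by Fatou's lemma for \<open>x ln x + 1 \<ge> 0\<close>.
\<close>

lemma entropy_contraction:
  assumes gm [measurable]: "g \<in> borel_measurable borel" and nn: "\<And>x. 0 \<le> g x"
    and int: "integrable \<pi> g" "(\<integral>x. g x \<partial>\<pi>) = 1"
    and ent: "integrable \<pi> (\<lambda>x. g x * ln (g x))"
  shows "integrable \<pi> (\<lambda>x. T g x * ln (T g x))"
    and "(\<integral>x. T g x * ln (T g x) \<partial>\<pi>) \<le> (\<integral>x. g x * ln (g x) \<partial>\<pi>) / \<beta>"
proof -
  define E where "E = (\<integral>x. g x * ln (g x) \<partial>\<pi>)"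
  define t where "t n = truncate n g" for n
  define m where "m n = (\<integral>x. t n x \<partial>\<pi>)" for n
  have tb: "borel_between (1 / (real n + 1)) (real n + 1) (t n)" for n
    unfolding t_def by (rule borel_between_truncate[OF gm])
  have tm [measurable]: "t n \<in> borel_measurable borel" for n by (rule borel_betweenD[OF tb])
  have tpos: "0 < t n x" for n x unfolding t_def by (rule truncate_bounds)
  have tlim: "(\<lambda>n. t n x) \<longlonglongrightarrow> g x" for x unfolding t_def by (intro tendsto_truncate nn)
  have tint: "integrable \<pi> (t n)" for n
    by (rule integrable_borel_between[OF finite_measure_axioms sets_\<pi> tb])
  have mlim: "m \<longlonglongrightarrow> 1"
    unfolding m_def[abs_def] int(2)[symmetric]
  proof (rule integral_dominated_convergence)
    show "integrable \<pi> (\<lambda>x. g x + 1)" using int(1) by simp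
    show "AE x in \<pi>. norm (t n x) \<le> g x + 1" for n
      using tpos truncate_bounds(4)[of g _ n] nn by (auto simp: t_def abs_of_pos)
  qed (use tlim in auto)
  have mpos: "0 < m n" for n
    unfolding m_def by (rule integral_borel_between_pos[OF prob sets_\<pi> tb]) simp
  have tent: "integrable \<pi> (\<lambda>x. t n x * ln (t n x))" for n
  proof (rule Bochner_Integration.integrable_bound)
    show "integrable \<pi> (\<lambda>x. \<bar>g x * ln (g x)\<bar> + 1)" using ent by simp
    show "AE x in \<pi>. norm (t n x * ln (t n x)) \<le> norm (\<bar>g x * ln (g x)\<bar> + 1)"
      using truncate_xlnx[of g _ _, OF nn[of _]] by (auto simp: t_def)
  qed measurable
  have entlim: "(\<lambda>n. \<integral>x. t n x * ln (t n x) \<partial>\<pi>) \<longlonglongrightarrow> E"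
    unfolding E_def
  proof (rule integral_dominated_convergence)
    show "integrable \<pi> (\<lambda>x. \<bar>g x * ln (g x)\<bar> + 1)" using ent by simp
    show "AE x in \<pi>. (\<lambda>n. t n x * ln (t n x)) \<longlonglongrightarrow> g x * ln (g x)"
      by (intro AE_I2 tendsto_xlnx tlim less_imp_le tpos)
    show "AE x in \<pi>. norm (t n x * ln (t n x)) \<le> \<bar>g x * ln (g x)\<bar> + 1" for n
      using truncate_xlnx[of g _ _, OF nn[of _]] by (auto simp: t_def)
  qed auto
  define u where "u n x = t n x / m n" for n x
  define F where "F n = (\<integral>x. t n x * ln (t n x) \<partial>\<pi>) / m n - ln (m n)" for n
  have F: "(\<integral>x. u n x * ln (u n x) \<partial>\<pi>) = F n" for n
  proof -
    have "u n x * ln (u n x) = (t n x * ln (t n x)) / m n - ln (m n) / m n * t n x" for x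
      using tpos[of n x] mpos[of n] by (simp add: u_def ln_div field_simps)
    then show ?thesis
      using tent[of n] tint[of n] mpos[of n] by (simp add: F_def m_def)
  qed
  have Flim: "F \<longlonglongrightarrow> E / 1 - ln 1"
    unfolding F_def[abs_def] by (intro tendsto_intros entlim mlim) auto
  have ub: "borel_between (1 / (real n + 1) / m n) ((real n + 1) / m n) (u n)" for n
    unfolding borel_between_def u_def[abs_def]
  proof (intro conjI allI)
    show "(\<lambda>x. t n x / m n) \<in> borel_measurable borel" by measurable
    show "1 / (real n + 1) / m n \<le> t n x / m n" "t n x / m n \<le> (real n + 1) / m n" for x
      using borel_betweenD(2,3)[OF tb[of n], of x] mpos[of n] by (simp_all only: divide_right_mono less_imp_le)
  qed
  have u1: "(\<integral>x. u n x \<partial>\<pi>) = 1" for n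
    using mpos[of n] by (simp add: u_def m_def)
  have bounded: "(\<integral>x. T (u n) x * ln (T (u n) x) \<partial>\<pi>) \<le> F n / \<beta>" for n
    unfolding F[symmetric] using mpos[of n] by (intro entropy_contraction_bounded[OF _ ub u1]) auto
  have Tupos: "0 \<le> T (u n) x" for n x
    using tpos mpos by (intro T_nonneg) (simp add: u_def less_imp_le)
  have um [measurable]: "u n \<in> borel_measurable borel" for n by (rule borel_betweenD[OF ub])
  let ?f = "\<lambda>n x. T (u n) x * ln (T (u n) x)"
  have Tuent: "integrable \<pi> (\<lambda>x. ?f n x)" for n
  proof -
    let ?b = "(real n + 1) / m n"
    have le: "T (u n) x \<le> ?b" for x by (rule borel_betweenD(3)[OF T_between[OF ub]])
    have "\<bar>?f n x\<bar> \<le> ?b\<^sup>2 + 1" for x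
      using abs_xlnx_le[OF Tupos[of n x]] power_mono[OF le[of x] Tupos, of 2] by linarith
    then show ?thesis
      by (intro integrable_const_bound[of _ "?b\<^sup>2 + 1"]) auto
  qed
  have E0: "0 \<le> E / \<beta> + 1"
  proof -
    have "(\<integral>x. -1 \<partial>\<pi>) \<le> E" unfolding E_def
      using ent xlnx_bounds(1)[OF nn] by (intro integral_mono) auto
    then have "-1 \<le> E" using prob_space by simp
    then have "- 1 / \<beta> \<le> E / \<beta>" using \<beta> by (intro divide_right_mono) auto
    moreover have "1 / \<beta> \<le> 1" using \<beta> by simp
    ultimately show ?thesis by simp
  qed
  have "(\<integral>\<^sup>+x. ennreal (T g x * ln (T g x) + 1) \<partial>\<pi>) = (\<integral>\<^sup>+x. liminf (\<lambda>n. ennreal (?f n x + 1)) \<partial>\<pi>)"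
  proof (rule nn_integral_cong_AE)
    show "AE x in \<pi>. ennreal (T g x * ln (T g x) + 1) = liminf (\<lambda>n. ennreal (?f n x + 1))"
      using T_truncate[OF gm nn int(1)]
    proof eventually_elim
      case (elim x)
      have "(\<lambda>n. T (t n) x / m n) \<longlonglongrightarrow> T g x / 1"
        using elim unfolding t_def by (intro tendsto_divide mlim) auto
      then have "(\<lambda>n. T (u n) x) \<longlonglongrightarrow> T g x"
        by (simp add: u_def[abs_def] T_divide)
      from tendsto_xlnx[OF this Tupos]
      have "(\<lambda>n. ennreal (?f n x + 1)) \<longlonglongrightarrow> ennreal (T g x * ln (T g x) + 1)"
        by (intro tendsto_ennrealI tendsto_add tendsto_const)
      then show ?case by (rule lim_imp_Liminf[OF sequentially_bot, symmetric])
    qed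
  qed
  also have "\<dots> \<le> liminf (\<lambda>n. \<integral>\<^sup>+x. ennreal (?f n x + 1) \<partial>\<pi>)"
    by (rule nn_integral_liminf) measurable
  also have "\<dots> \<le> liminf (\<lambda>n. ennreal (F n / \<beta> + 1))"
  proof (intro Liminf_mono always_eventually allI)
    fix n
    have "(\<integral>\<^sup>+x. ennreal (?f n x + 1) \<partial>\<pi>) = ennreal (\<integral>x. ?f n x + 1 \<partial>\<pi>)"
    proof (rule nn_integral_eq_integral)
      show "AE x in \<pi>. 0 \<le> ?f n x + 1"
      proof (intro AE_I2)
        show "0 \<le> ?f n x + 1" for x
          using xlnx_bounds(1)[OF Tupos[of n x]] by linarith
      qed
    qed (use Tuent in simp)
    also have "\<dots> \<le> ennreal (F n / \<beta> + 1)"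
      using bounded[of n] Tuent[of n] prob_space by (intro ennreal_leI) simp
    finally show "(\<integral>\<^sup>+x. ennreal (?f n x + 1) \<partial>\<pi>) \<le> ennreal (F n / \<beta> + 1)" .
  qed
  also have "\<dots> = ennreal (E / \<beta> + 1)"
  proof (rule lim_imp_Liminf[OF sequentially_bot], rule tendsto_ennrealI)
    have "(\<lambda>n. F n / \<beta> + 1) \<longlonglongrightarrow> (E / 1 - ln 1) / \<beta> + 1" using \<beta> by (intro tendsto_intros Flim) auto
    then show "(\<lambda>n. F n / \<beta> + 1) \<longlonglongrightarrow> E / \<beta> + 1" by simp
  qed
  finally have fin: "(\<integral>\<^sup>+x. ennreal (T g x * ln (T g x) + 1) \<partial>\<pi>) \<le> ennreal (E / \<beta> + 1)" .
  have nonneg: "0 \<le> T g x * ln (T g x) + 1" for x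
    using xlnx_bounds(1)[OF T_nonneg[of g x, OF nn]] by linarith
  have i: "integrable \<pi> (\<lambda>x. T g x * ln (T g x) + 1)"
    by (rule integrableI_nonneg) (use nonneg fin in \<open>auto intro: le_less_trans[OF fin]\<close>)
  from Bochner_Integration.integrable_diff[OF i integrable_const[of 1]]
  show i': "integrable \<pi> (\<lambda>x. T g x * ln (T g x))" by simp
  have "ennreal (\<integral>x. T g x * ln (T g x) + 1 \<partial>\<pi>) \<le> ennreal (E / \<beta> + 1)"
    using fin nonneg by (simp add: nn_integral_eq_integral[OF i])
  then have "(\<integral>x. T g x * ln (T g x) + 1 \<partial>\<pi>) \<le> E / \<beta> + 1"
    using E0 by (simp add: ennreal_le_iff)
  then show "(\<integral>x. T g x * ln (T g x) \<partial>\<pi>) \<le> (\<integral>x. g x * ln (g x) \<partial>\<pi>) / \<beta>"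
    using i' prob_space by (simp add: E_def)
qed

lemma KL_contraction:
  assumes g [measurable]: "g \<in> borel_measurable borel" and nn: "\<And>x. 0 \<le> g x" and pg: "prob_space (density \<pi> g)"
  shows "KL \<pi> (density \<pi> (T g)) \<le> KL \<pi> (density \<pi> g) / ereal \<beta>"
proof -
  have gm: "g \<in> borel_measurable \<pi>" and Tm: "T g \<in> borel_measurable \<pi>" by measurable
  have int: "integrable \<pi> g" "(\<integral>x. g x \<partial>\<pi>) = 1" using prob_space_density_iff[OF gm nn] pg by auto
  show ?thesis
  proof (cases "integrable \<pi> (\<lambda>x. g x * ln (g x))")
    case True
    note c = entropy_contraction[OF g nn int True]
    show ?thesis
      using True c \<beta> by (simp add: KL_density_real[OF prob gm nn] KL_density_real[OF prob Tm T_nonneg[OF nn]])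
  next
    case False
    then show ?thesis using \<beta> by (simp add: KL_density_real[OF prob gm nn])
  qed
qed

lemma renyi_contraction:
  assumes g [measurable]: "g \<in> borel_measurable borel" and nn: "\<And>x. 0 \<le> g x" and pg: "prob_space (density \<pi> g)"
    and q: "1 < q"
  shows "renyi q \<pi> (density \<pi> (T g)) \<le> renyi q \<pi> (density \<pi> g) / ereal (1 + (\<beta> - 1) / q)"
proof -
  have gm: "g \<in> borel_measurable \<pi>" and Tm: "T g \<in> borel_measurable \<pi>" by measurable
  have int: "integrable \<pi> g" "(\<integral>x. g x \<partial>\<pi>) = 1" using prob_space_density_iff[OF gm nn] pg by auto
  have den: "0 < 1 + (\<beta> - 1) / q" using q \<beta> by (intro add_pos_pos) auto
  show ?thesis
  proof (cases "(\<integral>\<^sup>+x. ennreal (g x powr q) \<partial>\<pi>) = \<infinity>")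
    case True
    then show ?thesis using q den by (simp add: renyi_density[OF prob gm nn])
  next
    case False
    define I where "I = (\<integral>x. g x powr q \<partial>\<pi>)"
    define J where "J = (\<integral>x. T g x powr q \<partial>\<pi>)"
    have iq: "integrable \<pi> (\<lambda>x. g x powr q)"
      using False by (intro integrableI_nonneg) (auto simp: less_top)
    then have I: "(\<integral>\<^sup>+x. ennreal (g x powr q) \<partial>\<pi>) = ennreal I"
      by (simp add: nn_integral_eq_integral I_def)
    have I1: "1 \<le> I" unfolding I_def by (rule integral_powr_ge_1[OF prob nn int iq q])
    note mc = moment_contraction[OF g nn int q iq]
    have jq: "integrable \<pi> (\<lambda>x. T g x powr q)"
      using le_less_trans[OF mc] by (intro integrableI_nonneg) auto
    then have J: "(\<integral>\<^sup>+x. ennreal (T g x powr q) \<partial>\<pi>) = ennreal J"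
      by (simp add: nn_integral_eq_integral J_def)
    have J1: "1 \<le> J" unfolding J_def
      using T_integral[OF g nn int(1)] int(2)
      by (intro integral_powr_ge_1[OF prob T_nonneg _ _ jq q]) (auto simp: nn)
    have "J \<le> I powr (q / (\<beta> + q - 1))"
      using mc unfolding J I_def[symmetric] by (simp add: ennreal_le_iff)
    then have "ln J \<le> ln (I powr (q / (\<beta> + q - 1)))" using J1 by (intro ln_mono) auto
    also have "\<dots> = (q / (\<beta> + q - 1)) * ln I" using I1 by (simp add: ln_powr)
    also have "q / (\<beta> + q - 1) = 1 / (1 + (\<beta> - 1) / q)" using q \<beta> by (simp add: field_simps)
    finally have "1 / (q - 1) * ln J \<le> 1 / (q - 1) * (1 / (1 + (\<beta> - 1) / q) * ln I)"
      using q by (intro mult_left_mono) auto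
    then show ?thesis
      using q den I1 J1 I J by (simp add: renyi_density[OF prob gm nn] renyi_density[OF prob Tm T_nonneg[OF nn]])
  qed
qed

end

section \<open>Reversible pairs of kernels\<close>

text \<open>
  The joint law of \<open>(X, Y)\<close>, disintegrated in both directions. The composite kernel \<open>R\<close> below goes
  from \<open>X\<close> to \<open>Y\<close> and back.
\<close>

locale reversible_kernels =
  fixes \<pi> \<mu> :: "'a::euclidean_space measure" and Q P :: "'a \<Rightarrow> 'a measure"
  assumes prob_\<pi>: "prob_space \<pi>" and prob_\<mu>: "prob_space \<mu>"
    and sets_\<pi> [simp, measurable_cong]: "sets \<pi> = sets borel"
    and sets_\<mu> [simp, measurable_cong]: "sets \<mu> = sets borel"
    and Q: "Q \<in> borel \<rightarrow>\<^sub>M prob_algebra borel" and P: "P \<in> borel \<rightarrow>\<^sub>M prob_algebra borel"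
    and reversible: "\<And>F. F \<in> borel_measurable (borel \<Otimes>\<^sub>M borel) \<Longrightarrow>
      (\<integral>\<^sup>+x. \<integral>\<^sup>+y. F (x, y) \<partial>Q x \<partial>\<pi>) = (\<integral>\<^sup>+y. \<integral>\<^sup>+x. F (x, y) \<partial>P y \<partial>\<mu>)"
begin

lemma Q_subprob [measurable]: "Q \<in> borel \<rightarrow>\<^sub>M subprob_algebra borel"
  and P_subprob [measurable]: "P \<in> borel \<rightarrow>\<^sub>M subprob_algebra borel"
  by (rule measurable_prob_algebraD[OF Q], rule measurable_prob_algebraD[OF P])

definition R where "R x = Q x \<bind> P"

lemma P_measurable_Q: "P \<in> Q x \<rightarrow>\<^sub>M subprob_algebra borel"
  using P_subprob measurable_cong_sets[OF kernel_space(2)[OF Q] refl] by blast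

lemma R_kernel: "R \<in> borel \<rightarrow>\<^sub>M prob_algebra borel"
  unfolding R_def[abs_def] by (rule measurable_bind_prob_space[OF Q P])

lemma nn_integral_R:
  "h \<in> borel_measurable borel \<Longrightarrow> (\<integral>\<^sup>+z. h z \<partial>R x) = (\<integral>\<^sup>+y. \<integral>\<^sup>+z. h z \<partial>P y \<partial>Q x)"
  unfolding R_def by (rule nn_integral_bind[OF _ P_measurable_Q])

lemma emeasure_space_kernel [simp]:
  "emeasure (Q x) (space (Q x)) = 1" "emeasure (P x) (space (P x)) = 1"
  using prob_space.emeasure_space_1[OF kernel_space(1)[OF Q]] prob_space.emeasure_space_1[OF kernel_space(1)[OF P]]
  by auto

lemma invariant:
  assumes [measurable]: "h \<in> borel_measurable borel"
  shows "(\<integral>\<^sup>+x. \<integral>\<^sup>+z. h z \<partial>R x \<partial>\<pi>) = (\<integral>\<^sup>+x. h x \<partial>\<pi>)"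
proof -
  have "(\<integral>\<^sup>+x. \<integral>\<^sup>+z. h z \<partial>R x \<partial>\<pi>) = (\<integral>\<^sup>+x. \<integral>\<^sup>+y. (\<lambda>(x, y). \<integral>\<^sup>+z. h z \<partial>P y) (x, y) \<partial>Q x \<partial>\<pi>)"
    by (simp add: nn_integral_R)
  also have "\<dots> = (\<integral>\<^sup>+y. \<integral>\<^sup>+x. (\<lambda>(x, y). \<integral>\<^sup>+z. h z \<partial>P y) (x, y) \<partial>P y \<partial>\<mu>)"
    by (rule reversible) measurable
  also have "\<dots> = (\<integral>\<^sup>+y. \<integral>\<^sup>+x. (\<lambda>(x, y). h x) (x, y) \<partial>P y \<partial>\<mu>)" by simp
  also have "\<dots> = (\<integral>\<^sup>+x. \<integral>\<^sup>+y. (\<lambda>(x, y). h x) (x, y) \<partial>Q x \<partial>\<pi>)"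
    by (rule reversible[symmetric]) measurable
  finally show ?thesis by simp
qed

text \<open>
  Reversibility is used twice: once to move the initial density to the \<open>Y\<close> side, where it becomes
  \<open>K g\<close>, and once to come back.
\<close>

lemma density_bind:
  fixes g :: "'a \<Rightarrow> ennreal"
  assumes g [measurable]: "g \<in> borel_measurable borel"
  shows "(density \<pi> g \<bind> Q) \<bind> P = density \<pi> (\<lambda>x. \<integral>\<^sup>+z. g z \<partial>R x)"
proof (rule measure_eqI)
  have sp: "space \<pi> = UNIV" using sets_eq_imp_space_eq[OF sets_\<pi>] by simp
  have Q': "Q \<in> density \<pi> g \<rightarrow>\<^sub>M subprob_algebra borel" by measurable
  have s1: "sets (density \<pi> g \<bind> Q) = sets borel"
    using sp by (intro sets_bind) (auto simp: kernel_space[OF Q])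
  have P': "P \<in> (density \<pi> g \<bind> Q) \<rightarrow>\<^sub>M subprob_algebra borel"
    using P_subprob measurable_cong_sets[OF s1 refl] by blast
  have sp1: "space (density \<pi> g \<bind> Q) = UNIV" using sets_eq_imp_space_eq[OF s1] by simp
  have s2: "sets ((density \<pi> g \<bind> Q) \<bind> P) = sets borel"
    using sp1 by (intro sets_bind) (auto simp: kernel_space[OF P])
  show "sets ((density \<pi> g \<bind> Q) \<bind> P) = sets (density \<pi> (\<lambda>x. \<integral>\<^sup>+z. g z \<partial>R x))" using s2 by simp
  fix A assume "A \<in> sets ((density \<pi> g \<bind> Q) \<bind> P)"
  then have A [measurable]: "A \<in> sets borel" using s2 by simp
  have [measurable]: "R \<in> borel \<rightarrow>\<^sub>M subprob_algebra borel" by (rule measurable_prob_algebraD[OF R_kernel])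
  have "emeasure ((density \<pi> g \<bind> Q) \<bind> P) A = (\<integral>\<^sup>+y. emeasure (P y) A \<partial>(density \<pi> g \<bind> Q))"
    using sp1 by (intro emeasure_bind[OF _ P' A]) simp
  also have "\<dots> = (\<integral>\<^sup>+x. \<integral>\<^sup>+y. emeasure (P y) A \<partial>Q x \<partial>density \<pi> g)"
    by (rule nn_integral_bind[OF _ Q']) measurable
  also have "\<dots> = (\<integral>\<^sup>+x. g x * (\<integral>\<^sup>+y. emeasure (P y) A \<partial>Q x) \<partial>\<pi>)"
    by (rule nn_integral_density) measurable
  also have "\<dots> = (\<integral>\<^sup>+x. \<integral>\<^sup>+y. (\<lambda>(x, y). g x * emeasure (P y) A) (x, y) \<partial>Q x \<partial>\<pi>)"
    by (rule nn_integral_cong) (simp add: nn_integral_cmult measurable_cong_sets[OF kernel_space(2)[OF Q] refl])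
  also have "\<dots> = (\<integral>\<^sup>+y. \<integral>\<^sup>+x. (\<lambda>(x, y). g x * emeasure (P y) A) (x, y) \<partial>P y \<partial>\<mu>)"
    by (rule reversible) measurable
  also have "\<dots> = (\<integral>\<^sup>+y. \<integral>\<^sup>+x. (\<lambda>(x, y). (\<integral>\<^sup>+z. g z \<partial>P y) * indicator A x) (x, y) \<partial>P y \<partial>\<mu>)"
    by (rule nn_integral_cong)
       (simp add: nn_integral_cmult nn_integral_multc measurable_cong_sets[OF kernel_space(2)[OF P] refl] kernel_space(2)[OF P])
  also have "\<dots> = (\<integral>\<^sup>+x. \<integral>\<^sup>+y. (\<lambda>(x, y). (\<integral>\<^sup>+z. g z \<partial>P y) * indicator A x) (x, y) \<partial>Q x \<partial>\<pi>)"
    by (rule reversible[symmetric]) measurable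
  also have "\<dots> = (\<integral>\<^sup>+x. (\<integral>\<^sup>+z. g z \<partial>R x) * indicator A x \<partial>\<pi>)"
    by (rule nn_integral_cong)
       (simp add: nn_integral_R nn_integral_multc measurable_cong_sets[OF kernel_space(2)[OF Q] refl])
  also have "\<dots> = emeasure (density \<pi> (\<lambda>x. \<integral>\<^sup>+z. g z \<partial>R x)) A"
    by (subst emeasure_density) auto
  finally show "emeasure ((density \<pi> g \<bind> Q) \<bind> P) A = emeasure (density \<pi> (\<lambda>x. \<integral>\<^sup>+z. g z \<partial>R x)) A" .
qed

lemma integrable_bd:
  assumes "borel_between c C u"
  shows "integrable \<pi> u" "integrable \<mu> u" "integrable (Q x) u" "integrable (P x) u"
  using assms prob_\<pi> prob_\<mu> kernel_space[OF Q, of x] kernel_space[OF P, of x]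
  by (auto intro!: integrable_borel_between[of _ c C] simp: prob_space_def)

lemma adjoint:
  assumes u: "borel_between c C u" "0 \<le> c" and v: "borel_between c' C' v" "0 \<le> c'"
  shows "(\<integral>x. u x * (\<integral>y. v y \<partial>Q x) \<partial>\<pi>) = (\<integral>y. (\<integral>x. u x \<partial>P y) * v y \<partial>\<mu>)"
proof -
  have um [measurable]: "u \<in> borel_measurable borel" and vm [measurable]: "v \<in> borel_measurable borel"
    using borel_betweenD(1) u(1) v(1) by blast+
  have un: "0 \<le> u x" and vn: "0 \<le> v x" for x
    using borel_betweenD(2)[OF u(1), of x] borel_betweenD(2)[OF v(1), of x] u(2) v(2) by auto
  have prod: "borel_between (a * a') (b * b') (\<lambda>x. s x * t x)"
    if "borel_between a b s" "borel_between a' b' t" "0 \<le> a" "0 \<le> a'" for a a' b b' and s t :: "'a \<Rightarrow> real"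
    using that unfolding borel_between_def by (auto intro!: mult_mono intro: order_trans)
  have Qn: "0 \<le> (\<integral>y. v y \<partial>Q x)" and Pn: "0 \<le> (\<integral>y. u y \<partial>P x)" for x
    using un vn by (auto intro: Bochner_Integration.integral_nonneg)
  have "ennreal (\<integral>x. u x * (\<integral>y. v y \<partial>Q x) \<partial>\<pi>) = (\<integral>\<^sup>+x. ennreal (u x * (\<integral>y. v y \<partial>Q x)) \<partial>\<pi>)"
    using integrable_bd(1)[OF prod[OF u(1) kernel_between[OF Q v(1)] u(2) v(2)]] un Qn
    by (intro nn_integral_eq_integral[symmetric]) auto
  also have "\<dots> = (\<integral>\<^sup>+x. \<integral>\<^sup>+y. (\<lambda>(x, y). ennreal (u x) * ennreal (v y)) (x, y) \<partial>Q x \<partial>\<pi>)"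
  proof (rule nn_integral_cong)
    fix x
    have "(\<integral>\<^sup>+y. ennreal (v y) \<partial>Q x) = ennreal (\<integral>y. v y \<partial>Q x)"
      using integrable_bd(3)[OF v(1)] vn by (intro nn_integral_eq_integral) auto
    then show "ennreal (u x * (\<integral>y. v y \<partial>Q x)) = (\<integral>\<^sup>+y. (\<lambda>(x, y). ennreal (u x) * ennreal (v y)) (x, y) \<partial>Q x)"
      using un by (simp add: nn_integral_cmult ennreal_mult' measurable_cong_sets[OF kernel_space(2)[OF Q] refl])
  qed
  also have "\<dots> = (\<integral>\<^sup>+y. \<integral>\<^sup>+x. (\<lambda>(x, y). ennreal (u x) * ennreal (v y)) (x, y) \<partial>P y \<partial>\<mu>)"
    by (rule reversible) measurable
  also have "\<dots> = (\<integral>\<^sup>+y. ennreal ((\<integral>x. u x \<partial>P y) * v y) \<partial>\<mu>)"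
  proof (rule nn_integral_cong)
    fix y
    have "(\<integral>\<^sup>+x. ennreal (u x) \<partial>P y) = ennreal (\<integral>x. u x \<partial>P y)"
      using integrable_bd(4)[OF u(1)] un by (intro nn_integral_eq_integral) auto
    then show "(\<integral>\<^sup>+x. (\<lambda>(x, y). ennreal (u x) * ennreal (v y)) (x, y) \<partial>P y) = ennreal ((\<integral>x. u x \<partial>P y) * v y)"
      using Pn by (simp add: nn_integral_multc ennreal_mult' measurable_cong_sets[OF kernel_space(2)[OF P] refl])
  qed
  also have "\<dots> = ennreal (\<integral>y. (\<integral>x. u x \<partial>P y) * v y \<partial>\<mu>)"
    using integrable_bd(2)[OF prod[OF kernel_between[OF P u(1)] v(1) u(2) v(2)]] vn Pn
    by (intro nn_integral_eq_integral) auto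
  finally show ?thesis
    using un vn Qn Pn by (subst (asm) ennreal_inj) (auto intro!: Bochner_Integration.integral_nonneg)
qed

lemma integral_R:
  assumes "borel_between c C g"
  shows "(\<integral>z. g z \<partial>R x) = (\<integral>y. \<integral>z. g z \<partial>P y \<partial>Q x)"
  unfolding R_def
proof (rule integral_bind[OF borel_betweenD(1)[OF assms] _ P_measurable_Q])
  show "\<bar>g y\<bar> \<le> max \<bar>c\<bar> \<bar>C\<bar>" for y using borel_betweenD(2,3)[OF assms, of y] by auto
  show "finite_measure (Q x)" by (rule prob_space.finite_measure[OF kernel_space(1)[OF Q]])
  show "AE y in Q x. emeasure (P y) (space (P y)) \<le> ennreal 1"
    using prob_space.emeasure_space_1[OF kernel_space(1)[OF P]] by (intro AE_I2) simp
qed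

text \<open>
  Hypercontractivity of \<open>Q\<close> passes to its adjoint \<open>P\<close> by testing \<open>h = P g\<close> against \<open>h\<^bsup>p - 1\<^esup>\<close>: the
  relation \<open>r' - 1 = b (p' - 1)\<close> between the exponents becomes \<open>p - 1 = b (r - 1)\<close> for the
  conjugate ones. Hence going from \<open>X\<close> to \<open>Y\<close> and going back each gain a factor \<open>b\<close> in the
  exponent.
\<close>

lemma hypercontractive_R:
  assumes b: "1 < b"
    and hyper: "\<And>p c C v. 1 < p \<Longrightarrow> 0 < c \<Longrightarrow> borel_between c C v \<Longrightarrow>
      (\<integral>x. (\<integral>y. v y \<partial>Q x) powr (1 + b * (p - 1)) \<partial>\<pi>) powr (1 / (1 + b * (p - 1)))
        \<le> (\<integral>y. v y powr p \<partial>\<mu>) powr (1 / p)"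
  shows "hypercontractive_kernel \<pi> R (b\<^sup>2)"
proof (rule hypercontractive_kernel.intro)
  show "prob_space \<pi>" "sets \<pi> = sets borel" by (rule prob_\<pi>, rule sets_\<pi>)
  show "R \<in> borel \<rightarrow>\<^sub>M prob_algebra borel" by (rule R_kernel)
  show "(\<integral>\<^sup>+x. \<integral>\<^sup>+y. h y \<partial>R x \<partial>\<pi>) = (\<integral>\<^sup>+x. h x \<partial>\<pi>)" if "h \<in> borel_measurable borel" for h
    by (rule invariant[OF that])
  show "1 < b\<^sup>2" using b by simp
  fix q c C :: real and g :: "'a \<Rightarrow> real"
  assume q: "1 < q" and c: "0 < c" and g: "borel_between c C g"
  define p where "p = 1 + (q - 1) / b"
  define r where "r = 1 + (q - 1) / b\<^sup>2"
  define p' where "p' = p / (p - 1)"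
  define r' where "r' = r / (r - 1)"
  have p: "1 < p" "1 + b * (p - 1) = q" using q b by (auto simp: p_def)
  have r: "1 < r" using q b by (simp add: r_def)
  have p': "1 < p'" "1 / p' = 1 - 1 / p" "(p - 1) * p' = p" using p by (auto simp: p'_def field_simps)
  have r': "1 < r'" "1 / r + 1 / r' = 1" using r by (auto simp: r'_def field_simps)
  have pr: "1 + b * (p' - 1) = r'"
    using p r q b by (simp add: p'_def r'_def p_def r_def field_simps power2_eq_square)
  define h where "h y = (\<integral>x. g x \<partial>P y)" for y
  have h: "borel_between c C h" unfolding h_def[abs_def] by (rule kernel_between[OF P g])
  define v where "v y = h y powr (p - 1)" for y
  define d where "d = c powr (p - 1)"
  have d: "0 < d" using c by (simp add: d_def)
  have v: "borel_between d (C powr (p - 1)) v"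
    unfolding v_def[abs_def] d_def using borel_between_powr[OF h] c p by simp
  define Qv where "Qv x = (\<integral>y. v y \<partial>Q x)" for x
  have Qv: "borel_between d (C powr (p - 1)) Qv"
    unfolding Qv_def[abs_def] by (rule kernel_between[OF Q v])
  note pos = integral_borel_between_pos[OF prob_\<pi> sets_\<pi>]
  define A where "A = (\<integral>y. h y powr p \<partial>\<mu>)"
  have hp: "borel_between (c powr p) (C powr p) (\<lambda>y. h y powr p)" using borel_between_powr[OF h] c p by simp
  have A: "0 < A" unfolding A_def using integral_borel_between_pos[OF prob_\<mu> sets_\<mu> hp] c by simp
  have hpos: "0 < h y" for y using borel_betweenD(2)[OF h, of y] c by linarith
  have gr: "borel_between (c powr r) (C powr r) (\<lambda>y. g y powr r)" using borel_between_powr[OF g] c r by simp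
  have Qvr: "borel_between (d powr r') ((C powr (p - 1)) powr r') (\<lambda>y. Qv y powr r')"
    using borel_between_powr[OF Qv] d r' by simp
  have gm: "g \<in> borel_measurable \<pi>" "Qv \<in> borel_measurable \<pi>"
    using borel_betweenD(1)[OF g] borel_betweenD(1)[OF Qv] by measurable
  have "A = (\<integral>y. h y * v y \<partial>\<mu>)"
    unfolding A_def v_def using hpos p by (intro Bochner_Integration.integral_cong refl) (simp add: powr_mult_base less_imp_le)
  also have "\<dots> = (\<integral>x. g x * Qv x \<partial>\<pi>)"
    unfolding h_def Qv_def using c d by (intro adjoint[symmetric, OF g _ v]) auto
  also have "\<dots> \<le> (\<integral>x. g x powr r \<partial>\<pi>) powr (1 / r) * (\<integral>x. Qv x powr r' \<partial>\<pi>) powr (1 / r')"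
  proof (rule Holder_inequality[OF r r' _ _ gm integrable_bd(1)[OF gr] integrable_bd(1)[OF Qvr]])
    show "0 \<le> g x" "0 \<le> Qv x" for x
      using borel_betweenD(2)[OF g, of x] borel_betweenD(2)[OF Qv, of x] c d by auto
    show "0 < (\<integral>x. g x powr r \<partial>\<pi>)" "0 < (\<integral>x. Qv x powr r' \<partial>\<pi>)"
      using pos[OF gr] pos[OF Qvr] c d by auto
  qed
  also have "\<dots> \<le> (\<integral>x. g x powr r \<partial>\<pi>) powr (1 / r) * A powr (1 - 1 / p)"
  proof (rule mult_left_mono)
    have "(\<integral>x. Qv x powr r' \<partial>\<pi>) powr (1 / r') \<le> (\<integral>y. v y powr p' \<partial>\<mu>) powr (1 / p')"
      using hyper[OF p'(1) d v] unfolding pr Qv_def .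
    also have "(\<lambda>y. v y powr p') = (\<lambda>y. h y powr p)" by (simp add: v_def powr_powr p'(3))
    finally show "(\<integral>x. Qv x powr r' \<partial>\<pi>) powr (1 / r') \<le> A powr (1 - 1 / p)" by (simp add: A_def p'(2))
  qed simp
  finally have "A powr (1 / p) * A powr (1 - 1 / p) \<le> (\<integral>x. g x powr r \<partial>\<pi>) powr (1 / r) * A powr (1 - 1 / p)"
    using A by (simp add: powr_add[symmetric])
  then have dual: "A powr (1 / p) \<le> (\<integral>x. g x powr r \<partial>\<pi>) powr (1 / r)"
    using A by (simp add: mult_le_cancel_right)
  have "(\<integral>x. (\<integral>y. h y \<partial>Q x) powr q \<partial>\<pi>) powr (1 / q) \<le> A powr (1 / p)"
    using hyper[OF p(1) c h] unfolding p(2) A_def .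
  also note dual
  finally show "(\<integral>x. (\<integral>y. g y \<partial>R x) powr q \<partial>\<pi>) powr (1 / q)
      \<le> (\<integral>x. g x powr (1 + (q - 1) / b\<^sup>2) \<partial>\<pi>) powr (1 / (1 + (q - 1) / b\<^sup>2))"
    by (simp add: integral_R[OF g] h_def r_def)
qed

end

section \<open>The proximal sampler\<close>

lemma prox_Y_given_X_eq_gauss:
  fixes f :: "'a::euclidean_space \<Rightarrow> real"
  assumes "0 < \<eta>"
  shows "prox_Y_given_X f \<eta> x = density lborel (\<lambda>y. ennreal (gauss_density \<eta> (y - x)))"
proof -
  have "(\<Prod>b\<in>Basis. normal_density (x \<bullet> b) (sqrt \<eta>) (y \<bullet> b)) = gauss_density \<eta> (y - x)" for y
    unfolding gauss_density_eq_prod[OF assms]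
    by (rule prod.cong) (simp_all add: normal_density_def inner_diff_left)
  then show ?thesis by (simp add: prox_Y_given_X_eq_normal[OF assms])
qed

lemma integral_prox_Y_given_X:
  fixes f v :: "'a::euclidean_space \<Rightarrow> real"
  assumes \<eta>: "0 < \<eta>" and [measurable]: "v \<in> borel_measurable borel"
  shows "(\<integral>y. v y \<partial>prox_Y_given_X f \<eta> x) = heat \<eta> v x"
proof -
  have "(\<integral>y. v y \<partial>prox_Y_given_X f \<eta> x) = (\<integral>y. gauss_density \<eta> (y - x) * v y \<partial>lborel)"
    unfolding prox_Y_given_X_eq_gauss[OF \<eta>]
    by (subst integral_real_density) (auto simp: gauss_density_nonneg[OF \<eta>])
  also have "\<dots> = (\<integral>z. gauss_density \<eta> (x + z - x) * v (x + z) \<partial>lborel)"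
    by (rule lborel_integral_translate[symmetric]) measurable
  also have "\<dots> = heat \<eta> v x"
    by (simp add: heat_def integral_gauss[OF \<eta>])
  finally show ?thesis .
qed

lemma integral_lborel_pos:
  fixes w :: "'a::euclidean_space \<Rightarrow> real"
  assumes "integrable lborel w" "\<And>x. 0 < w x"
  shows "0 < (\<integral>x. w x \<partial>lborel)"
proof (rule ccontr)
  assume "\<not> ?thesis"
  moreover have "0 \<le> (\<integral>x. w x \<partial>lborel)"
    using assms(2) by (intro Bochner_Integration.integral_nonneg) (simp add: less_imp_le)
  ultimately have "(\<integral>x. w x \<partial>lborel) = 0" by linarith
  then have "propto w = density lborel (\<lambda>_. 0)" by (simp add: propto_def)
  then have "emeasure (propto w) (space (propto w)) = 0" by (simp add: emeasure_density)
  then show False using prob_space.emeasure_space_1[OF prob_space_propto[OF assms]] by simp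
qed

lemma nn_integral_cmult_ennreal:
  assumes [measurable]: "b \<in> borel_measurable M" "F \<in> borel_measurable M" and "\<And>x. 0 \<le> b x"
  shows "ennreal a * (\<integral>\<^sup>+x. ennreal (b x) * F x \<partial>M) = (\<integral>\<^sup>+x. ennreal (a * b x) * F x \<partial>M)"
  using assms(3) by (subst nn_integral_cmult[symmetric]) (auto simp: ennreal_mult'' mult.assoc)

text \<open>
  Both disintegrations have the same joint Lebesgue density, a multiple of \<^const>\<open>prox_joint\<close>, so
  reversibility is Fubini's theorem.
\<close>

lemma prox_reversible:
  fixes f :: "'a::euclidean_space \<Rightarrow> real"
  assumes f [measurable]: "f \<in> borel_measurable borel" and fi: "integrable lborel (\<lambda>x. exp (- f x))"
    and \<eta>: "0 < \<eta>"
  obtains \<mu> where "reversible_kernels (target f) \<mu> (prox_Y_given_X f \<eta>) (prox_X_given_Y f \<eta>)"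
proof -
  define Z where "Z = (\<integral>x. exp (- f x) \<partial>lborel)"
  define N where "N = (1 / sqrt (2 * pi * \<eta>)) ^ DIM('a)"
  define J where "J y = (\<integral>x. prox_joint f \<eta> x y \<partial>lborel)" for y
  have Z: "0 < Z" unfolding Z_def by (rule integral_lborel_pos[OF fi]) simp
  have N: "0 < N" using \<eta> by (simp add: N_def)
  have J: "0 < J y" for y
    unfolding J_def by (rule integral_lborel_pos[OF integrable_prox_joint_X[OF \<eta> fi f]]) (simp add: prox_joint_def)
  have jm [measurable]: "(\<lambda>p. prox_joint f \<eta> (fst p) (snd p)) \<in> borel_measurable (borel \<Otimes>\<^sub>M borel)"
    unfolding prox_joint_def by measurable
  have jm2 [measurable]: "(\<lambda>x. prox_joint f \<eta> x y) \<in> borel_measurable borel" for y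
    unfolding prox_joint_def by measurable
  have jm3 [measurable]: "(\<lambda>(y, x). prox_joint f \<eta> x y) \<in> borel_measurable (borel \<Otimes>\<^sub>M lborel)"
    unfolding prox_joint_def by measurable
  have Jm [measurable]: "J \<in> borel_measurable borel"
    unfolding J_def[abs_def] by measurable
  have jpos: "0 < prox_joint f \<eta> x y" for x y by (simp add: prox_joint_def)
  have jG: "exp (- f x) * gauss_density \<eta> (y - x) = N * prox_joint f \<eta> x y" for x y
    by (simp add: gauss_density_def prox_joint_def N_def exp_add[symmetric] norm_minus_commute)
  define \<mu> where "\<mu> = density lborel (\<lambda>y. ennreal (N * J y / Z))"
  have prob_\<pi>: "prob_space (target f)"
    unfolding target_def by (rule prob_space_propto[OF fi]) simp
  have rev: "(\<integral>\<^sup>+x. \<integral>\<^sup>+y. F (x, y) \<partial>prox_Y_given_X f \<eta> x \<partial>target f) = (\<integral>\<^sup>+y. \<integral>\<^sup>+x. F (x, y) \<partial>prox_X_given_Y f \<eta> y \<partial>\<mu>)"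
    if F [measurable]: "F \<in> borel_measurable (borel \<Otimes>\<^sub>M borel)" for F
  proof -
    let ?G = "\<lambda>x. \<integral>\<^sup>+y. ennreal (gauss_density \<eta> (y - x)) * F (x, y) \<partial>lborel"
    let ?H = "\<lambda>y. \<integral>\<^sup>+x. ennreal (prox_joint f \<eta> x y / J y) * F (x, y) \<partial>lborel"
    let ?j = "\<lambda>x y. ennreal (N * prox_joint f \<eta> x y / Z) * F (x, y)"
    have "(\<integral>\<^sup>+x. \<integral>\<^sup>+y. F (x, y) \<partial>prox_Y_given_X f \<eta> x \<partial>target f)
        = (\<integral>\<^sup>+x. ?G x \<partial>target f)"
      unfolding prox_Y_given_X_eq_gauss[OF \<eta>]
      by (intro nn_integral_cong nn_integral_density) auto
    also have "\<dots> = (\<integral>\<^sup>+x. ennreal (exp (- f x) / Z) * ?G x \<partial>lborel)"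
      unfolding target_def propto_def Z_def[symmetric]
      by (rule nn_integral_density) measurable
    also have "\<dots> = (\<integral>\<^sup>+x. \<integral>\<^sup>+y. ?j x y \<partial>lborel \<partial>lborel)"
    proof (rule nn_integral_cong)
      fix x :: 'a
      have eq: "exp (- f x) / Z * gauss_density \<eta> (y - x) = N * prox_joint f \<eta> x y / Z" for y
        using jG[of x y] by simp
      have "ennreal (exp (- f x) / Z) * ?G x
          = (\<integral>\<^sup>+y. ennreal (exp (- f x) / Z * gauss_density \<eta> (y - x)) * F (x, y) \<partial>lborel)"
        by (rule nn_integral_cmult_ennreal) (auto simp: gauss_density_nonneg[OF \<eta>])
      then show "ennreal (exp (- f x) / Z) * ?G x
          = (\<integral>\<^sup>+y. ?j x y \<partial>lborel)"
        by (simp only: eq)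
    qed
    also have "\<dots> = (\<integral>\<^sup>+y. \<integral>\<^sup>+x. ?j x y \<partial>lborel \<partial>lborel)"
      by (rule lborel_pair.Fubini'[symmetric]) measurable
    also have "\<dots> = (\<integral>\<^sup>+y. ennreal (N * J y / Z) * ?H y \<partial>lborel)"
    proof (rule nn_integral_cong)
      fix y :: 'a
      have "N * J y / Z * (prox_joint f \<eta> x y / J y) = N * prox_joint f \<eta> x y / Z" for x
        using J[of y] by simp
      then show "(\<integral>\<^sup>+x. ?j x y \<partial>lborel)
          = ennreal (N * J y / Z) * ?H y"
        using J[of y] jpos by (subst nn_integral_cmult_ennreal) (auto simp: less_imp_le)
    qed
    also have "\<dots> = (\<integral>\<^sup>+y. ?H y \<partial>\<mu>)"
      unfolding \<mu>_def by (rule nn_integral_density[symmetric]) measurable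
    also have "\<dots> = (\<integral>\<^sup>+y. \<integral>\<^sup>+x. F (x, y) \<partial>prox_X_given_Y f \<eta> y \<partial>\<mu>)"
      unfolding prox_X_given_Y_def propto_def J_def[symmetric]
      by (intro nn_integral_cong nn_integral_density[symmetric]) auto
    finally show ?thesis .
  qed
  have Q: "prox_Y_given_X f \<eta> \<in> borel \<rightarrow>\<^sub>M prob_algebra borel" by (rule measurable_prox_Y_given_X[OF \<eta> f])
  have P: "prox_X_given_Y f \<eta> \<in> borel \<rightarrow>\<^sub>M prob_algebra borel" by (rule measurable_prox_X_given_Y[OF \<eta> fi f])
  have "prob_space \<mu>"
  proof (rule prob_spaceI)
    have "(\<integral>\<^sup>+x. \<integral>\<^sup>+y. 1 \<partial>prox_Y_given_X f \<eta> x \<partial>target f) = (\<integral>\<^sup>+y. \<integral>\<^sup>+x. 1 \<partial>prox_X_given_Y f \<eta> y \<partial>\<mu>)"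
      by (rule rev) measurable
    then show "emeasure \<mu> (space \<mu>) = 1"
      by (simp add: prob_space.emeasure_space_1[OF kernel_space(1)[OF Q]]
          prob_space.emeasure_space_1[OF kernel_space(1)[OF P]] prob_space.emeasure_space_1[OF prob_\<pi>])
  qed
  then have "reversible_kernels (target f) \<mu> (prox_Y_given_X f \<eta>) (prox_X_given_Y f \<eta>)"
    by (intro reversible_kernels.intro prob_\<pi> Q P rev) (auto simp: \<mu>_def target_def)
  then show thesis by (rule that)
qed

text \<open>
  Hypercontractivity is available for every \<open>b\<close> strictly below \<open>1 + \<alpha> \<eta>\<close>; the end point is reached
  by continuity of the rate.
\<close>

lemma ereal_le_limit_from_below:
  fixes F :: "real \<Rightarrow> real" and X Y :: ereal
  assumes F: "isCont F B" and B: "1 < B" and Fpos: "\<And>b. 1 < b \<Longrightarrow> 0 < F b"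
    and le: "\<And>b. 1 < b \<Longrightarrow> b < B \<Longrightarrow> X \<le> Y / ereal (F b)"
  shows "X \<le> Y / ereal (F B)"
proof (cases Y)
  case (real y)
  have "X \<le> Y / ereal (F ((1 + B) / 2))" using B by (intro le) auto
  also have "\<dots> < \<infinity>" using real Fpos[of "(1 + B) / 2"] B by simp
  finally consider "X = - \<infinity>" | x where "X = ereal x" by (cases X) auto
  then show ?thesis
  proof cases
    case 2
    have "x \<le> y / F B"
    proof (rule tendsto_lowerbound)
      show "((\<lambda>b. y / F b) \<longlongrightarrow> y / F B) (at_left B)"
        using F Fpos[OF B] by (intro tendsto_divide) (auto simp: isCont_def filterlim_at_split)
      have "x \<le> y / F b" if "1 < b" "b < B" for b
        using le[OF that] Fpos[OF that(1)] 2 real by simp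
      then show "\<forall>\<^sub>F b in at_left B. x \<le> y / F b"
        using eventually_at_left[OF B] B by auto
    qed simp
    then show ?thesis using 2 real Fpos[OF B] by simp
  qed simp
next
  case PInf
  then show ?thesis using Fpos[OF B] by simp
next
  case MInf
  have "X \<le> Y / ereal (F ((1 + B) / 2))" using B by (intro le) auto
  also have "\<dots> = - \<infinity>" using MInf Fpos[of "(1 + B) / 2"] B by simp
  finally show ?thesis by simp
qed

lemma renyi_nonneg:
  assumes "prob_space M" "prob_space \<rho>" "sets \<rho> = sets M" "1 < q"
  shows "0 \<le> renyi q M \<rho>"
proof (cases "absolutely_continuous M \<rho>")
  case True
  interpret prob_space M by fact
  obtain g where g: "g \<in> borel_measurable M" "\<And>x. 0 \<le> g x" "\<rho> = density M (\<lambda>x. ennreal (g x))"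
    using real_density_exists[OF assms(1-3) True] by blast
  note int = prob_space_density_iff[OF g(1,2)]
  show ?thesis
  proof (cases "(\<integral>\<^sup>+x. ennreal (g x powr q) \<partial>M) = \<infinity>")
    case True
    then show ?thesis using assms(4) g by (simp add: renyi_density[OF assms(1) g(1,2)])
  next
    case False
    have iq: "integrable M (\<lambda>x. g x powr q)"
      using False g(1) by (intro integrableI_nonneg) (auto simp: less_top)
    have "1 \<le> (\<integral>x. g x powr q \<partial>M)"
      using int assms(2) unfolding g(3) by (intro integral_powr_ge_1[OF assms(1) g(2) _ _ iq assms(4)]) auto
    then show ?thesis
      using assms(4) False iq g(3) by (simp add: renyi_density[OF assms(1) g(1,2)] nn_integral_eq_integral)
  qed
qed (use assms in \<open>simp add: renyi_def\<close>)

lemma prox_step: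
  fixes f :: "'a::euclidean_space \<Rightarrow> real"
  assumes f: "f \<in> borel_measurable borel" and fi: "integrable lborel (\<lambda>x. exp (- f x))"
    and \<alpha>: "0 < \<alpha>" and lsi: "LSI \<alpha> (target f)" and \<eta>: "0 < \<eta>"
    and \<rho>: "prob_space \<rho>" and s\<rho>: "sets \<rho> = sets borel"
  defines "\<rho>' \<equiv> (\<rho> \<bind> prox_Y_given_X f \<eta>) \<bind> prox_X_given_Y f \<eta>"
  shows "KL (target f) \<rho>' \<le> KL (target f) \<rho> / ereal ((1 + \<alpha> * \<eta>)\<^sup>2)"
    and "1 < q \<Longrightarrow> renyi q (target f) \<rho>' \<le> renyi q (target f) \<rho> / ereal ((1 + \<alpha> * \<eta>) powr (2 / q))"
proof -
  define B where "B = 1 + \<alpha> * \<eta>"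
  have B: "1 < B" using \<alpha> \<eta> by (simp add: B_def)
  obtain \<mu> where "reversible_kernels (target f) \<mu> (prox_Y_given_X f \<eta>) (prox_X_given_Y f \<eta>)"
    by (rule prox_reversible[OF f fi \<eta>])
  then interpret reversible_kernels "target f" \<mu> "prox_Y_given_X f \<eta>" "prox_X_given_Y f \<eta>" .
  have hc: "hypercontractive_kernel (target f) R (b\<^sup>2)" if b: "1 < b" "b < B" for b
  proof (rule hypercontractive_R[OF b(1)])
    fix p c C :: real and v :: "'a \<Rightarrow> real"
    assume p: "1 < p" and c: "0 < c" and v: "borel_between c C v"
    have vp: "borel_between (c powr p) (C powr p) (\<lambda>x. v x powr p)" using borel_between_powr[OF v] c p by simp
    have one: "borel_between 1 1 (\<lambda>x::'a. 1)" by (simp add: borel_between_def)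
    have "(\<integral>x. heat \<eta> v x powr (1 + b * (p - 1)) \<partial>target f) powr (1 / (1 + b * (p - 1)))
        \<le> (\<integral>x. heat \<eta> (\<lambda>z. v z powr p) x \<partial>target f) powr (1 / p)"
      using b by (intro heat_hypercontractivity[OF prob_\<pi> sets_\<pi> lsi \<alpha> \<eta> p _ _ v c]) (auto simp: B_def)
    also have "(\<integral>x. heat \<eta> (\<lambda>z. v z powr p) x \<partial>target f) = (\<integral>y. v y powr p \<partial>\<mu>)"
      using adjoint[OF one _ vp] c prob_space.prob_space[OF kernel_space(1)[OF P]]
      by (simp add: integral_prox_Y_given_X[OF \<eta> borel_betweenD(1)[OF vp]])
    finally show "(\<integral>x. (\<integral>y. v y \<partial>prox_Y_given_X f \<eta> x) powr (1 + b * (p - 1)) \<partial>target f) powr (1 / (1 + b * (p - 1)))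
        \<le> (\<integral>y. v y powr p \<partial>\<mu>) powr (1 / p)"
      by (simp add: integral_prox_Y_given_X[OF \<eta> borel_betweenD(1)[OF v]])
  qed
  \<comment> \<open>If \<open>\<rho>\<close> is not absolutely continuous, both bounds are infinite.\<close>
  have main: "KL (target f) \<rho>' \<le> KL (target f) \<rho> / ereal (b\<^sup>2)
      \<and> (1 < q \<longrightarrow> renyi q (target f) \<rho>' \<le> renyi q (target f) \<rho> / ereal (1 + (b\<^sup>2 - 1) / q))"
    if b: "1 < b" "b < B" for b q
  proof (cases "absolutely_continuous (target f) \<rho>")
    case True
    interpret S: hypercontractive_kernel "target f" R "b\<^sup>2" by (rule hc[OF b])
    obtain g where g: "g \<in> borel_measurable (target f)" "\<And>x. 0 \<le> g x" "\<rho> = density (target f) (\<lambda>x. ennreal (g x))"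
      using real_density_exists[OF prob_\<pi> \<rho> _ True] s\<rho> by (auto simp: target_def)
    have gm [measurable]: "g \<in> borel_measurable borel"
      using g(1) measurable_cong_sets[OF sets_\<pi> refl] by blast
    have pg: "prob_space (density (target f) g)" using \<rho> g(3) by simp
    have int: "integrable (target f) g" using prob_space_density_iff[OF g(1,2)] pg by simp
    have "\<rho>' = density (target f) (\<lambda>x. \<integral>\<^sup>+z. ennreal (g z) \<partial>R x)"
      unfolding \<rho>'_def g(3) by (rule density_bind) measurable
    also have "\<dots> = density (target f) (S.T g)"
    proof (rule density_cong)
      have [measurable]: "R \<in> borel \<rightarrow>\<^sub>M subprob_algebra borel" by (rule measurable_prob_algebraD[OF R_kernel])
      show "(\<lambda>x. \<integral>\<^sup>+z. ennreal (g z) \<partial>R x) \<in> borel_measurable (target f)" by measurable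
      show "(\<lambda>x. ennreal (S.T g x)) \<in> borel_measurable (target f)" by measurable
      show "AE x in target f. (\<integral>\<^sup>+z. ennreal (g z) \<partial>R x) = ennreal (S.T g x)"
        using S.AE_nn_integral_R[OF gm g(2) int] by eventually_elim simp
    qed
    finally have eq: "\<rho>' = density (target f) (S.T g)" .
    show ?thesis
      using S.KL_contraction[OF gm g(2) pg] S.renyi_contraction[OF gm g(2) pg] unfolding eq g(3) by blast
  next
    case False
    have "0 < b\<^sup>2" "0 \<le> b\<^sup>2 - 1" using b by auto
    then show ?thesis using False
      by (auto simp: KL_def renyi_def intro: add_nonneg_nonneg)
  qed
  show "KL (target f) \<rho>' \<le> KL (target f) \<rho> / ereal ((1 + \<alpha> * \<eta>)\<^sup>2)"
    unfolding B_def[symmetric]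
  proof (rule ereal_le_limit_from_below[where F = "\<lambda>b. b\<^sup>2", OF _ B])
    show "isCont (\<lambda>b. b\<^sup>2) B" by (intro continuous_intros)
    show "0 < b\<^sup>2" if "1 < b" for b :: real using that by simp
    show "KL (target f) \<rho>' \<le> KL (target f) \<rho> / ereal (b\<^sup>2)" if "1 < b" "b < B" for b
      using main[OF that] by (rule conjunct1)
  qed
  assume q: "1 < q"
  have "renyi q (target f) \<rho>' \<le> renyi q (target f) \<rho> / ereal (1 + (B\<^sup>2 - 1) / q)"
  proof (rule ereal_le_limit_from_below[where F = "\<lambda>b. 1 + (b\<^sup>2 - 1) / q", OF _ B])
    show "isCont (\<lambda>b. 1 + (b\<^sup>2 - 1) / q) B" using q by (intro continuous_intros) auto
    show "0 < 1 + (b\<^sup>2 - 1) / q" if "1 < b" for b :: real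
    proof -
      have "1 < b\<^sup>2" using that by simp
      then show ?thesis using q by (intro add_pos_nonneg divide_nonneg_pos) auto
    qed
    show "renyi q (target f) \<rho>' \<le> renyi q (target f) \<rho> / ereal (1 + (b\<^sup>2 - 1) / q)" if "1 < b" "b < B" for b
      using conjunct2[OF main[OF that, of q]] q by (rule mp)
  qed
  also have "\<dots> \<le> renyi q (target f) \<rho> / ereal (B powr (2 / q))"
  proof (cases "renyi q (target f) \<rho> = 0")
    case False
    show ?thesis
    proof (rule ereal_divide_left_mono)
      have "B powr (2 / q) = (1 + (B\<^sup>2 - 1)) powr (1 / q)"
      proof -
        have "(1 + (B\<^sup>2 - 1)) powr (1 / q) = (B powr 2) powr (1 / q)" using B by simp
        then show ?thesis by (simp only: powr_powr) simp
    qed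
      also have "\<dots> \<le> 1 + (B\<^sup>2 - 1) / q" using B q by (intro bernoulli_powr) auto
      finally show "ereal (B powr (2 / q)) \<le> ereal (1 + (B\<^sup>2 - 1) / q)" by simp
      show "0 < renyi q (target f) \<rho>"
        using renyi_nonneg[OF prob_\<pi> \<rho> _ q] s\<rho> False by simp
      show "0 < ereal (1 + (B\<^sup>2 - 1) / q) * ereal (B powr (2 / q))"
      proof -
        have "0 < 1 + (B\<^sup>2 - 1) / q" using B q by (intro add_pos_nonneg divide_nonneg_pos) auto
        then show ?thesis using B by simp
    qed
    qed
  qed simp
  finally show "renyi q (target f) \<rho>' \<le> renyi q (target f) \<rho> / ereal ((1 + \<alpha> * \<eta>) powr (2 / q))"
    by (simp add: B_def)
qed

lemma prob_space_prox_law: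
  fixes f :: "'a::euclidean_space \<Rightarrow> real"
  assumes f: "f \<in> borel_measurable borel" and fi: "integrable lborel (\<lambda>x. exp (- f x))" and \<eta>: "0 < \<eta>"
    and \<rho>: "prob_space \<rho>" "sets \<rho> = sets borel"
  shows "prob_space (prox_law f \<eta> \<rho> k) \<and> sets (prox_law f \<eta> \<rho> k) = sets borel"
proof (induction k)
  case (Suc k)
  let ?M = "prox_law f \<eta> \<rho> k"
  have "?M \<in> space (prob_algebra borel)" using Suc by (simp add: space_prob_algebra)
  then have "?M \<bind> prox_Y_given_X f \<eta> \<in> space (prob_algebra borel)"
    using prob_space_bind'[OF _ measurable_prox_Y_given_X[OF \<eta> f]] sets_bind'[OF _ measurable_prox_Y_given_X[OF \<eta> f]]
    by (simp add: space_prob_algebra)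
  then have "(?M \<bind> prox_Y_given_X f \<eta>) \<bind> prox_X_given_Y f \<eta> \<in> space (prob_algebra borel)"
    using prob_space_bind'[OF _ measurable_prox_X_given_Y[OF \<eta> fi f]] sets_bind'[OF _ measurable_prox_X_given_Y[OF \<eta> fi f]]
    by (simp add: space_prob_algebra)
  then show ?case by (simp add: space_prob_algebra)
qed (use \<rho> in simp)

lemma ereal_divide_divide:
  fixes x :: ereal and a b :: real
  assumes "0 < a" "0 < b"
  shows "x / ereal a / ereal b = x / ereal (a * b)"
  using assms by (cases x) auto

theorem theorem3:
  fixes f :: "'a::euclidean_space \<Rightarrow> real"
    and \<alpha> \<eta> :: real
    and \<rho>\<^sub>0 :: "'a measure"
    and k :: nat
  assumes "f \<in> borel_measurable borel"
    and "integrable lborel (\<lambda>x. exp (- f x))"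
    and "integrable (target f) (\<lambda>x. (norm x)\<^sup>2)"
    and "\<alpha> > 0"
    and "LSI \<alpha> (target f)"
    and "\<eta> > 0"
    and "prob_space \<rho>\<^sub>0"
    and "sets \<rho>\<^sub>0 = sets borel"
  shows "KL (target f) (prox_law f \<eta> \<rho>\<^sub>0 k)
           \<le> KL (target f) \<rho>\<^sub>0 / ereal ((1 + \<alpha> * \<eta>) ^ (2 * k))
       \<and> (\<forall>q\<ge>1. renyi q (target f) (prox_law f \<eta> \<rho>\<^sub>0 k)
           \<le> renyi q (target f) \<rho>\<^sub>0 / ereal ((1 + \<alpha> * \<eta>) powr (2 * real k / q)))"
proof -
  define B where "B = 1 + \<alpha> * \<eta>"
  have B: "0 < B" using assms(4,6) by (simp add: B_def add_pos_pos)
  note law = prob_space_prox_law[OF assms(1,2,6,7,8)]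
  note step = prox_step[OF assms(1,2,4,5,6) conjunct1[OF law] conjunct2[OF law], folded B_def]
  have KL: "KL (target f) (prox_law f \<eta> \<rho>\<^sub>0 k) \<le> KL (target f) \<rho>\<^sub>0 / ereal (B ^ (2 * k))"
  proof (induction k)
    case (Suc k)
    have "KL (target f) (prox_law f \<eta> \<rho>\<^sub>0 (Suc k)) \<le> KL (target f) (prox_law f \<eta> \<rho>\<^sub>0 k) / ereal (B\<^sup>2)"
      using step(1) by simp
    also have "\<dots> \<le> KL (target f) \<rho>\<^sub>0 / ereal (B ^ (2 * k)) / ereal (B\<^sup>2)"
      using B Suc by (intro ereal_divide_right_mono) auto
    also have "\<dots> = KL (target f) \<rho>\<^sub>0 / ereal (B ^ (2 * k) * B\<^sup>2)"
      using B by (intro ereal_divide_divide) auto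
    also have "B ^ (2 * k) * B\<^sup>2 = B ^ (2 * Suc k)" by (simp add: power_add[symmetric])
    finally show ?case .
  qed (simp flip: one_ereal_def)
  have renyi: "renyi q (target f) (prox_law f \<eta> \<rho>\<^sub>0 k) \<le> renyi q (target f) \<rho>\<^sub>0 / ereal (B powr (2 * real k / q))"
    if q: "1 < q" for q
  proof (induction k)
    case 0
    then show ?case using B by (simp flip: one_ereal_def)
  next
    case (Suc k)
    have "renyi q (target f) (prox_law f \<eta> \<rho>\<^sub>0 (Suc k)) \<le> renyi q (target f) (prox_law f \<eta> \<rho>\<^sub>0 k) / ereal (B powr (2 / q))"
      using step(2)[OF q] by simp
    also have "\<dots> \<le> renyi q (target f) \<rho>\<^sub>0 / ereal (B powr (2 * real k / q)) / ereal (B powr (2 / q))"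
      using B Suc by (intro ereal_divide_right_mono) auto
    also have "\<dots> = renyi q (target f) \<rho>\<^sub>0 / ereal (B powr (2 * real k / q) * B powr (2 / q))"
      using B by (intro ereal_divide_divide) auto
    also have "B powr (2 * real k / q) * B powr (2 / q) = B powr (2 * real (Suc k) / q)"
      by (simp add: powr_add[symmetric] add_divide_distrib[symmetric] algebra_simps)
    finally show ?case .
  qed
  have "renyi 1 (target f) (prox_law f \<eta> \<rho>\<^sub>0 k) \<le> renyi 1 (target f) \<rho>\<^sub>0 / ereal (B powr (2 * real k / 1))"
  proof -
    have "B powr (2 * real k / 1) = B ^ (2 * k)" using B powr_realpow[of B "2 * k"] by simp
    then show ?thesis using KL by (simp add: renyi_def)
  qed
  with renyi KL show ?thesis
    unfolding B_def[symmetric] by (metis order_le_less)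
qed

end
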